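(* There exists a time homogeneous Markov process $\mathbf M=(\boldsymbol\Omega,\mathbf F,(\mathbf F_t)_{t\ge0},(\boldsymbol\theta_t)_{t\ge0},(\mathbf P_\gamma)_{\gamma\in\Gamma_X},(\mathbf X_t)_{t\ge0})$ on the state space $(\Gamma_X,\mathcal B(\Gamma_X))$ with transition probability function $(\mathbf P_t)_{t\ge0}$ whose sample paths are cadlag in $\Gamma_X$: here $\boldsymbol\Omega=D([0,\infty),\Gamma_X)$ is the space of right-continuous maps $[0,\infty)\to\Gamma_X$ with left limits on $(0,\infty)$, $\mathbf F$ its cylinder $\sigma$-algebra, $\mathbf X_t(\omega)=\omega(t)$, $\mathbf F_t=\sigma(\mathbf X_s,0\le s\le t)$, $(\boldsymbol\theta_t\omega)(s)=\omega(s+t)$, and for every $\gamma\in\Gamma_X$ (every starting configuration, not only almost every) $\mathbf P_\gamma$ is a probability measure on $(\boldsymbol\Omega,\mathbf F)$ with $\mathbf P_\gamma(\mathbf X_0=\gamma)=1$ and $$\mathbf P_\gamma(\mathbf X_{t_1}\in A_1,\dots,\mathbf X_{t_n}\in A_n)=\int_{A_1}\mathbf P_{t_1}(\gamma,d\gamma_1)\int_{A_2}\mathbf P_{t_2-t_1}(\gamma_1,d\gamma_2)\cdots\int_{A_n}\mathbf P_{t_n-t_{n-1}}(\gamma_{n-1},d\gamma_n)$$ for all $0<t_1<\dots<t_n$, $A_i\in\mathcal B(\Gamma_X)$. Moreover, such a process with cadlag paths is unique (the measures $\mathbf P_\gamma$ on $(\boldsymbol\Omega,\mathbf F)$ are uniquely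 determined).
   Context: $X$ is a locally compact second countable Hausdorff space, $m$ a non-atomic Radon measure on $X$. $\Gamma_X$ is the space of locally finite subsets of $X$, identified with $\sum_{x\in\gamma}\varepsilon_x$, with the vague topology (which is metrizable) and Borel $\sigma$-algebra $\mathcal B(\Gamma_X)$. $\pi_{zm}$ is the Poisson measure on $\Gamma_X$ with intensity $zm$. For $t>0$, $\mathbf P_t(\gamma,\cdot)$ is the law of $\eta_1+\eta_2$, where $\eta_1=\sum_{x\in\gamma}a(x)\varepsilon_x$ with $(a(x))_{x\in\gamma}$ i.i.d. $\{0,1\}$-valued, $P(a(x)=1)=e^{-t}$, and $\eta_2\sim\pi_{(1-e^{-t})m}$ independent of $\eta_1$; $\mathbf P_0(\gamma,\cdot)=\varepsilon_\gamma$. $(\mathbf P_t)_{t\ge0}$ is a Markov semigroup of kernels on $\Gamma_X$. *)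

theory Defs
  imports "HOL-Probability.Probability"
begin

text \<open>Locally finite subsets of X (identified with simple counting measures).\<close>
definition config_space :: "'a::topological_space set set" ("\<Gamma>") where
  "\<Gamma> = {\<gamma>. \<forall>K. compact K \<longrightarrow> finite (\<gamma> \<inter> K)}"

definition Cc :: "('a::topological_space \<Rightarrow> real) set" where
  "Cc = {f. continuous_on UNIV f \<and> compact (closure {x. f x \<noteq> 0})}"

definition pair_conf :: "('a \<Rightarrow> real) \<Rightarrow> 'a set \<Rightarrow> real" where
  "pair_conf f \<gamma> = (\<Sum>x\<in>{x\<in>\<gamma>. f x \<noteq> 0}. f x)"

definition vague_topology :: "'a::topological_space set topology" where
  "vague_topology = topology_generated_by
     {{\<gamma>\<in>\<Gamma>. pair_conf f \<gamma> \<in> U} | f U. f \<in> Cc \<and> open U}"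

definition conf_borel :: "'a::topological_space set measure" where
  "conf_borel = sigma \<Gamma> {U. openin vague_topology U}"

definition is_poisson_measure ::
  "('a::topological_space set \<Rightarrow> real) \<Rightarrow> 'a set measure \<Rightarrow> bool" where
  "is_poisson_measure \<mu> PiMeas \<longleftrightarrow> prob_space PiMeas \<and> sets PiMeas = sets conf_borel \<and>
    (\<forall>n::nat. \<forall>B::nat \<Rightarrow> 'a set. \<forall>k::nat \<Rightarrow> nat.
      (\<forall>i<n. B i \<in> sets borel \<and> compact (closure (B i))) \<longrightarrow>
      (\<forall>i<n. \<forall>j<n. i \<noteq> j \<longrightarrow> B i \<inter> B j = {}) \<longrightarrow>
      measure PiMeas {\<gamma>\<in>\<Gamma>. \<forall>i<n. card (\<gamma> \<inter> B i) = k i} =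
        (\<Prod>i<n. exp (- \<mu> (B i)) * \<mu> (B i) ^ k i / fact (k i)))"

definition poisson_measure :: "real \<Rightarrow> 'a::topological_space measure \<Rightarrow> 'a set measure" where
  "poisson_measure z m = (THE PiMeas. is_poisson_measure (\<lambda>B. z * measure m B) PiMeas)"

definition thinning :: "real \<Rightarrow> 'a::topological_space set \<Rightarrow> 'a set measure" where
  "thinning p \<gamma> = distr (PiM \<gamma> (\<lambda>_. measure_pmf (bernoulli_pmf p))) conf_borel
      (\<lambda>a. {x\<in>\<gamma>. a x})"

definition transition :: "'a::topological_space measure \<Rightarrow> real \<Rightarrow> 'a set \<Rightarrow> 'a set measure" where
  "transition m t \<gamma> = (if t = 0 then return conf_borel \<gamma> else
     distr (thinning (exp (- t)) \<gamma> \<Otimes>\<^sub>M poisson_measure (1 - exp (- t)) m) conf_borel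
       (\<lambda>(\<eta>1, \<eta>2). \<eta>1 \<union> \<eta>2))"

definition cadlag_paths :: "(real \<Rightarrow> 'a::topological_space set) set" where
  "cadlag_paths = {\<omega>. (\<forall>t. t < 0 \<longrightarrow> \<omega> t = {}) \<and> (\<forall>t\<ge>0. \<omega> t \<in> \<Gamma>) \<and>
     (\<forall>t\<ge>0. limitin vague_topology \<omega> (\<omega> t) (at_right t)) \<and>
     (\<forall>t>0. \<exists>l. limitin vague_topology \<omega> l (at_left t))}"

definition path_sigma :: "real set \<Rightarrow> (real \<Rightarrow> 'a::topological_space set) measure" where
  "path_sigma T = sigma cadlag_paths
     {{\<omega>\<in>cadlag_paths. \<omega> t \<in> A} | t A. t \<in> T \<and> A \<in> sets conf_borel}"

abbreviation path_F :: "(real \<Rightarrow> 'a::topological_space set) measure" where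
  "path_F \<equiv> path_sigma {0..}"

abbreviation path_Ft :: "real \<Rightarrow> (real \<Rightarrow> 'a::topological_space set) measure" where
  "path_Ft t \<equiv> path_sigma {0..t}"

definition shift :: "real \<Rightarrow> (real \<Rightarrow> 'a set) \<Rightarrow> (real \<Rightarrow> 'a set)" where
  "shift t \<omega> = (\<lambda>s. if s \<ge> 0 then \<omega> (s + t) else {})"

fun fdd :: "'a::topological_space measure \<Rightarrow> 'a set \<Rightarrow> real \<Rightarrow> (real \<times> 'a set set) list \<Rightarrow> ennreal" where
  "fdd m \<gamma> s [] = 1"
| "fdd m \<gamma> s ((t, A) # rest) =
     (\<integral>\<^sup>+ \<gamma>1. indicator A \<gamma>1 * fdd m \<gamma>1 t rest \<partial>(transition m (t - s) \<gamma>))"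

definition process_law :: "'a::topological_space measure \<Rightarrow> ('a set \<Rightarrow> (real \<Rightarrow> 'a set) measure) \<Rightarrow> bool" where
  "process_law m P \<longleftrightarrow> (\<forall>\<gamma>\<in>\<Gamma>.
     prob_space (P \<gamma>) \<and> sets (P \<gamma>) = sets path_F \<and>
     emeasure (P \<gamma>) {\<omega>\<in>cadlag_paths. \<omega> 0 = \<gamma>} = 1 \<and>
     (\<forall>ts::(real \<times> 'a set set) list.
        sorted_wrt (<) (map fst ts) \<longrightarrow> (\<forall>(t, A)\<in>set ts. 0 < t \<and> A \<in> sets conf_borel) \<longrightarrow>
        emeasure (P \<gamma>) {\<omega>\<in>cadlag_paths. \<forall>(t, A)\<in>set ts. \<omega> t \<in> A} = fdd m \<gamma> 0 ts))"

definition markov_family :: "('a::topological_space set \<Rightarrow> (real \<Rightarrow> 'a set) measure) \<Rightarrow> bool" where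
  "markov_family P \<longleftrightarrow>
     (\<forall>B\<in>sets path_F. (\<lambda>\<gamma>. emeasure (P \<gamma>) B) \<in> borel_measurable conf_borel) \<and>
     (\<forall>\<gamma>\<in>\<Gamma>. \<forall>t\<ge>0. \<forall>A\<in>sets (path_Ft t). \<forall>B\<in>sets path_F.
        emeasure (P \<gamma>) (A \<inter> (shift t -` B \<inter> cadlag_paths)) =
          (\<integral>\<^sup>+ \<omega>. indicator A \<omega> * emeasure (P (\<omega> t)) B \<partial>(P \<gamma>)))"

end

theory Submission
  imports Defs
begin

text \<open>The process is built graphically. The particles of the initial configuration get independent
  exponential lifetimes, and independently of them new particles \<open>(x, b, l)\<close> (position, birth time,
  lifetime) form a Poisson process of intensity \<open>m \<otimes> db \<otimes> Exp(1)\<close>; the state at time \<open>t\<close> is the set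
  of positions of the particles alive at \<open>t\<close>. On a compact set and a bounded time interval only
  finitely many particles occur, so every path is cadlag, whatever the initial configuration.

  Laws on \<open>\<Gamma>\<close> are identified through void events \<open>\<gamma> \<inter> B = {}\<close> with \<open>B\<close> relatively compact. They form a
  \<open>\<pi>\<close>-system that generates the Borel sets of the vague topology (Renyi): disjoint small compact sets
  around its points recover the number of points of \<open>\<gamma>\<close> in \<open>B\<close>. For lists of void events
  both the graphical construction and the iterated transition kernels are explicit: the kernels
  map \<open>\<Prod>x\<in>\<gamma>. g x\<close> to a constant times \<open>\<Prod>x\<in>\<gamma>. 1 - exp (- t) * (1 - g x)\<close>, and the constructed process
  factorises over particles. Replacing the void events by arbitrary
  Borel sets one coordinate at a time gives the finite-dimensional distributions; the Markov property
  and uniqueness follow since cylinders form a \<open>\<pi>\<close>-system.\<close>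

section \<open>The vague topology and its Borel sets\<close>

text \<open>A configuration is a set, so a union stands for the sum of two counting measures and
  would lose multiplicities. Void events do not see multiplicities, hence the particle construction
  can be analysed without showing that positions are distinct. Non-atomicity enters through the
  Poisson measure, whose sampled points must almost surely be distinct, and through the kernels,
  where these points must avoid the surviving configuration. As \<open>poisson_measure\<close> is a
  definite description, existence and uniqueness of the Poisson measure have to be settled before
  any statement about the kernels. The intensity \<open>1 - exp (- t)\<close> is the mass of the
  particles born in \<open>(0, t]\<close> that are alive at \<open>t\<close>, the integral of
  \<open>exp (- (t - b))\<close> over the birth time \<open>b\<close>. The Markov property is not
  read off from the particles: memorylessness of the lifetimes only makes the void probabilities of
  particles and kernels agree, and the rest is deduced from the finite-dimensional
  distributions.\<close>

definition compact_base :: "'a::topological_space set set" where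
  "compact_base = (SOME \<C>. countable \<C> \<and> (\<forall>C\<in>\<C>. compact C) \<and>
     (\<forall>x W. open W \<longrightarrow> x \<in> W \<longrightarrow> (\<exists>C\<in>\<C>. x \<in> interior C \<and> C \<subseteq> W)))"

lemma config_spaceD: "\<gamma> \<in> \<Gamma> \<Longrightarrow> compact K \<Longrightarrow> finite (\<gamma> \<inter> K)"
  by (auto simp: config_space_def)

lemma config_space_subset: "\<gamma> \<in> \<Gamma> \<Longrightarrow> \<eta> \<subseteq> \<gamma> \<Longrightarrow> \<eta> \<in> \<Gamma>"
  unfolding config_space_def by (auto intro: rev_finite_subset)

lemma config_space_Un: "\<gamma> \<in> \<Gamma> \<Longrightarrow> \<eta> \<in> \<Gamma> \<Longrightarrow> \<gamma> \<union> \<eta> \<in> \<Gamma>"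
  unfolding config_space_def by (auto simp: Int_Un_distrib2)

lemma empty_in_config_space [simp]: "{} \<in> \<Gamma>"
  by (simp add: config_space_def)

lemma config_space_rel_compact:
  "\<gamma> \<in> \<Gamma> \<Longrightarrow> compact (closure B) \<Longrightarrow> finite (\<gamma> \<inter> B)"
  using config_spaceD[of \<gamma> "closure B"] closure_subset[of B]
  by (auto intro: rev_finite_subset)

lemma Cc_support:
  assumes "f \<in> Cc" obtains K where "compact K" "\<And>x. f x \<noteq> 0 \<Longrightarrow> x \<in> K"
  using assms closure_subset[of "{x. f x \<noteq> 0}"] unfolding Cc_def by auto

lemma topspace_vague [simp]: "topspace vague_topology = (\<Gamma> :: 'a::topological_space set set)"
proof -
  have "(\<lambda>x. 0) \<in> (Cc :: ('a \<Rightarrow> real) set)"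
    by (auto simp: Cc_def)
  then have "\<Gamma> \<in> {{\<gamma>\<in>\<Gamma>. pair_conf f \<gamma> \<in> U} | f U. (f :: 'a \<Rightarrow> real) \<in> Cc \<and> open U}"
    by (auto intro!: exI[of _ "\<lambda>x::'a. 0"] exI[of _ "UNIV::real set"])
  then show ?thesis
    unfolding vague_topology_def topology_generated_by_topspace by (auto 4 3)
qed

lemma openin_vague_subset: "openin vague_topology U \<Longrightarrow> U \<subseteq> \<Gamma>"
  using openin_subset by fastforce

lemma space_conf_borel [simp]: "space conf_borel = \<Gamma>"
  unfolding conf_borel_def by (auto simp: space_measure_of_conv)

lemma sets_conf_borel: "sets conf_borel = sigma_sets \<Gamma> {U. openin vague_topology U}"
  unfolding conf_borel_def using openin_vague_subset by (intro sets_measure_of) auto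

text \<open>Particles never move, so this strong form of convergence is available: a test function
  sees only a compact set, on which the configuration is eventually constant, so each
  \<open>pair_conf f (w s)\<close> eventually equals its limit. Induction on
  \<open>generate_topology_on\<close> passes from subbasic to arbitrary open sets.\<close>

lemma limitin_vague:
  fixes l :: "'a::topological_space set"
  assumes l: "l \<in> \<Gamma>" and w: "eventually (\<lambda>s. w s \<in> \<Gamma>) F"
    and K: "\<And>K. compact K \<Longrightarrow> eventually (\<lambda>s. w s \<inter> K = l \<inter> K) F"
  shows "limitin vague_topology w l F"
  unfolding limitin_def
proof (intro conjI allI impI)
  fix U :: "'a set set" assume "openin vague_topology U \<and> l \<in> U"
  then have "generate_topology_on {{\<gamma>\<in>\<Gamma>. pair_conf f \<gamma> \<in> U} | f U. (f :: 'a \<Rightarrow> real) \<in> Cc \<and> open U} U" "l \<in> U"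
    by (auto simp: vague_topology_def openin_topology_generated_by_iff)
  then show "eventually (\<lambda>s. w s \<in> U) F"
  proof induct
    case (Int a b)
    then show ?case by (auto intro: eventually_conj)
  next
    case (UN \<K>)
    then obtain k where "k \<in> \<K>" "l \<in> k" by auto
    with UN(2)[OF this] show ?case by (auto elim: eventually_mono)
  next
    case (Basis s)
    then obtain f and V :: "real set" where f: "f \<in> Cc" and s: "s = {\<gamma>\<in>\<Gamma>. pair_conf f \<gamma> \<in> V}" by auto
    obtain K where Kc: "compact K" and sub: "\<And>x. f x \<noteq> 0 \<Longrightarrow> x \<in> K" using Cc_support[OF f] by blast
    have "pair_conf f (w t) = pair_conf f l" if "w t \<inter> K = l \<inter> K" for t
    proof -
      have "{x \<in> w t. f x \<noteq> 0} = {x \<in> l. f x \<noteq> 0}" using that sub by blast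
      then show ?thesis by (simp add: pair_conf_def)
    qed
    moreover have "pair_conf f l \<in> V" using Basis s by auto
    ultimately have "w t \<in> s" if "w t \<in> \<Gamma> \<and> w t \<inter> K = l \<inter> K" for t
      using that by (auto simp: s)
    then show ?case
      using eventually_conj[OF w K[OF Kc]] 
      by (elim eventually_mono) (auto simp: s)
  qed simp
qed (use l in simp)

lemma Hausdorff_euclidean: "Hausdorff_space (euclidean :: 'a::t2_space topology)"
  using hausdorff by (fastforce simp: Hausdorff_space_def disjnt_def)

section \<open>Countably many compact neighbourhoods\<close>

locale vague_space =
  fixes X :: "'a::{t2_space, second_countable_topology} itself"
  assumes lc: "locally_compact_space (euclidean :: 'a topology)"
begin

text \<open>The family consists of the compact closures of members of a countable basis. Local
  compactness provides a compact neighbourhood inside \<open>W\<close>, and a basic set inside it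
  has its closure there too. Countability later turns coverings into countable unions of
  events.\<close>

lemma compact_base:
  "countable (compact_base :: 'a set set)"
  "C \<in> (compact_base :: 'a set set) \<Longrightarrow> compact C"
  "open W \<Longrightarrow> x \<in> W \<Longrightarrow> \<exists>C\<in>(compact_base :: 'a set set). x \<in> interior C \<and> C \<subseteq> W"
proof -
  have nb: "neighbourhood_base_of (compactin euclidean) (euclidean :: 'a topology)"
    using lc locally_compact_space_neighbourhood_base[of "euclidean :: 'a topology"]
    by (simp add: Hausdorff_euclidean)
  obtain \<B> :: "'a set set" where \<B>: "countable \<B>" "topological_basis \<B>"
    using ex_countable_basis by blast
  let ?C = "{closure B | B. B \<in> \<B> \<and> compact (closure B)}"
  have "\<exists>C\<in>?C. x \<in> interior C \<and> C \<subseteq> W" if W: "open W" "x \<in> W" for x W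
  proof -
    obtain U V where UV: "openin euclidean U" "compactin euclidean V" "x \<in> U" "U \<subseteq> V" "V \<subseteq> W"
      using nb W unfolding neighbourhood_base_of by (metis open_openin)
    then have V: "open U" "compact V" by auto
    obtain B where B: "B \<in> \<B>" "x \<in> B" "B \<subseteq> U"
      using topological_basisE[OF \<B>(2) V(1) UV(3)] by blast
    have cl: "closure B \<subseteq> V" using B UV V compact_imp_closed by (intro closure_minimal) auto
    then have "compact (closure B)"
      by (metis V(2) closed_closure compact_Int_closed inf.absorb_iff2)
    moreover have "x \<in> interior (closure B)"
      using B topological_basis_open[OF \<B>(2)] closure_subset by (meson interiorI)
    ultimately show ?thesis using B cl UV by (intro bexI[of _ "closure B"]) auto
  qed
  moreover have "countable ?C"
    by (rule countable_subset[of _ "closure ` \<B>"]) (use \<B> in auto)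
  ultimately have "\<exists>\<C>. countable \<C> \<and> (\<forall>C\<in>\<C>. compact C) \<and>
     (\<forall>x W. open W \<longrightarrow> x \<in> W \<longrightarrow> (\<exists>C\<in>\<C>. (x::'a) \<in> interior C \<and> C \<subseteq> W))"
    by (intro exI[of _ ?C]) auto
  from someI_ex[OF this, folded compact_base_def]
  show "countable (compact_base :: 'a set set)"
    "C \<in> (compact_base :: 'a set set) \<Longrightarrow> compact C"
    "open W \<Longrightarrow> x \<in> W \<Longrightarrow> \<exists>C\<in>(compact_base :: 'a set set). x \<in> interior C \<and> C \<subseteq> W"
    by blast+
qed

lemma rel_compact_subset:
  "B \<subseteq> K \<Longrightarrow> compact K \<Longrightarrow> compact (closure (B :: 'a set))"
  by (metis closed_closure closure_minimal compact_Int_closed compact_imp_closed inf.absorb_iff2)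

lemma compact_cover:
  assumes "compact (K :: 'a set)" "\<And>x. x \<in> K \<Longrightarrow> \<exists>C\<in>\<C>. x \<in> interior C"
  shows "\<exists>\<V>\<subseteq>\<C>. finite \<V> \<and> K \<subseteq> (\<Union>C\<in>\<V>. interior C)"
proof -
  have "K \<subseteq> (\<Union>C\<in>\<C>. interior C)" using assms by blast
  from compactE_image[OF assms(1) _ this] show ?thesis by (metis open_interior)
qed

text \<open>Around a point outside \<open>\<gamma>\<close>, a compact neighbourhood contains only
  finitely many points of \<open>\<gamma>\<close>, and these can be removed.\<close>

lemma config_closed:
  assumes "\<gamma> \<in> \<Gamma>" shows "closed (\<gamma> :: 'a set)"
proof -
  have "\<exists>T. open T \<and> x \<in> T \<and> T \<subseteq> - \<gamma>" if x: "x \<notin> \<gamma>" for x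
  proof -
    obtain C where C: "C \<in> compact_base" "x \<in> interior C" using compact_base(3)[of UNIV x] by auto
    have "finite (\<gamma> \<inter> C)" using config_spaceD[OF assms] compact_base(2) C by blast
    then have "open (interior C - (\<gamma> \<inter> C))" by (intro open_Diff finite_imp_closed) auto
    then show ?thesis
      using C x interior_subset by (intro exI[of _ "interior C - (\<gamma> \<inter> C)"]) auto
  qed
  then show ?thesis unfolding closed_def by (subst open_subopen) auto
qed

lemma config_Diff_open: "\<gamma> \<in> \<Gamma> \<Longrightarrow> F \<subseteq> \<gamma> \<Longrightarrow> open (- (\<gamma> - F) :: 'a set)"
  using config_closed[of "\<gamma> - F"] config_space_subset[of \<gamma> "\<gamma> - F"] by (auto simp: closed_def)

text \<open>The sets \<open>W\<close> vary in the induction because the neighbourhoods of the old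
  points must shrink again to leave room for the new one: Hausdorff separation gives
  \<open>U x\<close> around the new point and \<open>V x\<close> around each old point.\<close>

lemma separate_finite:
  assumes "finite (F :: 'a set)" "\<And>x. x \<in> F \<Longrightarrow> open (W x) \<and> x \<in> W x"
  shows "\<exists>c. (\<forall>x\<in>F. c x \<in> compact_base \<and> x \<in> interior (c x) \<and> c x \<subseteq> W x) \<and> disjoint_family_on c F"
  using assms
proof (induct arbitrary: W)
  case empty
  then show ?case by (auto simp: disjoint_family_on_def)
next
  case (insert a F)
  have "\<exists>U V. open U \<and> open V \<and> a \<in> U \<and> x \<in> V \<and> U \<inter> V = {}" if "x \<in> F" for x
    using that insert(2) by (intro hausdorff) auto
  then obtain U V where UV: "\<And>x. x \<in> F \<Longrightarrow> open (U x) \<and> open (V x) \<and> a \<in> U x \<and> x \<in> V x \<and> U x \<inter> V x = {}"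
    by metis
  have "open (W a \<inter> (\<Inter>x\<in>F. U x))" "a \<in> W a \<inter> (\<Inter>x\<in>F. U x)"
    using UV insert by (auto intro!: open_Int open_INT)
  from compact_base(3)[OF this] obtain A where A: "A \<in> compact_base" "a \<in> interior A" "A \<subseteq> W a" "\<And>x. x \<in> F \<Longrightarrow> A \<subseteq> U x" by blast
  obtain c where c: "\<And>x. x \<in> F \<Longrightarrow> c x \<in> compact_base \<and> x \<in> interior (c x) \<and> c x \<subseteq> W x \<inter> V x" and d: "disjoint_family_on c F"
    using insert(3)[of "\<lambda>x. W x \<inter> V x"] UV insert(4) by (metis IntI insertI2 open_Int)
  have "A \<inter> c x = {}" if "x \<in> F" for x using UV[OF that] c[OF that] A(4)[OF that] by blast
  then have "disjoint_family_on (c(a := A)) (insert a F)"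
    using d insert(2) unfolding disjoint_family_on_def by (auto split: if_splits)
  moreover have "\<forall>x\<in>insert a F. (c(a := A)) x \<in> compact_base \<and> x \<in> interior ((c(a := A)) x) \<and> (c(a := A)) x \<subseteq> W x"
    using A c insert(2) by auto
  ultimately show ?case by blast
qed

section \<open>Measurability of void events and of counts\<close>

abbreviation void :: "'a set \<Rightarrow> 'a set set" where
  "void B \<equiv> {\<gamma>\<in>\<Gamma>. \<gamma> \<inter> B = {}}"

text \<open>There are at least \<open>k\<close> points in \<open>B\<close> iff \<open>k\<close>
  pairwise disjoint members of the compact base each catch one, so counting reduces to countably
  many void events. The map \<open>Y\<close> is general because the lemma serves both the identity
  on configurations and maps whose measurability is still to be shown.\<close>

lemma measurable_count:
  assumes fin: "\<And>\<omega>. \<omega> \<in> space M \<Longrightarrow> finite (Y \<omega> \<inter> B)"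
    and void: "\<And>C. C \<in> (compact_base :: 'a set set) \<Longrightarrow> {\<omega>\<in>space M. Y \<omega> \<inter> (B \<inter> C) = {}} \<in> sets M"
  shows "(\<lambda>\<omega>. card (Y \<omega> \<inter> B)) \<in> measurable M (count_space UNIV)"
proof -
  let ?T = "\<lambda>k. {\<V>. \<V> \<subseteq> (compact_base :: 'a set set) \<and> finite \<V> \<and> card \<V> = k \<and> disjoint \<V>}"
  have eq: "k \<le> card (Y \<omega> \<inter> B) \<longleftrightarrow> (\<exists>\<V>\<in>?T k. \<forall>C\<in>\<V>. Y \<omega> \<inter> (B \<inter> C) \<noteq> {})" if \<omega>: "\<omega> \<in> space M" for k \<omega>
  proof
    assume "k \<le> card (Y \<omega> \<inter> B)"
    then obtain F where F: "F \<subseteq> Y \<omega> \<inter> B" "card F = k" "finite F"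
      by (metis obtain_subset_with_card_n)
    obtain c where c: "\<And>x. x \<in> F \<Longrightarrow> c x \<in> compact_base \<and> x \<in> interior (c x)" "disjoint_family_on c F"
      using separate_finite[OF F(3), of "\<lambda>_. UNIV"] by auto
    have x: "x \<in> c x" if "x \<in> F" for x using c(1)[OF that] interior_subset by blast
    have "inj_on c F"
      using c(2) x unfolding inj_on_def disjoint_family_on_def by (metis IntI empty_iff)
    moreover have "disjoint (c ` F)"
      using disjoint_family_on_disjoint_image[OF c(2)] .
    ultimately show "\<exists>\<V>\<in>?T k. \<forall>C\<in>\<V>. Y \<omega> \<inter> (B \<inter> C) \<noteq> {}"
      using F c(1) x by (intro bexI[of _ "c ` F"]) (auto simp: card_image)
  next
    assume "\<exists>\<V>\<in>?T k. \<forall>C\<in>\<V>. Y \<omega> \<inter> (B \<inter> C) \<noteq> {}"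
    then obtain \<V> where V: "finite \<V>" "card \<V> = k" "disjoint \<V>" "\<And>C. C \<in> \<V> \<Longrightarrow> \<exists>x. x \<in> Y \<omega> \<inter> (B \<inter> C)"
      by blast
    then obtain p where p: "\<And>C. C \<in> \<V> \<Longrightarrow> p C \<in> Y \<omega> \<inter> (B \<inter> C)" by metis
    have "inj_on p \<V>"
    proof (rule inj_onI)
      fix C D assume "C \<in> \<V>" "D \<in> \<V>" "p C = p D"
      then have "C \<inter> D \<noteq> {}" using p by (metis IntD2 IntI empty_iff)
      then show "C = D" using V(3) \<open>C \<in> \<V>\<close> \<open>D \<in> \<V>\<close> by (meson disjointD)
    qed
    then have "card \<V> \<le> card (Y \<omega> \<inter> B)"
      using p fin[OF \<omega>] by (intro card_inj_on_le[of p]) auto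
    then show "k \<le> card (Y \<omega> \<inter> B)" using V by simp
  qed
  have ct: "countable (?T k)" for k
    by (rule countable_subset[OF _ countable_Collect_finite_subset[OF compact_base(1)]]) auto
  have [measurable]: "{\<omega>\<in>space M. k \<le> card (Y \<omega> \<inter> B)} \<in> sets M" for k
  proof -
    have "{\<omega>\<in>space M. k \<le> card (Y \<omega> \<inter> B)} = {\<omega>\<in>space M. \<exists>\<V>\<in>?T k. \<forall>C\<in>\<V>. Y \<omega> \<inter> (B \<inter> C) \<noteq> {}}"
      using eq by auto
    also have "\<dots> \<in> sets M"
    proof (rule sets.sets_Collect_countable_Ex'[OF _ ct], rule sets.sets_Collect_finite_All)
      fix \<V> C assume "\<V> \<in> ?T k" "C \<in> \<V>"
      then have "{\<omega>\<in>space M. Y \<omega> \<inter> (B \<inter> C) = {}} \<in> sets M" by (intro void) auto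
      from sets.compl_sets[OF this] show "{\<omega>\<in>space M. Y \<omega> \<inter> (B \<inter> C) \<noteq> {}} \<in> sets M"
        by (rule back_subst[where P="\<lambda>A. A \<in> sets M"]) auto
    qed auto
    finally show ?thesis .
  qed
  show ?thesis
  proof (rule measurableI)
    fix A assume "A \<in> sets (count_space (UNIV::nat set))"
    have "(\<lambda>\<omega>. card (Y \<omega> \<inter> B)) -` A \<inter> space M =
      (\<Union>k\<in>A. {\<omega>\<in>space M. k \<le> card (Y \<omega> \<inter> B)} - {\<omega>\<in>space M. Suc k \<le> card (Y \<omega> \<inter> B)})"
      using le_antisym not_less_eq_eq by (auto simp: not_less_eq_eq[symmetric] le_antisym)
    also have "\<dots> \<in> sets M" by (intro sets.countable_UN') auto
    finally show "(\<lambda>\<omega>. card (Y \<omega> \<inter> B)) -` A \<inter> space M \<in> sets M" .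
  qed simp
qed

text \<open>Meeting \<open>V\<close> is a vaguely open condition: a bump function at a point of the
  configuration in \<open>V\<close>, with support in \<open>V\<close>, detects it. Complete
  regularity of locally compact Hausdorff spaces supplies the bump.\<close>

lemma measurable_void_open:
  assumes V: "open V" shows "void V \<in> sets conf_borel"
proof -
  have "\<exists>T. openin vague_topology T \<and> \<gamma> \<in> T \<and> T \<subseteq> {\<gamma>\<in>\<Gamma>. \<gamma> \<inter> V \<noteq> {}}"
    if \<gamma>: "\<gamma> \<in> \<Gamma>" "\<gamma> \<inter> V \<noteq> {}" for \<gamma>
  proof -
    obtain x where x: "x \<in> \<gamma>" "x \<in> V" using \<gamma> by blast
    obtain C where C: "C \<in> compact_base" "x \<in> interior C" "C \<subseteq> V" using compact_base(3)[OF V x(2)] by blast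
    have "completely_regular_space (euclidean :: 'a topology)"
      using lc by (intro locally_compact_regular_imp_completely_regular_space) (auto simp: Hausdorff_euclidean)
    then obtain h :: "'a \<Rightarrow> real" where h: "continuous_map euclidean euclideanreal h" "h x = 0" "h ` (UNIV - interior C) \<subseteq> {1}"
      unfolding completely_regular_space_alt' using C(2) by (metis open_interior open_openin topspace_euclidean)
    \<comment> \<open>\<open>h\<close> vanishes at \<open>x\<close> and is 1 off
      \<open>interior C\<close>; reversing and truncating it gives a nonnegative function that
      vanishes outside \<open>C\<close>.\<close>
    define f where "f = (\<lambda>y. max 0 (1 - h y))"
    have sub: "y \<in> C" if "f y \<noteq> 0" for y
    proof (rule ccontr)
      assume "y \<notin> C"
      then have "h y = 1" using h(3) interior_subset[of C] by blast
      then show False using that by (simp add: f_def)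
    qed
    have f: "f \<in> Cc"
      using h(1) sub rel_compact_subset[of "{x. f x \<noteq> 0}" C] compact_base(2)[OF C(1)]
      by (auto simp: Cc_def f_def intro!: continuous_intros)
    have "f x = 1" using h by (simp add: f_def)
    have "pair_conf f \<gamma> \<ge> f x"
      unfolding pair_conf_def
    proof (rule member_le_sum)
      show "finite {x \<in> \<gamma>. f x \<noteq> 0}"
        by (rule finite_subset[OF _ config_spaceD[OF \<gamma>(1) compact_base(2)[OF C(1)]]]) (use sub in auto)
    qed (use x \<open>f x = 1\<close> in \<open>auto simp: f_def\<close>)
    \<comment> \<open>Any threshold works that lies strictly between 0, the value for configurations
      missing \<open>V\<close>, and \<open>f x = 1\<close>.\<close>
    moreover have "\<gamma>' \<inter> V \<noteq> {}" if "pair_conf f \<gamma>' > 1/2" for \<gamma>'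
    proof (rule ccontr)
      assume "\<not> \<gamma>' \<inter> V \<noteq> {}"
      then have "{x\<in>\<gamma>'. f x \<noteq> 0} = {}" using sub C by blast
      then show False using that by (simp add: pair_conf_def)
    qed
    moreover have "openin vague_topology {\<gamma>\<in>\<Gamma>. pair_conf f \<gamma> \<in> {1/2<..}}"
      unfolding vague_topology_def openin_topology_generated_by_iff
      by (rule generate_topology_on.Basis, rule CollectI, rule exI[of _ f], rule exI[of _ "{1/2<..}"]) (use f in simp)
    ultimately show ?thesis using \<gamma> \<open>f x = 1\<close>
      by (intro exI[of _ "{\<gamma>\<in>\<Gamma>. pair_conf f \<gamma> \<in> {1/2<..}}"]) auto
  qed
  then have "openin vague_topology {\<gamma>\<in>\<Gamma>. \<gamma> \<inter> V \<noteq> {}}"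
    by (subst openin_subopen) blast
  then have "{\<gamma>\<in>\<Gamma>. \<gamma> \<inter> V \<noteq> {}} \<in> sets conf_borel" unfolding sets_conf_borel by auto
  from sets.compl_sets[OF this] show ?thesis
    by (rule back_subst[where P="\<lambda>A. A \<in> sets _"]) auto
qed

lemma config_avoid:
  assumes "\<gamma> \<in> \<Gamma>" "compact K" "\<gamma> \<inter> K = {}"
  shows "\<exists>\<V>\<subseteq>(compact_base :: 'a set set). finite \<V> \<and> K \<subseteq> (\<Union>C\<in>\<V>. interior C) \<and> \<gamma> \<inter> \<Union>\<V> = {}"
proof -
  have "open (- \<gamma>)" using config_closed[OF assms(1)] by (simp add: closed_def)
  then have "\<exists>C\<in>{C\<in>compact_base. C \<inter> \<gamma> = {}}. x \<in> interior C" if "x \<in> K" for x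
    using compact_base(3)[of "- \<gamma>" x] that assms by fastforce
  from compact_cover[OF assms(2) this] show ?thesis by (auto simp: subset_eq)
qed

text \<open>Since configurations are closed, missing a compact \<open>K\<close> already implies
  missing an open neighbourhood of \<open>K\<close> built from finitely many base sets; the open
  case then gives a countable union.\<close>

lemma measurable_void_compact:
  assumes K: "compact K" shows "void K \<in> sets conf_borel"
proof -
  let ?T = "{\<V>. \<V> \<subseteq> (compact_base :: 'a set set) \<and> finite \<V> \<and> K \<subseteq> (\<Union>C\<in>\<V>. interior C)}"
  have "void K = (\<Union>\<V>\<in>?T. void (\<Union>C\<in>\<V>. interior C))"
  proof (intro equalityI subsetI)
    fix \<gamma> assume \<gamma>: "\<gamma> \<in> void K"
    with config_avoid[of \<gamma> K] K obtain \<V> where V: "\<V> \<subseteq> compact_base" "finite \<V>" "K \<subseteq> (\<Union>C\<in>\<V>. interior C)" "\<gamma> \<inter> \<Union>\<V> = {}"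
      by auto
    have "\<gamma> \<inter> (\<Union>C\<in>\<V>. interior C) = {}" using V(4) interior_subset by blast
    then show "\<gamma> \<in> (\<Union>\<V>\<in>?T. void (\<Union>C\<in>\<V>. interior C))" using \<gamma> V by (intro UN_I[of \<V>]) auto
  qed blast
  moreover have "countable ?T"
    by (rule countable_subset[OF _ countable_Collect_finite_subset[OF compact_base(1)]]) auto
  ultimately show ?thesis
    by (auto intro!: sets.countable_UN' measurable_void_open)
qed

text \<open>A Dynkin argument from closed sets to Borel sets. Counting with
  \<open>count_space\<close> in \<open>ennreal\<close> makes the count additive over infinite
  disjoint unions, while the fixed compact \<open>K\<close> keeps it finite, so that complements
  become differences.\<close>

lemma measurable_count_Int:
  assumes K: "compact (K :: 'a set)" and B: "B \<in> sets borel"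
  shows "(\<lambda>\<gamma>. emeasure (count_space UNIV) (\<gamma> \<inter> B \<inter> K)) \<in> borel_measurable conf_borel"
proof -
  have fin: "finite (\<gamma> \<inter> B \<inter> K)" if "\<gamma> \<in> \<Gamma>" for \<gamma> :: "'a set" and B
    using config_spaceD[OF that K] by (rule rev_finite_subset) auto
  have Int_closed: "Int_stable {S :: 'a set. closed S}" and sub: "{S :: 'a set. closed S} \<subseteq> Pow UNIV"
    by (auto simp: Int_stable_def closed_Int)
  have "B \<in> sigma_sets UNIV {S. closed S}" using B by (simp add: borel_eq_closed)
  with Int_closed sub show ?thesis
  proof (induct rule: sigma_sets_induct_disjoint)
    case (basic S)
    then have c: "compact (S \<inter> K)" using K by (metis closed_Int_compact mem_Collect_eq)
    have "(\<lambda>\<gamma>. card (\<gamma> \<inter> (S \<inter> K))) \<in> measurable conf_borel (count_space UNIV)"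
    proof (rule measurable_count)
      fix C :: "'a set" assume "C \<in> compact_base"
      then show "{\<omega> \<in> space conf_borel. \<omega> \<inter> (S \<inter> K \<inter> C) = {}} \<in> sets conf_borel"
        using measurable_void_compact[of "S \<inter> K \<inter> C"] c compact_base(2) by (auto simp: compact_Int)
    qed (use config_spaceD[OF _ c] in auto)
    then have "(\<lambda>\<gamma>. ennreal (real (card (\<gamma> \<inter> (S \<inter> K))))) \<in> borel_measurable conf_borel" by measurable
    moreover have "emeasure (count_space UNIV) (\<gamma> \<inter> S \<inter> K) = ennreal (real (card (\<gamma> \<inter> (S \<inter> K))))"
      if "\<gamma> \<in> space conf_borel" for \<gamma>
      using fin[of \<gamma> S] that by (simp add: emeasure_count_space_finite Int_assoc ennreal_of_nat_eq_real_of_nat)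
    ultimately show ?case by (simp only: cong: measurable_cong)
  next
    case (compl A)
    have "(\<lambda>\<gamma>. card (\<gamma> \<inter> K)) \<in> measurable conf_borel (count_space UNIV)"
    proof (rule measurable_count)
      fix C :: "'a set" assume "C \<in> compact_base"
      then show "{\<omega> \<in> space conf_borel. \<omega> \<inter> (K \<inter> C) = {}} \<in> sets conf_borel"
        using measurable_void_compact[of "K \<inter> C"] K compact_base(2) by (auto simp: compact_Int)
    qed (use config_spaceD[OF _ K] in auto)
    then have "(\<lambda>\<gamma>. of_nat (card (\<gamma> \<inter> K)) :: ennreal) \<in> borel_measurable conf_borel"
      by (rule measurable_compose) simp
    from borel_measurable_minus_ennreal[OF this compl(2)]
    have "(\<lambda>\<gamma>. of_nat (card (\<gamma> \<inter> K)) - emeasure (count_space UNIV) (\<gamma> \<inter> A \<inter> K)) \<in> borel_measurable conf_borel" .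
    moreover have "of_nat (card (\<gamma> \<inter> K)) - emeasure (count_space UNIV) (\<gamma> \<inter> A \<inter> K) = emeasure (count_space UNIV) (\<gamma> \<inter> (UNIV - A) \<inter> K)"
      if "\<gamma> \<in> space conf_borel" for \<gamma>
    proof -
      have that: "\<gamma> \<in> \<Gamma>" using that by simp
      have "emeasure (count_space UNIV) (\<gamma> \<inter> K - \<gamma> \<inter> A \<inter> K) =
        emeasure (count_space UNIV) (\<gamma> \<inter> K) - emeasure (count_space UNIV) (\<gamma> \<inter> A \<inter> K)"
        using fin[OF that] by (intro emeasure_Diff) auto
      moreover have "\<gamma> \<inter> K - \<gamma> \<inter> A \<inter> K = \<gamma> \<inter> (UNIV - A) \<inter> K" by auto
      moreover have "finite (\<gamma> \<inter> K)" using fin[OF that, of UNIV] by simp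
      ultimately show ?thesis by (simp add: emeasure_count_space_finite)
    qed
    ultimately show ?case by (simp only: cong: measurable_cong)
  next
    case (union A)
    have "(\<lambda>\<gamma>. \<Sum>i. emeasure (count_space UNIV) (\<gamma> \<inter> A i \<inter> K)) \<in> borel_measurable conf_borel"
      by (rule borel_measurable_suminf_order) (use union(3) in simp)
    moreover have "(\<Sum>i. emeasure (count_space UNIV) (\<gamma> \<inter> A i \<inter> K)) = emeasure (count_space UNIV) (\<gamma> \<inter> (\<Union>i. A i) \<inter> K)" for \<gamma>
    proof -
      have "disjoint_family (\<lambda>i. \<gamma> \<inter> A i \<inter> K)" using union(1) by (auto simp: disjoint_family_on_def)
      then have "(\<Sum>i. emeasure (count_space UNIV) (\<gamma> \<inter> A i \<inter> K)) = emeasure (count_space UNIV) (\<Union>i. \<gamma> \<inter> A i \<inter> K)"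
        by (intro suminf_emeasure) auto
      also have "(\<Union>i. \<gamma> \<inter> A i \<inter> K) = \<gamma> \<inter> (\<Union>i. A i) \<inter> K" by auto
      finally show ?thesis .
    qed
    ultimately show ?case by simp
  qed simp
qed

lemma measurable_card_Int:
  assumes "B \<in> sets borel" "compact (closure (B :: 'a set))"
  shows "(\<lambda>\<gamma>. card (\<gamma> \<inter> B)) \<in> measurable conf_borel (count_space UNIV)"
proof -
  have *: "{\<gamma> \<in> \<Gamma>. card (\<gamma> \<inter> B) = k} \<in> sets conf_borel" for k
  proof -
    have [measurable]: "(\<lambda>\<gamma>. emeasure (count_space UNIV) (\<gamma> \<inter> B \<inter> closure B)) \<in> borel_measurable conf_borel"
      by (rule measurable_count_Int) fact+
    have "{\<gamma> \<in> space conf_borel. emeasure (count_space UNIV) (\<gamma> \<inter> B \<inter> closure B) = of_nat k} \<in> sets conf_borel"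
      by (intro borel_measurable_eq) auto
    also have "{\<gamma> \<in> space conf_borel. emeasure (count_space UNIV) (\<gamma> \<inter> B \<inter> closure B) = of_nat k} = {\<gamma> \<in> \<Gamma>. card (\<gamma> \<inter> B) = k}"
    proof -
      have "\<gamma> \<inter> B \<inter> closure B = \<gamma> \<inter> B" for \<gamma> using closure_subset by auto
      then show ?thesis using config_space_rel_compact[OF _ assms(2)] by (auto simp: emeasure_count_space_finite)
    qed
    finally show ?thesis .
  qed
  show ?thesis
  proof (rule measurableI)
    fix A :: "nat set"
    have "(\<lambda>\<gamma>. card (\<gamma> \<inter> B)) -` A \<inter> space conf_borel = (\<Union>k\<in>A. {\<gamma> \<in> \<Gamma>. card (\<gamma> \<inter> B) = k})" by auto
    also have "\<dots> \<in> sets conf_borel" using * by (intro sets.countable_UN') auto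
    finally show "(\<lambda>\<gamma>. card (\<gamma> \<inter> B)) -` A \<inter> space conf_borel \<in> sets conf_borel" .
  qed simp
qed

lemma measurable_void:
  assumes "B \<in> sets borel" "compact (closure (B :: 'a set))"
  shows "void B \<in> sets conf_borel"
proof -
  have "{\<gamma> \<in> space conf_borel. card (\<gamma> \<inter> B) = 0} \<in> sets conf_borel"
    using measurable_card_Int[OF assms] by measurable
  also have "{\<gamma> \<in> space conf_borel. card (\<gamma> \<inter> B) = 0} = void B"
    using config_space_rel_compact[OF _ assms(2)] by auto
  finally show ?thesis .
qed

text \<open>The converse inclusion of Borel sets: a vague neighbourhood of a configuration contains a
  measurable one that prescribes exactly one point in small compact sets around finitely many points
  and no points in finitely many further compact sets; there are countably many of these.\<close>

lemma vague_measurableI: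
  fixes Y :: "'w \<Rightarrow> 'a set"
  assumes Y: "\<And>\<omega>. \<omega> \<in> space M \<Longrightarrow> Y \<omega> \<in> \<Gamma>"
    and void: "\<And>B. compact B \<Longrightarrow> {\<omega>\<in>space M. Y \<omega> \<inter> B = {}} \<in> sets M"
  shows "Y \<in> measurable M conf_borel"
proof -
  define N where "N = (\<lambda>(\<V>, \<W>). {\<gamma>\<in>\<Gamma>. (\<forall>C\<in>\<V>. card (\<gamma> \<inter> C) = 1) \<and> \<gamma> \<inter> \<Union>\<W> = {}} :: 'a set set)"
  define \<D> where "\<D> = {(\<V>, \<W>). \<V> \<subseteq> (compact_base :: 'a set set) \<and> finite \<V> \<and> \<W> \<subseteq> (compact_base :: 'a set set) \<and> finite \<W>}"
  have "\<D> \<subseteq> {\<V>. \<V> \<subseteq> (compact_base :: 'a set set) \<and> finite \<V>} \<times> {\<V>. \<V> \<subseteq> (compact_base :: 'a set set) \<and> finite \<V>}"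
    by (auto simp: \<D>_def)
  moreover have cfin: "countable {\<V>. \<V> \<subseteq> (compact_base :: 'a set set) \<and> finite \<V>}"
    by (rule countable_subset[OF _ countable_Collect_finite_subset[OF compact_base(1)]]) auto
  ultimately have count: "countable \<D>" 
    using countable_subset[OF _ countable_SIGMA[OF cfin cfin]] by simp
  have N_Int: "N (\<V>, \<W>) \<inter> N (\<V>', \<W>') = N (\<V> \<union> \<V>', \<W> \<union> \<W>')" for \<V> \<W> \<V>' \<W>'
    by (auto simp: N_def)
  have N_meas: "{\<omega>\<in>space M. Y \<omega> \<in> N d} \<in> sets M" if d: "d \<in> \<D>" for d
  proof -
    obtain \<V> \<W> where d': "d = (\<V>, \<W>)" "\<V> \<subseteq> compact_base" "finite \<V>" "\<W> \<subseteq> compact_base" "finite \<W>"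
      using d by (auto simp: \<D>_def)
    have "compact (\<Union>\<W>)" using d' compact_base(2) by (intro compact_Union) auto
    then have [measurable]: "{\<omega>\<in>space M. Y \<omega> \<inter> \<Union>\<W> = {}} \<in> sets M" by (rule void)
    have "(\<lambda>\<omega>. card (Y \<omega> \<inter> C)) \<in> measurable M (count_space UNIV)" if "C \<in> \<V>" for C
    proof (rule measurable_count)
      have C: "compact C" using that d' compact_base(2) by blast
      show "finite (Y \<omega> \<inter> C)" if "\<omega> \<in> space M" for \<omega> using config_spaceD[OF Y[OF that] C] .
      show "{\<omega> \<in> space M. Y \<omega> \<inter> (C \<inter> D) = {}} \<in> sets M" if "D \<in> compact_base" for D
        by (intro void compact_Int C compact_base(2) that)
    qed
    then have "{\<omega>\<in>space M. \<forall>C\<in>\<V>. card (Y \<omega> \<inter> C) = 1} \<in> sets M"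
      using d' by (intro sets.sets_Collect_finite_All) auto
    from sets.Int[OF this \<open>{\<omega>\<in>space M. Y \<omega> \<inter> \<Union>\<W> = {}} \<in> sets M\<close>] show ?thesis
      by (rule back_subst[where P="\<lambda>A. A \<in> sets _"]) (use Y in \<open>auto simp: N_def d'\<close>)
  qed
  have nbhd: "\<exists>d\<in>\<D>. \<gamma> \<in> N d \<and> N d \<subseteq> U" if "openin vague_topology U" "\<gamma> \<in> U" for U \<gamma>
  proof -
    from that have "generate_topology_on {{\<gamma>\<in>\<Gamma>. pair_conf f \<gamma> \<in> U} | f U. (f :: 'a \<Rightarrow> real) \<in> Cc \<and> open U} U" "\<gamma> \<in> U"
      by (auto simp: vague_topology_def openin_topology_generated_by_iff)
    then show ?thesis
    proof induct
      case (Int a b)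
      from Int have "\<gamma> \<in> a" "\<gamma> \<in> b" by auto
      obtain d where d: "d \<in> \<D>" "\<gamma> \<in> N d" "N d \<subseteq> a" using Int(2)[OF \<open>\<gamma> \<in> a\<close>] by blast
      obtain d' where d': "d' \<in> \<D>" "\<gamma> \<in> N d'" "N d' \<subseteq> b" using Int(4)[OF \<open>\<gamma> \<in> b\<close>] by blast
      have "N (fst d \<union> fst d', snd d \<union> snd d') = N d \<inter> N d'" by (simp add: N_Int[symmetric])
      moreover have "(fst d \<union> fst d', snd d \<union> snd d') \<in> \<D>" using d(1) d'(1) by (auto simp: \<D>_def)
      ultimately show ?case using d d' by (intro bexI[of _ "(fst d \<union> fst d', snd d \<union> snd d')"]) auto
    next
      case (Basis s)
      then obtain f and V :: "real set" where f: "f \<in> Cc" and V: "open V" and s: "s = {\<gamma>\<in>\<Gamma>. pair_conf f \<gamma> \<in> V}" by auto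
      have \<gamma>: "\<gamma> \<in> \<Gamma>" "pair_conf f \<gamma> \<in> V" using Basis s by auto
      obtain e where e: "e > 0" "\<And>y. dist y (pair_conf f \<gamma>) < e \<Longrightarrow> y \<in> V"
        using V \<gamma>(2) unfolding open_dist by blast
      obtain K where Kc: "compact K" and sub: "\<And>x. f x \<noteq> 0 \<Longrightarrow> x \<in> K" using Cc_support[OF f] by blast
      define F where "F = \<gamma> \<inter> K"
      have F: "finite F" unfolding F_def by (rule config_spaceD[OF \<gamma>(1) Kc])
      \<comment> \<open>The first factor isolates \<open>x\<close> from the rest of
        \<open>\<gamma>\<close>. The second bounds the change of \<open>f\<close> at each of the
        \<open>card F\<close> points; dividing by \<open>card F + 1\<close> makes the total strictly
        smaller than \<open>e\<close>, also for empty \<open>F\<close>.\<close>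
      define W where "W x = - (\<gamma> - {x}) \<inter> {y. \<bar>f y - f x\<bar> < e / (card F + 1)}" for x
      have "open (W x) \<and> x \<in> W x" if "x \<in> F" for x
      proof
        have "continuous_on UNIV f" using f by (simp add: Cc_def)
        then have "open {y. \<bar>f y - f x\<bar> < e / (card F + 1)}"
          by (intro open_Collect_less continuous_intros)
        then show "open (W x)"
          unfolding W_def using that by (intro open_Int config_Diff_open[OF \<gamma>(1)]) (auto simp: F_def)
      qed (use e in \<open>simp add: W_def\<close>)
      from separate_finite[OF F this] obtain c where
        c: "\<And>x. x \<in> F \<Longrightarrow> c x \<in> compact_base \<and> x \<in> interior (c x) \<and> c x \<subseteq> W x" "disjoint_family_on c F" by blast
      \<comment> \<open>Outside the small sets around \<open>F\<close> the configuration has no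
        point in \<open>K\<close>. Covering this compact remainder by base sets that must stay empty
        prevents a nearby configuration from having further points where \<open>f\<close> is
        nonzero.\<close>
      have "compact (K - (\<Union>x\<in>F. interior (c x)))" using Kc by (intro compact_diff) auto
      moreover have "\<gamma> \<inter> (K - (\<Union>x\<in>F. interior (c x))) = {}" using c by (auto simp: F_def)
      ultimately obtain \<W> where W: "\<W> \<subseteq> compact_base" "finite \<W>" "K - (\<Union>x\<in>F. interior (c x)) \<subseteq> (\<Union>C\<in>\<W>. interior C)"
        "\<gamma> \<inter> \<Union>\<W> = {}" using config_avoid[OF \<gamma>(1), of "K - (\<Union>x\<in>F. interior (c x))"] by metis
      have single: "\<gamma> \<inter> c x = {x}" if "x \<in> F" for x
        using c(1)[OF that] that interior_subset by (fastforce simp: W_def F_def)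
      show ?case
      proof (intro bexI[of _ "(c ` F, \<W>)"] conjI subsetI)
        show "(c ` F, \<W>) \<in> \<D>" using c W F by (auto simp: \<D>_def)
        show "\<gamma> \<in> N (c ` F, \<W>)" using \<gamma> W single by (auto simp: N_def)
        fix \<eta> assume \<eta>: "\<eta> \<in> N (c ` F, \<W>)"
        then have "\<forall>x\<in>F. \<exists>y. \<eta> \<inter> c x = {y}" by (auto simp: N_def card_1_singleton_iff)
        then obtain p where p: "\<And>x. x \<in> F \<Longrightarrow> \<eta> \<inter> c x = {p x}" by metis
        have inj: "inj_on p F"
        proof (rule inj_onI)
          fix x y assume "x \<in> F" "y \<in> F" "p x = p y"
          then have "p x \<in> c x \<inter> c y" using p by (metis Int_iff insertI1)
          then show "x = y" using c(2) \<open>x \<in> F\<close> \<open>y \<in> F\<close> by (auto simp: disjoint_family_on_def)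
        qed
        have sup: "{x\<in>\<eta>. f x \<noteq> 0} \<subseteq> p ` F"
        proof
          fix y assume y: "y \<in> {x\<in>\<eta>. f x \<noteq> 0}"
          then have "y \<in> K" using sub by auto
          moreover have "y \<notin> \<Union>\<W>" using \<eta> y by (auto simp: N_def)
          then have "y \<notin> (\<Union>C\<in>\<W>. interior C)" using interior_subset by blast
          ultimately obtain x where x: "x \<in> F" "y \<in> interior (c x)" using W(3) by blast
          then have "y \<in> \<eta> \<inter> c x" using y interior_subset by blast
          then show "y \<in> p ` F" using p x by blast
        qed
        have "pair_conf f \<eta> = (\<Sum>x\<in>p ` F. f x)"
          unfolding pair_conf_def using sup F p by (intro sum.mono_neutral_left) auto
        also have "\<dots> = (\<Sum>x\<in>F. f (p x))" by (rule sum.reindex_cong[OF inj]) auto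
        finally have 1: "pair_conf f \<eta> = (\<Sum>x\<in>F. f (p x))" .
        have 2: "pair_conf f \<gamma> = (\<Sum>x\<in>F. f x)"
          unfolding pair_conf_def using F sub by (intro sum.mono_neutral_left) (auto simp: F_def)
        have b: "\<bar>f (p x) - f x\<bar> \<le> e / (card F + 1)" if "x \<in> F" for x
          using c(1)[OF that] p[OF that] by (auto simp: W_def)
        have "\<bar>pair_conf f \<eta> - pair_conf f \<gamma>\<bar> \<le> (\<Sum>x\<in>F. \<bar>f (p x) - f x\<bar>)"
          unfolding 1 2 sum_subtractf[symmetric] by (rule sum_abs)
        also have "\<dots> \<le> card F * (e / (card F + 1))"
          by (rule sum_bounded_above) (rule b)
        also have "\<dots> < e" using e by (auto simp: field_simps)
        finally have "pair_conf f \<eta> \<in> V" by (intro e) (auto simp: dist_real_def)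
        then show "\<eta> \<in> s" using \<eta> by (auto simp: s N_def)
      qed
    qed blast+
  qed
  show ?thesis
  proof (rule measurable_sigma_sets[OF sets_conf_borel])
    show "{U. openin vague_topology U} \<subseteq> Pow (\<Gamma> :: 'a set set)" using openin_vague_subset by blast
    show "Y \<in> space M \<rightarrow> \<Gamma>" using Y by auto
    fix U :: "'a set set" assume "U \<in> {U. openin vague_topology U}"
    then have "Y -` U \<inter> space M = (\<Union>d\<in>{d\<in>\<D>. N d \<subseteq> U}. {\<omega>\<in>space M. Y \<omega> \<in> N d})"
      using nbhd by fastforce
    also have "\<dots> \<in> sets M"
      using N_meas count by (intro sets.countable_UN'[OF countable_subset]) auto
    finally show "Y -` U \<inter> space M \<in> sets M" .
  qed
qed

section \<open>Void events generate the Borel sets\<close>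

definition voids :: "'a set set set" where
  "voids = {void B | B. B \<in> sets borel \<and> compact (closure B)}"

text \<open>To put the Borel sets into the generated sigma-algebra, the identity map out of the
  latter is shown to be measurable by \<open>vague_measurableI\<close>, whose measurability
  hypothesis concerns void events alone.\<close>

lemma sigma_voids: "sets conf_borel = sigma_sets \<Gamma> voids"
proof
  show "sigma_sets \<Gamma> voids \<subseteq> sets conf_borel"
    using measurable_void sets.sigma_sets_subset[of voids conf_borel] by (auto simp: voids_def)
  have sub: "voids \<subseteq> Pow \<Gamma>" by (auto simp: voids_def)
  have "(\<lambda>x. x) \<in> measurable (sigma \<Gamma> voids) conf_borel"
  proof (rule vague_measurableI)
    fix B :: "'a set" assume "compact B"
    then have "closed B" by (rule compact_imp_closed)
    then have "B \<in> sets borel" "compact (closure B)" using \<open>compact B\<close> by (simp_all add: closure_closed)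
    then have "void B \<in> voids" unfolding voids_def by blast
    then show "{\<omega> \<in> space (sigma \<Gamma> voids). \<omega> \<inter> B = {}} \<in> sets (sigma \<Gamma> voids)"
      using sub by (simp add: space_measure_of_conv)
  next
    fix \<omega> assume "\<omega> \<in> space (sigma \<Gamma> voids)"
    then show "\<omega> \<in> \<Gamma>" using sub by (simp add: space_measure_of_conv)
  qed
  note id = this
  show "sets conf_borel \<subseteq> sigma_sets \<Gamma> voids"
  proof
    fix A :: "'a set set" assume A: "A \<in> sets conf_borel"
    then have "A \<subseteq> \<Gamma>" using sets.sets_into_space by fastforce
    then have "(\<lambda>x. x) -` A \<inter> space (sigma \<Gamma> voids) = A" using sub by (auto simp: space_measure_of_conv)
    then show "A \<in> sigma_sets \<Gamma> voids"
      using measurable_sets[OF id A] sub by simp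
  qed
qed

lemma Int_stable_voids: "Int_stable voids"
proof (rule Int_stableI)
  fix a b assume "a \<in> voids" "b \<in> voids"
  then obtain B C where "a = void B" "b = void C" "B \<in> sets borel" "C \<in> sets borel" "compact (closure B)" "compact (closure C)"
    by (auto simp: voids_def)
  then have "a \<inter> b = void (B \<union> C)" "B \<union> C \<in> sets borel" "compact (closure (B \<union> C))"
    by (auto simp: closure_Un compact_Un)
  then show "a \<inter> b \<in> voids" unfolding voids_def by blast
qed

lemma voids_subset: "voids \<subseteq> Pow \<Gamma>"
  by (auto simp: voids_def)

lemma conf_measure_eqI:
  assumes "finite_measure P" "sets P = sets conf_borel" "sets Q = sets conf_borel"
    and "\<And>B. B \<in> sets borel \<Longrightarrow> compact (closure B) \<Longrightarrow> emeasure P (void B) = emeasure Q (void B)"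
  shows "P = Q"
proof (rule measure_eqI_generator_eq[OF Int_stable_voids voids_subset, where A="\<lambda>_. \<Gamma>"])
  \<comment> \<open>The whole space is itself a void event, so equality of the total masses is part
    of the hypothesis.\<close>
  have "\<Gamma> = void {}" by auto
  then have "\<Gamma> \<in> voids" unfolding voids_def by (intro CollectI exI[of _ "{}"]) auto
  then show "range (\<lambda>_. \<Gamma>) \<subseteq> voids" by auto
  show "emeasure P \<Gamma> \<noteq> \<infinity>" using assms(1) by (simp add: finite_measure.emeasure_finite)
qed (use assms sigma_voids in \<open>auto simp: voids_def\<close>)

end

section \<open>Poisson processes\<close>

lemma nn_integral_PiM_prod:
  assumes M: "\<And>i. i \<in> I \<Longrightarrow> prob_space (M i)" and J: "finite J" "J \<subseteq> I"
    and f: "\<And>i. i \<in> J \<Longrightarrow> f i \<in> borel_measurable (M i)"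
  shows "(\<integral>\<^sup>+\<omega>. (\<Prod>i\<in>J. f i (\<omega> i)) \<partial>PiM I M) = (\<Prod>i\<in>J. \<integral>\<^sup>+x. f i x \<partial>M i)"
proof -
  \<comment> \<open>\<open>product_prob_space\<close> asks for a probability measure at every index,
    also outside \<open>I\<close>; a one-point space fills the gap without changing
    \<open>PiM I M\<close>.\<close>
  let ?M = "\<lambda>i. if i \<in> I then M i else count_space {undefined}"
  interpret M': prob_space "?M i" for i
    using M by (cases "i \<in> I") (auto intro!: prob_spaceI)
  interpret product_prob_space ?M I by unfold_locales
  have PI: "PiM I M = PiM I ?M" by (intro PiM_cong) auto
  have m: "(\<lambda>\<omega>. \<Prod>i\<in>J. f i (\<omega> i)) \<in> borel_measurable (PiM J ?M)"
    using f J by (intro borel_measurable_prod_ennreal measurable_PiM_component_rev) auto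
  have "(\<integral>\<^sup>+\<omega>. (\<Prod>i\<in>J. f i (\<omega> i)) \<partial>PiM I M) = (\<integral>\<^sup>+\<omega>. (\<Prod>i\<in>J. f i (restrict \<omega> J i)) \<partial>PiM I ?M)"
    by (simp add: PI)
  also have "\<dots> = (\<integral>\<^sup>+\<omega>. (\<Prod>i\<in>J. f i (\<omega> i)) \<partial>distr (PiM I ?M) (PiM J ?M) (\<lambda>\<omega>. restrict \<omega> J))"
    using m J by (subst nn_integral_distr) (auto intro!: measurable_restrict_subset)
  also have "\<dots> = (\<integral>\<^sup>+\<omega>. (\<Prod>i\<in>J. f i (\<omega> i)) \<partial>PiM J ?M)"
    by (subst distr_PiM_restrict_finite[OF J]) simp
  also have "\<dots> = (\<Prod>i\<in>J. \<integral>\<^sup>+x. f i x \<partial>?M i)"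
    using f J by (intro product_nn_integral_prod) auto
  also have "\<dots> = (\<Prod>i\<in>J. \<integral>\<^sup>+x. f i x \<partial>M i)"
    using J by (intro prod.cong) auto
  finally show ?thesis .
qed

text \<open>Two distinct coordinates are independent, so by Fubini the value of the first can be
  fixed, and \<open>na\<close> makes the second avoid it.\<close>

lemma AE_PiM_neq:
  fixes f g :: "'b \<Rightarrow> 'c::{second_countable_topology, t2_space}"
  assumes M: "\<And>i. i \<in> I \<Longrightarrow> prob_space (M i)" and ij: "i \<in> I" "j \<in> I" "i \<noteq> j"
    and f: "f \<in> borel_measurable (M i)" and g: "g \<in> borel_measurable (M j)"
    and na: "\<And>y. AE x in M j. g x \<noteq> y"
  shows "AE \<omega> in PiM I M. f (\<omega> i) \<noteq> g (\<omega> j)"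
proof -
  interpret i: prob_space "M i" using M ij by auto
  interpret j: prob_space "M j" using M ij by auto
  interpret P: prob_space "PiM I M" using M by (rule prob_space_PiM)
  have eq: "distr (PiM I M) (M i \<Otimes>\<^sub>M M j) (\<lambda>\<omega>. (\<omega> i, \<omega> j)) = M i \<Otimes>\<^sub>M M j"
  proof (rule pair_measure_eqI[OF i.sigma_finite_measure_axioms j.sigma_finite_measure_axioms, symmetric])
    fix A B assume A [measurable]: "A \<in> sets (M i)" "B \<in> sets (M j)"
    note [measurable] = measurable_component_singleton[OF ij(1), of M] measurable_component_singleton[OF ij(2), of M]
    have "emeasure (distr (PiM I M) (M i \<Otimes>\<^sub>M M j) (\<lambda>\<omega>. (\<omega> i, \<omega> j))) (A \<times> B) =
      emeasure (PiM I M) {\<omega>\<in>space (PiM I M). \<omega> i \<in> A \<and> \<omega> j \<in> B}"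
      using A ij by (subst emeasure_distr) (auto intro!: arg_cong[where f="emeasure _"])
    also have "\<dots> = (\<integral>\<^sup>+\<omega>. indicator {\<omega>\<in>space (PiM I M). \<omega> i \<in> A \<and> \<omega> j \<in> B} \<omega> \<partial>PiM I M)"
      using A ij by (intro nn_integral_indicator[symmetric]) measurable
    also have "\<dots> = (\<integral>\<^sup>+\<omega>. (\<Prod>k\<in>{i, j}. indicator (if k = i then A else B) (\<omega> k)) \<partial>PiM I M)"
      using ij by (intro nn_integral_cong) (auto split: split_indicator)
    also have "\<dots> = emeasure (M i) A * emeasure (M j) B"
      using ij A M by (subst nn_integral_PiM_prod) auto
    finally show "emeasure (M i) A * emeasure (M j) B =
      emeasure (distr (PiM I M) (M i \<Otimes>\<^sub>M M j) (\<lambda>\<omega>. (\<omega> i, \<omega> j))) (A \<times> B)" by simp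
  qed simp
  have "AE p in M i \<Otimes>\<^sub>M M j. f (fst p) \<noteq> g (snd p)"
  proof (rule pair_sigma_finite.AE_pair_measure)
    show "pair_sigma_finite (M i) (M j)" ..
    show "{x \<in> space (M i \<Otimes>\<^sub>M M j). f (fst x) \<noteq> g (snd x)} \<in> sets (M i \<Otimes>\<^sub>M M j)"
      using f g by measurable
    show "AE x in M i. AE y in M j. f (fst (x, y)) \<noteq> g (snd (x, y))"
    proof (rule AE_I2)
      fix x
      show "AE y in M j. f (fst (x, y)) \<noteq> g (snd (x, y))"
        using na[of "f x"] by eventually_elim auto
    qed
  qed
  then have "AE p in distr (PiM I M) (M i \<Otimes>\<^sub>M M j) (\<lambda>\<omega>. (\<omega> i, \<omega> j)). f (fst p) \<noteq> g (snd p)"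
    by (simp only: eq)
  from AE_distrD[OF _ this] show ?thesis using ij by auto
qed

lemma AE_pair_snd:
  assumes "sigma_finite_measure B" "AE y in B. P y"
  shows "AE p in A \<Otimes>\<^sub>M B. P (snd p)"
proof -
  interpret B: sigma_finite_measure B by fact
  obtain N where N: "{y \<in> space B. \<not> P y} \<subseteq> N" "emeasure B N = 0" "N \<in> sets B"
    using AE_E[OF assms(2)] by metis
  show ?thesis
    by (rule AE_I[where N="space A \<times> N"])
       (use N in \<open>auto simp: space_pair_measure B.emeasure_pair_measure_Times\<close>)
qed

text \<open>The generating function of the Poisson distribution. It converts a power of the mean
  factor \<open>q\<close>, one for each point of a piece, into an exponential of the
  intensity.\<close>

lemma nn_integral_poisson_power:
  assumes "0 < r" "0 \<le> q" "q \<le> 1"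
  shows "(\<integral>\<^sup>+n. ennreal (q ^ n) \<partial>measure_pmf (poisson_pmf r)) = ennreal (exp (- (r * (1 - q))))"
proof -
  have s: "(\<lambda>n. exp (- r) * ((r * q) ^ n / fact n)) sums (exp (- r) * exp (r * q))"
    using sums_mult[OF exp_converges[of "r * q"], of "exp (- r)"] by (simp add: field_simps)
  have "(\<integral>\<^sup>+n. ennreal (q ^ n) \<partial>measure_pmf (poisson_pmf r)) = (\<Sum>n. ennreal (exp (- r) * ((r * q) ^ n / fact n)))"
    using assms by (simp add: nn_integral_measure_pmf nn_integral_count_space_nat ennreal_mult''[symmetric]
        power_mult_distrib field_simps)
  also have "\<dots> = ennreal (exp (- r) * exp (r * q))"
    using s assms by (intro suminf_ennreal_eq) auto
  also have "exp (- r) * exp (r * q) = exp (- (r * (1 - q)))"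
    by (simp add: exp_add[symmetric] algebra_simps)
  finally show ?thesis .
qed

text \<open>A Poisson process of intensity \<open>M\<close> on the union of countably many disjoint pieces \<open>E i\<close>: a
  Poisson number of independent uniform points in each piece. Null pieces are left out of the index
  set \<open>active\<close>, because \<open>uniform_measure\<close> and \<open>poisson_pmf\<close> are junk on them. The uniform points lie in
  their piece only almost surely; \<open>labels\<close> drops the others, so that local finiteness holds surely.\<close>

locale poisson_pieces =
  fixes M :: "'s measure" and E :: "'i::countable \<Rightarrow> 's set"
  assumes E_sets [measurable]: "\<And>i. E i \<in> sets M" and E_finite: "\<And>i. emeasure M (E i) < \<infinity>"
    and E_disj: "disjoint_family E"
begin

definition active :: "'i set" where
  "active = {i. emeasure M (E i) \<noteq> 0}"

definition num_space :: "('i \<Rightarrow> nat) measure" where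
  "num_space = PiM active (\<lambda>i. measure_pmf (poisson_pmf (measure M (E i))))"

definition pos_space :: "('i \<times> nat \<Rightarrow> 's) measure" where
  "pos_space = PiM (active \<times> UNIV) (\<lambda>(i, n). uniform_measure M (E i))"

definition ppp_space :: "(('i \<Rightarrow> nat) \<times> ('i \<times> nat \<Rightarrow> 's)) measure" where
  "ppp_space = num_space \<Otimes>\<^sub>M pos_space"

definition labels :: "('i \<Rightarrow> nat) \<times> ('i \<times> nat \<Rightarrow> 's) \<Rightarrow> ('i \<times> nat) set" where
  "labels \<omega> = {(i, n). i \<in> active \<and> n < fst \<omega> i \<and> snd \<omega> (i, n) \<in> E i}"

text \<open>Passing to a set merges particles at the same place. Products are therefore taken over
  \<open>labels\<close>, and \<open>AE_inj_labels\<close> gives a condition under which both views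
  agree almost surely.\<close>

definition points :: "('i \<Rightarrow> nat) \<times> ('i \<times> nat \<Rightarrow> 's) \<Rightarrow> 's set" where
  "points \<omega> = snd \<omega> ` labels \<omega>"

lemma active_pos: "i \<in> active \<Longrightarrow> 0 < measure M (E i)"
  using E_finite[of i] by (auto simp: active_def measure_def enn2real_positive_iff zero_less_iff_neq_zero)

lemma prob_uniform: "i \<in> active \<Longrightarrow> prob_space (uniform_measure M (E i))"
  using E_finite[of i] by (intro prob_space_uniform_measure) (auto simp: active_def)

sublocale num: prob_space num_space
  unfolding num_space_def by (intro prob_space_PiM prob_space_measure_pmf)

sublocale pos: prob_space pos_space
  unfolding pos_space_def by (intro prob_space_PiM) (auto intro: prob_uniform)

sublocale ppp: pair_prob_space num_space pos_space ..

lemma prob_space_ppp: "prob_space ppp_space"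
  unfolding ppp_space_def by (rule ppp.prob_space_axioms)

lemma measurable_num [measurable]:
  "i \<in> active \<Longrightarrow> (\<lambda>\<omega>. fst \<omega> i) \<in> measurable ppp_space (count_space UNIV)"
  unfolding ppp_space_def num_space_def by measurable

lemma measurable_pos [measurable]:
  "i \<in> active \<Longrightarrow> (\<lambda>\<omega>. snd \<omega> (i, n)) \<in> measurable ppp_space M"
proof -
  assume i: "i \<in> active"
  have "(\<lambda>z. z (i, n)) \<in> measurable pos_space (uniform_measure M (E i))"
    unfolding pos_space_def using i measurable_component_singleton[of "(i, n)" "active \<times> UNIV" "\<lambda>(i, n). uniform_measure M (E i)"]
    by simp
  then have "(\<lambda>z. z (i, n)) \<in> measurable pos_space M"
    by (simp only: measurable_cong_sets[OF refl sets_uniform_measure])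
  then show ?thesis unfolding ppp_space_def by measurable
qed

lemma points_piece_finite: "finite (points \<omega> \<inter> E i)"
proof -
  have "points \<omega> \<inter> E i \<subseteq> snd \<omega> ` ({i} \<times> {..<fst \<omega> i})"
    using E_disj by (fastforce simp: points_def labels_def disjoint_family_on_def)
  then show ?thesis by (rule finite_subset) auto
qed

lemma points_subset: "points \<omega> \<subseteq> (\<Union>i. E i)"
  by (auto simp: points_def labels_def)

lemma points_finite:
  assumes "finite J" "C \<inter> (\<Union>i. E i) \<subseteq> (\<Union>i\<in>J. E i)"
  shows "finite (points \<omega> \<inter> C)"
proof (rule finite_subset)
  show "points \<omega> \<inter> C \<subseteq> (\<Union>i\<in>J. points \<omega> \<inter> E i)" 
  proof
    fix x assume x: "x \<in> points \<omega> \<inter> C"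
    then have "x \<in> (\<Union>i\<in>J. E i)" using assms(2) points_subset[of \<omega>] by (meson IntD1 IntD2 IntI subsetD)
    then show "x \<in> (\<Union>i\<in>J. points \<omega> \<inter> E i)" using x by auto
  qed
  show "finite (\<Union>i\<in>J. points \<omega> \<inter> E i)" by (intro finite_UN_I assms points_piece_finite)
qed

lemma measurable_points_void [measurable]:
  assumes [measurable]: "C \<in> sets M" shows "{\<omega>\<in>space ppp_space. points \<omega> \<inter> C = {}} \<in> sets ppp_space"
proof -
  have "{\<omega>\<in>space ppp_space. \<forall>i\<in>active. \<forall>n. n < fst \<omega> i \<longrightarrow> snd \<omega> (i, n) \<in> E i \<longrightarrow> snd \<omega> (i, n) \<notin> C} \<in> sets ppp_space"
  proof (intro sets.sets_Collect_countable_All' sets.sets_Collect_countable_All)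
    fix i n
    show "{\<omega>\<in>space ppp_space. n < fst \<omega> i \<longrightarrow> snd \<omega> (i, n) \<in> E i \<longrightarrow> snd \<omega> (i, n) \<notin> C} \<in> sets ppp_space"
      if [simp]: "i \<in> active" by measurable
  qed simp
  also have "{\<omega>\<in>space ppp_space. \<forall>i\<in>active. \<forall>n. n < fst \<omega> i \<longrightarrow> snd \<omega> (i, n) \<in> E i \<longrightarrow> snd \<omega> (i, n) \<notin> C} =
    {\<omega>\<in>space ppp_space. points \<omega> \<inter> C = {}}"
    by (auto simp: points_def labels_def)
  finally show ?thesis .
qed

text \<open>The generating functional of a Poisson process. Given the numbers of points,
  independence yields in piece \<open>i\<close> the mean \<open>q i\<close> of \<open>g\<close> to
  the power of the number of points there. Averaging over the Poisson number gives
  \<open>exp (- (r i * (1 - q i)))\<close>, and \<open>r i * (1 - q i)\<close> is the integral of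
  \<open>1 - g\<close> over the piece.\<close>

lemma ppp_functional:
  assumes J: "finite J" and g [measurable]: "g \<in> borel_measurable M" and g01: "\<And>x. 0 \<le> g x" "\<And>x. g x \<le> (1::real)"
    and supp: "\<And>x. g x \<noteq> 1 \<Longrightarrow> x \<in> (\<Union>i\<in>J. E i)"
  shows "(\<integral>\<^sup>+\<omega>. ennreal (\<Prod>(i, n)\<in>labels \<omega> \<inter> J \<times> UNIV. g (snd \<omega> (i, n))) \<partial>ppp_space) =
    ennreal (exp (- (\<integral>x. (1 - g x) \<partial>M)))"
proof -
  let ?A = "J \<inter> active"
  have A: "finite ?A" "?A \<subseteq> active" using J by auto
  define r where "r i = measure M (E i)" for i
  \<comment> \<open>\<open>labels\<close> drops a sampled point that misses its piece; giving such a
    point the factor 1 allows a product over all \<open>n\<close> below the sampled number.\<close>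
  define h where "h i z = (if z \<in> E i then g z else 1)" for i z
  have h [measurable]: "h i \<in> borel_measurable M" for i unfolding h_def by measurable
  have h01: "0 \<le> h i z" "h i z \<le> 1" for i z using g01 by (auto simp: h_def)
  define q where "q i = (\<integral>z. h i z \<partial>uniform_measure M (E i))" for i
  have intE: "integrable M (\<lambda>x. indicator (E i) x * (1 - g x))" for i
  proof (rule Bochner_Integration.integrable_bound[OF integrable_real_indicator[OF E_sets E_finite]])
    show "AE x in M. norm (indicator (E i) x * (1 - g x)) \<le> norm (indicat_real (E i) x)"
      using g01 by (intro AE_I2) (auto split: split_indicator)
  qed measurable
  have q: "(\<integral>\<^sup>+z. ennreal (h i z) \<partial>uniform_measure M (E i)) = ennreal (q i)" "0 \<le> q i" "q i \<le> 1"
      "r i * (1 - q i) = (\<integral>x. indicator (E i) x * (1 - g x) \<partial>M)" if i: "i \<in> active" for i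
  proof -
    interpret U: prob_space "uniform_measure M (E i)" using i by (rule prob_uniform)
    have int: "integrable (uniform_measure M (E i)) (h i)"
      using h01 by (intro U.integrable_const_bound[of _ 1]) auto
    then show "(\<integral>\<^sup>+z. ennreal (h i z) \<partial>uniform_measure M (E i)) = ennreal (q i)"
      using h01 unfolding q_def by (intro nn_integral_eq_integral) auto
    show "0 \<le> q i" "q i \<le> 1"
      using h01 int unfolding q_def by (auto intro!: U.integral_ge_const U.integral_le_const)
    have "1 - q i = (\<integral>z. 1 - h i z \<partial>uniform_measure M (E i))"
      unfolding q_def using int U.prob_space by simp
    also have "\<dots> = (\<integral>x. indicator (E i) x * (1 - g x) \<partial>M) / r i"
    proof -
      have r: "r i > 0" "emeasure M (E i) = ennreal (r i)"
        using active_pos[OF i] E_finite[of i] by (auto simp: r_def emeasure_eq_ennreal_measure)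
      have "uniform_measure M (E i) = density M (\<lambda>x. ennreal (indicator (E i) x / r i))"
        unfolding uniform_measure_def using r
        by (intro density_cong) (auto simp: divide_ennreal[symmetric] split: split_indicator)
      then have "(\<integral>z. 1 - h i z \<partial>uniform_measure M (E i)) = (\<integral>x. (indicator (E i) x / r i) *\<^sub>R (1 - h i x) \<partial>M)"
        using r by (simp add: integral_density)
      also have "\<dots> = (\<integral>x. indicator (E i) x * (1 - g x) / r i \<partial>M)"
        by (intro Bochner_Integration.integral_cong) (auto simp: h_def split: split_indicator)
      finally show ?thesis by simp
    qed
    finally show "r i * (1 - q i) = (\<integral>x. indicator (E i) x * (1 - g x) \<partial>M)"
      using active_pos[OF i] by (simp add: r_def)
  qed
  have rw: "ennreal (\<Prod>(i, n)\<in>labels \<omega> \<inter> J \<times> UNIV. g (snd \<omega> (i, n))) =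
      (\<Prod>p\<in>(SIGMA i:?A. {..<fst \<omega> i}). ennreal (h (fst p) (snd \<omega> p)))" for \<omega>
  proof -
    have "(\<Prod>(i, n)\<in>labels \<omega> \<inter> J \<times> UNIV. g (snd \<omega> (i, n))) = (\<Prod>p\<in>(SIGMA i:?A. {..<fst \<omega> i}). h (fst p) (snd \<omega> p))"
      using A by (intro prod.mono_neutral_cong_left) (auto simp: labels_def h_def)
    then show ?thesis using h01 by (simp add: prod_ennreal)
  qed
  have inner: "(\<integral>\<^sup>+z. (\<Prod>p\<in>(SIGMA i:?A. {..<N i}). ennreal (h (fst p) (z p))) \<partial>pos_space) = (\<Prod>i\<in>?A. ennreal (q i ^ N i))" for N
  proof -
    have "(\<integral>\<^sup>+z. (\<Prod>p\<in>(SIGMA i:?A. {..<N i}). ennreal (h (fst p) (z p))) \<partial>pos_space) =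
      (\<Prod>p\<in>(SIGMA i:?A. {..<N i}). \<integral>\<^sup>+z. ennreal (h (fst p) z) \<partial>uniform_measure M (E (fst p)))"
      unfolding pos_space_def
      by (subst nn_integral_PiM_prod) (use A in \<open>auto simp: split_beta prob_uniform\<close>)
    also have "\<dots> = (\<Prod>p\<in>(SIGMA i:?A. {..<N i}). ennreal (q (fst p)))"
      using q(1) by (intro prod.cong) auto
    also have "\<dots> = (\<Prod>i\<in>?A. \<Prod>n<N i. ennreal (q i))"
      using A by (subst prod.Sigma) (auto simp: split_beta)
    also have "\<dots> = (\<Prod>i\<in>?A. ennreal (q i ^ N i))"
      using q(2) by (intro prod.cong) (auto simp: ennreal_power)
    finally show ?thesis .
  qed
  have meas: "(\<lambda>\<omega>. \<Prod>p\<in>(SIGMA i:?A. {..<fst \<omega> i}). ennreal (h (fst p) (snd \<omega> p))) \<in> borel_measurable (num_space \<Otimes>\<^sub>M pos_space)"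
  proof -
    \<comment> \<open>The number of factors is random. For each fixed \<open>k\<close> the product
      is measurable, and \<open>measurable_compose_countable\<close> inserts the random number for
      \<open>k\<close>.\<close>
    have "(\<lambda>\<omega>. \<Prod>i\<in>?A. (\<lambda>k \<omega>. \<Prod>n<k. ennreal (h i (snd \<omega> (i, n)))) (fst \<omega> i) \<omega>) \<in> borel_measurable ppp_space"
    proof (rule borel_measurable_prod_ennreal)
      fix i assume "i \<in> ?A"
      then have i [simp]: "i \<in> active" by simp
      have "(\<lambda>\<omega>. \<Prod>n<k. ennreal (h i (snd \<omega> (i, n)))) \<in> borel_measurable ppp_space" for k
        by (intro borel_measurable_prod_ennreal measurable_compose[OF measurable_pos[OF i]]
            measurable_compose[OF h measurable_ennreal])
      then show "(\<lambda>\<omega>. (\<lambda>k \<omega>. \<Prod>n<k. ennreal (h i (snd \<omega> (i, n)))) (fst \<omega> i) \<omega>) \<in> borel_measurable ppp_space"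
        by (rule measurable_compose_countable) (rule measurable_num[OF i])
    qed
    moreover have "(\<Prod>i\<in>?A. \<Prod>n<fst \<omega> i. ennreal (h i (snd \<omega> (i, n)))) = (\<Prod>p\<in>(SIGMA i:?A. {..<fst \<omega> i}). ennreal (h (fst p) (snd \<omega> p)))" for \<omega> :: "('i \<Rightarrow> nat) \<times> ('i \<times> nat \<Rightarrow> 's)"
      using A by (subst prod.Sigma) (auto simp: split_beta)
    ultimately show ?thesis by (simp add: ppp_space_def)
  qed
  have "(\<integral>\<^sup>+\<omega>. ennreal (\<Prod>(i, n)\<in>labels \<omega> \<inter> J \<times> UNIV. g (snd \<omega> (i, n))) \<partial>ppp_space) =
    (\<integral>\<^sup>+N. \<integral>\<^sup>+z. (\<Prod>p\<in>(SIGMA i:?A. {..<N i}). ennreal (h (fst p) (z p))) \<partial>pos_space \<partial>num_space)"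
    unfolding rw ppp_space_def using pos.nn_integral_fst[OF meas] by simp
  also have "\<dots> = (\<integral>\<^sup>+N. (\<Prod>i\<in>?A. ennreal (q i ^ N i)) \<partial>num_space)"
    by (simp only: inner)
  also have "\<dots> = (\<Prod>i\<in>?A. \<integral>\<^sup>+n. ennreal (q i ^ n) \<partial>measure_pmf (poisson_pmf (measure M (E i))))"
    unfolding num_space_def using A by (intro nn_integral_PiM_prod) (auto intro: prob_space_measure_pmf)
  also have "\<dots> = (\<Prod>i\<in>?A. ennreal (exp (- (r i * (1 - q i)))))"
    using q active_pos unfolding r_def by (intro prod.cong nn_integral_poisson_power) auto
  also have "\<dots> = ennreal (exp (- (\<Sum>i\<in>?A. r i * (1 - q i))))"
    using A by (simp add: prod_ennreal exp_sum sum_negf[symmetric])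
  also have "(\<Sum>i\<in>?A. r i * (1 - q i)) = (\<Sum>i\<in>?A. \<integral>x. indicator (E i) x * (1 - g x) \<partial>M)"
    using q(4) by (intro sum.cong) auto
  \<comment> \<open>Inactive pieces are null sets, so they can be added back to the sum.\<close>
  also have "\<dots> = (\<Sum>i\<in>J. \<integral>x. indicator (E i) x * (1 - g x) \<partial>M)"
  proof (rule sum.mono_neutral_left[OF J])
    show "\<forall>i\<in>J - ?A. (\<integral>x. indicator (E i) x * (1 - g x) \<partial>M) = 0"
    proof
      fix i assume "i \<in> J - ?A"
      then have "emeasure M (E i) = 0" by (auto simp: active_def)
      then have "AE x in M. x \<notin> E i" by (intro AE_not_in) (auto intro: null_setsI)
      then show "(\<integral>x. indicator (E i) x * (1 - g x) \<partial>M) = 0"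
        by (intro integral_eq_zero_AE) (auto elim!: eventually_mono)
    qed
  qed auto
  also have "\<dots> = (\<integral>x. (\<Sum>i\<in>J. indicator (E i) x * (1 - g x)) \<partial>M)"
    using intE by (intro Bochner_Integration.integral_sum[symmetric])
  also have "\<dots> = (\<integral>x. (1 - g x) \<partial>M)"
  proof (intro Bochner_Integration.integral_cong refl)
    fix x
    have "(\<Sum>i\<in>J. indicator (E i) x) * (1 - g x) = indicator (\<Union>i\<in>J. E i) x * (1 - g x)"
      using E_disj J by (subst indicator_UN_disjoint) (auto simp: disjoint_family_on_def)
    also have "\<dots> = 1 - g x" using supp[of x] by (auto split: split_indicator)
    finally show "(\<Sum>i\<in>J. indicator (E i) x * (1 - g x)) = 1 - g x" by (simp add: sum_distrib_right)
  qed
  finally show ?thesis .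
qed

text \<open>Apply the functional to the indicator of the complement of \<open>C\<close>: the product
  over labels is 1 if no point lies in \<open>C\<close> and 0 otherwise. Coinciding points only
  repeat factors 0 or 1, so the identity between event and product holds surely.\<close>

lemma emeasure_points_void:
  assumes J: "finite J" and [measurable]: "C \<in> sets M" and C: "C \<subseteq> (\<Union>i\<in>J. E i)"
  shows "emeasure ppp_space {\<omega>\<in>space ppp_space. points \<omega> \<inter> C = {}} = ennreal (exp (- measure M C))"
proof -
  have "emeasure ppp_space {\<omega>\<in>space ppp_space. points \<omega> \<inter> C = {}} =
      (\<integral>\<^sup>+\<omega>. indicator {\<omega>\<in>space ppp_space. points \<omega> \<inter> C = {}} \<omega> \<partial>ppp_space)"
    by (intro nn_integral_indicator[symmetric]) measurable
  also have "\<dots> = (\<integral>\<^sup>+\<omega>. ennreal (\<Prod>(i, n)\<in>labels \<omega> \<inter> J \<times> UNIV. indicator (- C) (snd \<omega> (i, n))) \<partial>ppp_space)"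
  proof (intro nn_integral_cong)
    fix \<omega> assume w: "\<omega> \<in> space ppp_space"
    have fin: "finite (labels \<omega> \<inter> J \<times> UNIV)"
      by (rule finite_subset[of _ "SIGMA i:J. {..<fst \<omega> i}"]) (use J in \<open>auto simp: labels_def\<close>)
    have sub: "(i, n) \<in> J \<times> UNIV" if l: "(i, n) \<in> labels \<omega>" "snd \<omega> (i, n) \<in> C" for i and n :: nat
    proof -
      obtain j where "j \<in> J" "snd \<omega> (i, n) \<in> E j" using l(2) C by blast
      moreover have "snd \<omega> (i, n) \<in> E i" using l(1) by (simp add: labels_def)
      ultimately have "i = j" using E_disj unfolding disjoint_family_on_def by blast
      then show ?thesis using \<open>j \<in> J\<close> by simp
    qed
    show "indicator {\<omega>\<in>space ppp_space. points \<omega> \<inter> C = {}} \<omega> = ennreal (\<Prod>(i, n)\<in>labels \<omega> \<inter> J \<times> UNIV. indicator (- C) (snd \<omega> (i, n)))"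
    proof (cases "points \<omega> \<inter> C = {}")
      case True
      then have "(\<Prod>(i, n)\<in>labels \<omega> \<inter> J \<times> UNIV. indicator (- C) (snd \<omega> (i, n))) = (1::real)"
        by (intro prod.neutral) (auto simp: points_def split: split_indicator)
      then show ?thesis using True w by simp
    next
      case False
      then obtain i n where "(i, n) \<in> labels \<omega>" "snd \<omega> (i, n) \<in> C" by (auto simp: points_def)
      then have "(\<Prod>(i, n)\<in>labels \<omega> \<inter> J \<times> UNIV. indicator (- C) (snd \<omega> (i, n))) = (0::real)"
        using sub[of i n] fin by (intro prod_zero) (auto intro!: bexI[of _ "(i, n)"])
      then show ?thesis using False by simp
    qed
  qed
  also have "\<dots> = ennreal (exp (- (\<integral>x. (1 - indicator (- C) x) \<partial>M)))"
  proof (rule ppp_functional[OF J])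
    have "(\<lambda>x. 1 - indicator C x :: real) \<in> borel_measurable M" by measurable
    then show "indicat_real (- C) \<in> borel_measurable M"
      by (rule back_subst[where P="\<lambda>f. f \<in> borel_measurable M"]) (auto split: split_indicator)
  qed (use C in \<open>auto split: split_indicator_asm\<close>)
  also have "(\<integral>x. (1 - indicator (- C) x) \<partial>M) = (\<integral>x. indicator C x \<partial>M :: real)"
    by (intro Bochner_Integration.integral_cong) (auto split: split_indicator)
  finally show ?thesis by simp
qed

text \<open>There are countably many pairs of labels, and for each pair the two images differ almost
  surely because the image law charges no single value.\<close>

lemma AE_inj_labels:
  fixes f :: "'s \<Rightarrow> 'c::{second_countable_topology, t2_space}"
  assumes f: "f \<in> borel_measurable M" and na: "\<And>y i. AE x in M. f x \<noteq> y \<or> x \<notin> E i"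
  shows "AE \<omega> in ppp_space. inj_on (\<lambda>p. f (snd \<omega> p)) (labels \<omega>)"
proof -
  have "AE z in pos_space. f (z p) \<noteq> f (z p')" if "p \<in> active \<times> UNIV" "p' \<in> active \<times> UNIV" "p \<noteq> p'" for p p'
    unfolding pos_space_def
  proof (rule AE_PiM_neq)
    fix y
    have "AE x in M. x \<in> E (fst p') \<longrightarrow> f x \<noteq> y" using na[of y "fst p'"] by (auto elim: eventually_mono)
    then show "AE x in (case p' of (i, n) \<Rightarrow> uniform_measure M (E i)). f x \<noteq> y"
      using that by (auto simp: split_beta intro!: AE_uniform_measureI)
  qed (use that f in \<open>auto simp: split_beta prob_uniform\<close>)
  then have "AE z in pos_space. \<forall>p\<in>active \<times> UNIV. \<forall>p'\<in>active \<times> UNIV. p \<noteq> p' \<longrightarrow> f (z p) \<noteq> f (z p')"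
    by (intro AE_ball_countable' ) auto
  then have "AE \<omega> in ppp_space. \<forall>p\<in>active \<times> UNIV. \<forall>p'\<in>active \<times> UNIV. p \<noteq> p' \<longrightarrow> f (snd \<omega> p) \<noteq> f (snd \<omega> p')"
    unfolding ppp_space_def by (rule AE_pair_snd[OF pos.sigma_finite_measure_axioms])
  then show ?thesis
    by eventually_elim (auto simp: inj_on_def labels_def)
qed

end

text \<open>Once the coefficients below \<open>k\<close> vanish, the series can be divided by
  \<open>s ^ k\<close>; letting \<open>s\<close> tend to 0 from the right, the side on which the sum
  is known, leaves \<open>d k\<close>.\<close>

lemma powser_zero_coeffs:
  fixes d :: "nat \<Rightarrow> real"
  assumes d: "\<And>s. 0 < s \<Longrightarrow> s < 1 \<Longrightarrow> (\<lambda>k. d k * s ^ k) sums 0"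
  shows "d k = 0"
proof (induct k rule: less_induct)
  case (less k)
  have s: "(\<lambda>j. d (j + k) * s ^ j) sums 0" if "0 < s" "s < 1" for s
  proof -
    have "(\<lambda>j. d (j + k) * s ^ (j + k)) sums 0"
      using d[OF that] less by (subst sums_zero_iff_shift) auto
    moreover have "1 / s ^ k * (d (j + k) * s ^ (j + k)) = d (j + k) * s ^ j" for j
      using that by (simp add: power_add)
    moreover note sums_mult[OF calculation(1), of "1 / s ^ k"]
    ultimately show ?thesis by (simp only: mult_zero_right)
  qed
  have "summable (\<lambda>j. d (j + k) * x ^ j)" if "norm x < 1/2" for x
  proof (rule powser_inside)
    show "summable (\<lambda>j. d (j + k) * (1/2) ^ j)" using s[of "1/2"] by (simp add: sums_iff)
  qed (use that in simp)
  then have "((\<lambda>x. \<Sum>j. d (j + k) * x ^ j) \<longlongrightarrow> d (0 + k)) (at 0)"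
    by (intro powser_limit_0[of "1/2" "\<lambda>j. d (j + k)"]) (auto simp: summable_sums)
  then have "((\<lambda>x. \<Sum>j. d (j + k) * x ^ j) \<longlongrightarrow> d k) (at_right 0)"
    by (auto intro: filterlim_mono at_le)
  moreover have "eventually (\<lambda>x. (\<Sum>j. d (j + k) * x ^ j) = 0) (at_right (0::real))"
    unfolding eventually_at_right_field using s by (intro exI[of _ 1]) (auto simp: sums_iff)
  then have "((\<lambda>x. \<Sum>j. d (j + k) * x ^ j) \<longlongrightarrow> 0) (at_right 0)"
    by (rule tendsto_eventually)
  ultimately show ?case
    by (rule tendsto_unique[rotated]) simp
qed

text \<open>Both sides of \<open>pgf\<close> are power series in \<open>s\<close>, so their
  coefficients can be compared. The weight \<open>Y\<close> carries the remaining factors of a joint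
  generating function, which lets the counts be treated one after the other.\<close>

lemma (in prob_space) poisson_pgf_extract:
  fixes Y :: "'a \<Rightarrow> real" and N :: "'a \<Rightarrow> nat"
  assumes [measurable]: "Y \<in> borel_measurable M" "N \<in> measurable M (count_space UNIV)"
    and Y: "\<And>x. 0 \<le> Y x" "\<And>x. Y x \<le> 1" and C: "0 \<le> C" "0 \<le> l"
    and pgf: "\<And>s. 0 \<le> s \<Longrightarrow> s \<le> 1 \<Longrightarrow> (\<integral>\<^sup>+x. ennreal (Y x * s ^ N x) \<partial>M) = ennreal (C * exp (- (l * (1 - s))))"
  shows "(\<integral>\<^sup>+x. ennreal (Y x * of_bool (N x = k)) \<partial>M) = ennreal (C * (exp (- l) * l ^ k / fact k))"
proof -
  define a where "a k = enn2real (\<integral>\<^sup>+x. ennreal (Y x * of_bool (N x = k)) \<partial>M)" for k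
  have a: "(\<integral>\<^sup>+x. ennreal (Y x * of_bool (N x = k)) \<partial>M) = ennreal (a k)" for k
  proof -
    have "(\<integral>\<^sup>+x. ennreal (Y x * of_bool (N x = k)) \<partial>M) \<le> (\<integral>\<^sup>+x. 1 \<partial>M)"
      using Y by (intro nn_integral_mono) auto
    also have "\<dots> < \<top>" by (simp add: emeasure_space_1)
    finally show ?thesis unfolding a_def by simp
  qed
  have a0: "0 \<le> a k" for k by (simp add: a_def)
  define b where "b k = C * (exp (- l) * l ^ k / fact k)" for k
  have "(\<lambda>k. (a k - b k) * s ^ k) sums 0" if s: "0 < s" "s < 1" for s
  proof -
    have "ennreal (C * exp (- (l * (1 - s)))) = (\<integral>\<^sup>+x. (\<Sum>k. ennreal (Y x * of_bool (N x = k) * s ^ k)) \<partial>M)"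
    proof (subst pgf[symmetric])
      show "(\<integral>\<^sup>+x. ennreal (Y x * s ^ N x) \<partial>M) = (\<integral>\<^sup>+x. (\<Sum>k. ennreal (Y x * of_bool (N x = k) * s ^ k)) \<partial>M)"
      proof (intro nn_integral_cong)
        fix x
        have "(\<Sum>k. ennreal (Y x * of_bool (N x = k) * s ^ k)) = (\<Sum>k\<in>{N x}. ennreal (Y x * of_bool (N x = k) * s ^ k))"
          by (intro suminf_finite) auto
        then show "ennreal (Y x * s ^ N x) = (\<Sum>k. ennreal (Y x * of_bool (N x = k) * s ^ k))" by simp
      qed
    qed (use s in auto)
    also have "\<dots> = (\<Sum>k. \<integral>\<^sup>+x. ennreal (Y x * of_bool (N x = k) * s ^ k) \<partial>M)"
      by (intro nn_integral_suminf) measurable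
    also have "\<dots> = (\<Sum>k. ennreal (a k * s ^ k))"
    proof (intro suminf_cong)
      fix k
      have "(\<integral>\<^sup>+x. ennreal (Y x * of_bool (N x = k) * s ^ k) \<partial>M) = (\<integral>\<^sup>+x. ennreal (Y x * of_bool (N x = k)) * ennreal (s ^ k) \<partial>M)"
        using s Y by (intro nn_integral_cong) (auto simp: ennreal_mult')
      also have "\<dots> = ennreal (a k * s ^ k)"
        using s a0 by (subst nn_integral_multc) (auto simp: a ennreal_mult')
      finally show "(\<integral>\<^sup>+x. ennreal (Y x * of_bool (N x = k) * s ^ k) \<partial>M) = ennreal (a k * s ^ k)" .
    qed
    finally have "(\<lambda>k. ennreal (a k * s ^ k)) sums ennreal (C * exp (- (l * (1 - s))))"
      using summable_sums[OF summableI] by metis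
    then have 1: "(\<lambda>k. a k * s ^ k) sums (C * exp (- (l * (1 - s))))"
      using s a0 C by (subst (asm) sums_ennreal) auto
    have 2: "(\<lambda>k. b k * s ^ k) sums (C * exp (- l) * exp (l * s))"
      using sums_mult[OF exp_converges[of "l * s"], of "C * exp (- l)"]
      by (simp add: b_def field_simps)
    have "C * exp (- l) * exp (l * s) = C * exp (- (l * (1 - s)))"
      by (simp add: exp_add[symmetric] algebra_simps)
    with sums_diff[OF 1 2] show ?thesis by (simp add: left_diff_distrib)
  qed
  then have "a k - b k = 0" by (rule powser_zero_coeffs)
  then show ?thesis using a[of k] by (simp add: b_def)
qed

text \<open>Restricting the product to \<open>g x \<noteq> 1\<close> makes it finite for \<open>g = 1\<close> outside a compact set
  (a product over an infinite set would be \<open>1\<close>).\<close>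

definition conf_prod :: "('a \<Rightarrow> real) \<Rightarrow> 'a set \<Rightarrow> real" where
  "conf_prod g \<gamma> = (\<Prod>x\<in>{x\<in>\<gamma>. g x \<noteq> 1}. g x)"

text \<open>For simple functions the functional depends on finitely many counts. The class contains
  the indicators of complements of relatively compact Borel sets and is stable under products and
  thinning, which is what the void events and the kernels produce.\<close>

definition test_fun :: "('a::topological_space \<Rightarrow> real) \<Rightarrow> bool" where
  "test_fun g \<longleftrightarrow> simple_function borel g \<and> (\<forall>x. 0 \<le> g x \<and> g x \<le> 1) \<and> (\<exists>K. compact K \<and> {x. g x \<noteq> 1} \<subseteq> K)"

lemma conf_prod_cong_finite:
  assumes "finite F" "{x\<in>\<gamma>. g x \<noteq> 1} \<subseteq> F" "F \<subseteq> \<gamma>"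
  shows "conf_prod g \<gamma> = (\<Prod>x\<in>F. g x)"
  unfolding conf_prod_def using assms by (intro prod.mono_neutral_left) auto

lemma conf_prod_bounds:
  assumes "\<And>x. 0 \<le> g x" "\<And>x. g x \<le> 1" shows "0 \<le> conf_prod g \<gamma>" "conf_prod g \<gamma> \<le> 1"
  using assms by (auto simp: conf_prod_def intro!: prod_nonneg prod_le_1)

section \<open>Multiplicative functionals and a partition of the space\<close>

context vague_space
begin

lemma test_funD:
  assumes "test_fun (g :: 'a \<Rightarrow> real)"
  shows "g \<in> borel_measurable borel" "0 \<le> g x" "g x \<le> 1" "0 \<le> conf_prod g \<gamma>" "conf_prod g \<gamma> \<le> 1"
    and "\<gamma> \<in> \<Gamma> \<Longrightarrow> finite {x\<in>\<gamma>. g x \<noteq> 1}"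
proof -
  obtain K where K: "compact K" "{x. g x \<noteq> 1} \<subseteq> K" using assms by (auto simp: test_fun_def)
  show "finite {x\<in>\<gamma>. g x \<noteq> 1}" if "\<gamma> \<in> \<Gamma>"
    by (rule finite_subset[OF _ config_spaceD[OF that K(1)]]) (use K in auto)
qed (use assms borel_measurable_simple_function conf_prod_bounds[of g] in \<open>auto simp: test_fun_def\<close>)

text \<open>Grouping the points by the value of \<open>g\<close> leaves finitely many powers
  \<open>v ^ n\<close>, where \<open>n\<close> counts the points at which \<open>g\<close> equals
  \<open>v\<close>. The value 1 is left out, since its level set is usually not relatively
  compact.\<close>

lemma conf_prod_measurable:
  assumes g: "test_fun (g :: 'a \<Rightarrow> real)"
  shows "conf_prod g \<in> borel_measurable conf_borel"
proof -
  let ?V = "range g - {1}"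
  have fin: "finite ?V" using g by (auto simp: test_fun_def simple_function_def)
  obtain K where K: "compact K" "{x. g x \<noteq> 1} \<subseteq> K" using g by (auto simp: test_fun_def)
  have "(\<lambda>\<gamma>. \<Prod>v\<in>?V. v ^ card (\<gamma> \<inter> g -` {v})) \<in> borel_measurable conf_borel"
  proof (rule borel_measurable_prod)
    fix v assume v: "v \<in> ?V"
    then have "g -` {v} \<subseteq> K" using K by auto
    then have "compact (closure (g -` {v}))" by (rule rel_compact_subset) fact
    moreover have "g -` {v} \<in> sets borel"
      using measurable_sets[OF test_funD(1)[OF g], of "{v}"] by simp
    ultimately have "(\<lambda>\<gamma>. card (\<gamma> \<inter> g -` {v})) \<in> measurable conf_borel (count_space UNIV)"
      by (intro measurable_card_Int)
    then show "(\<lambda>\<gamma>. v ^ card (\<gamma> \<inter> g -` {v})) \<in> borel_measurable conf_borel"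
      by (rule measurable_compose) simp
  qed
  moreover have "(\<Prod>v\<in>?V. v ^ card (\<gamma> \<inter> g -` {v})) = conf_prod g \<gamma>" if "\<gamma> \<in> space conf_borel" for \<gamma>
  proof -
    have "conf_prod g \<gamma> = (\<Prod>v\<in>?V. \<Prod>x\<in>{x\<in>{x\<in>\<gamma>. g x \<noteq> 1}. g x = v}. g x)"
      unfolding conf_prod_def using test_funD(6)[OF g] that fin
      by (intro prod.group[symmetric]) auto
    also have "\<dots> = (\<Prod>v\<in>?V. v ^ card (\<gamma> \<inter> g -` {v}))"
    proof (intro prod.cong refl)
      fix v assume v: "v \<in> ?V"
      have "(\<Prod>x\<in>{x\<in>{x\<in>\<gamma>. g x \<noteq> 1}. g x = v}. g x) = (\<Prod>x\<in>\<gamma> \<inter> g -` {v}. v)"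
        using v by (intro prod.cong) auto
      then show "(\<Prod>x\<in>{x\<in>{x\<in>\<gamma>. g x \<noteq> 1}. g x = v}. g x) = v ^ card (\<gamma> \<inter> g -` {v})" by simp
    qed
    finally show ?thesis by simp
  qed
  ultimately show ?thesis by (simp only: cong: measurable_cong)
qed

text \<open>The partition on which Poisson points are sampled: each piece lies in a compact set, and
  every compact set is covered by the first few pieces.\<close>

definition piece :: "nat \<Rightarrow> 'a set" where
  "piece = disjointed (from_nat_into compact_base)"

lemma piece:
  shows piece_sets: "piece n \<in> sets borel" and piece_disj: "disjoint_family piece"
    and piece_UN: "(\<Union>n. piece n) = UNIV" and piece_sub: "\<exists>K. compact K \<and> piece n \<subseteq> K"
    and piece_compact: "compact K \<Longrightarrow> \<exists>n. K \<subseteq> (\<Union>i<n. piece i)"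
proof -
  let ?c = "from_nat_into (compact_base :: 'a set set)"
  have ne: "(compact_base :: 'a set set) \<noteq> {}" using compact_base(3)[of UNIV undefined] by auto
  have c: "?c n \<in> compact_base" for n using from_nat_into[OF ne] .
  then have "?c n \<in> sets borel" for n using compact_base(2) by (intro borel_closed compact_imp_closed) auto
  then show "piece n \<in> sets borel" unfolding piece_def disjointed_def by (intro sets.Diff sets.finite_UN) auto
  show "disjoint_family piece" unfolding piece_def by (rule disjoint_family_disjointed)
  show "\<exists>K. compact K \<and> piece n \<subseteq> K"
    using c[of n] compact_base(2) disjointed_subset[of ?c n] unfolding piece_def by blast
  have surj: "\<exists>n. C = ?c n" if "C \<in> compact_base" for C
    using from_nat_into_surj[OF compact_base(1) that] by metis
  show cov: "\<exists>n. K \<subseteq> (\<Union>i<n. piece i)" if K: "compact K" for K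
  proof -
    have "K \<subseteq> (\<Union>n\<in>UNIV. interior (?c n))"
    proof
      fix x assume "x \<in> K"
      obtain C where "C \<in> compact_base" "x \<in> interior C" using compact_base(3)[of UNIV x] by auto
      with surj[of C] show "x \<in> (\<Union>n\<in>UNIV. interior (?c n))" by auto
    qed
    from compactE_image[OF K _ this] obtain T where T: "finite T" "K \<subseteq> (\<Union>n\<in>T. interior (?c n))" by auto
    then obtain n where n: "T \<subseteq> {..<n}" using finite_nat_bounded[OF T(1)] by blast
    have "K \<subseteq> (\<Union>i<n. ?c i)"
    proof
      fix x assume "x \<in> K"
      then obtain i where "i \<in> T" "x \<in> interior (?c i)" using T by blast
      then show "x \<in> (\<Union>i<n. ?c i)" using n interior_subset[of "?c i"] by blast
    qed
    also have "(\<Union>i<n. ?c i) = (\<Union>i<n. piece i)"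
      unfolding piece_def using finite_UN_disjointed_eq[of ?c n] by (simp add: lessThan_atLeast0)
    finally show ?thesis by blast
  qed
  show "(\<Union>n. piece n) = UNIV"
    using cov[of "{x}" for x] by (auto simp: finite_imp_compact)
qed

end

section \<open>The sampled Poisson configuration of a Radon measure\<close>

locale radon_space = vague_space "TYPE('a)" for m :: "'a::{t2_space, second_countable_topology} measure" +
  assumes sets_m [measurable_cong]: "sets m = sets borel"
    and compact_finite: "\<And>K. compact K \<Longrightarrow> emeasure m K < \<infinity>"
    and nonatomic: "\<And>x. emeasure m {x} = 0"
begin

lemma space_m [simp]: "space m = UNIV"
  using sets_eq_imp_space_eq[OF sets_m] by simp

lemma rel_compact_finite:
  assumes "B \<subseteq> K" "compact K" shows "emeasure m B < \<infinity>"
proof -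
  have "K \<in> sets m" using borel_compact[OF assms(2)] by (simp add: sets_m)
  then have "emeasure m B \<le> emeasure m K" using assms by (intro emeasure_mono)
  then show ?thesis using compact_finite[OF assms(2)] by (rule order_le_less_trans)
qed

lemma piece_finite: "emeasure m (piece i) < \<infinity>"
  using piece_sub[of i] rel_compact_finite by blast

sublocale m: sigma_finite_measure m
proof
  show "\<exists>A. countable A \<and> A \<subseteq> sets m \<and> \<Union> A = space m \<and> (\<forall>a\<in>A. emeasure m a \<noteq> \<infinity>)"
    using piece_finite piece_sets piece_UN
    by (intro exI[of _ "range piece"]) (auto simp: sets_m less_top)
qed

lemma integrable_test_fun: "test_fun g \<Longrightarrow> integrable m (\<lambda>x. 1 - g x)"
proof -
  assume g: "test_fun g"
  obtain K where K: "compact K" "{x. g x \<noteq> 1} \<subseteq> K" using g by (auto simp: test_fun_def)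
  have "K \<in> sets m" using borel_compact[OF K(1)] by (simp add: sets_m)
  show "integrable m (\<lambda>x. 1 - g x)"
  proof (rule Bochner_Integration.integrable_bound[OF integrable_real_indicator[OF \<open>K \<in> sets m\<close> compact_finite[OF K(1)]]])
    show "AE x in m. norm (1 - g x) \<le> norm (indicat_real K x)"
    proof (rule AE_I2)
      fix x
      have "g x = 1" if "x \<notin> K" using K(2) that by auto
      then show "norm (1 - g x) \<le> norm (indicat_real K x)"
        using test_funD(2,3)[OF g, of x] by (auto split: split_indicator)
    qed
    show "(\<lambda>x. 1 - g x) \<in> borel_measurable m" using test_funD(1)[OF g] by measurable
  qed
qed

end

locale poisson_config = radon_space m for m :: "'a::{t2_space, second_countable_topology} measure" +
  fixes z :: real assumes z_pos: "0 < z"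
begin

sublocale pp: poisson_pieces "scale_measure (ennreal z) m" piece
proof
  show "emeasure (scale_measure (ennreal z) m) (piece i) < \<infinity>" for i
    using piece_finite[of i] by (simp add: ennreal_mult_less_top)
qed (use piece_sets piece_disj sets_m in auto)

lemma points_config: "pp.points \<omega> \<in> \<Gamma>"
  unfolding config_space_def
proof (intro CollectI allI impI)
  fix K :: "'a set" assume "compact K"
  then obtain n where "K \<subseteq> (\<Union>i<n. piece i)" using piece_compact by blast
  then show "finite (pp.points \<omega> \<inter> K)" by (intro pp.points_finite[of "{..<n}"]) auto
qed

lemma measurable_points: "pp.points \<in> measurable pp.ppp_space conf_borel"
proof (rule vague_measurableI)
  fix B :: "'a set" assume "compact B"
  then have "B \<in> sets (scale_measure (ennreal z) m)" using borel_compact by (simp add: sets_m)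
  then show "{\<omega> \<in> space pp.ppp_space. pp.points \<omega> \<inter> B = {}} \<in> sets pp.ppp_space" by measurable
qed (rule points_config)

definition law :: "'a set measure" where
  "law = distr pp.ppp_space conf_borel pp.points"

sublocale law: prob_space law
  unfolding law_def by (intro prob_space.prob_space_distr pp.prob_space_ppp measurable_points)

lemma sets_law [measurable_cong]: "sets law = sets conf_borel"
  by (simp add: law_def)

text \<open>Non-atomicity makes the sampled positions almost surely distinct, so the product over
  the set of points equals the product over labels to which \<open>ppp_functional\<close>
  applies.\<close>

lemma law_functional:
  assumes g: "test_fun g"
  shows "(\<integral>\<^sup>+\<eta>. ennreal (conf_prod g \<eta>) \<partial>law) = ennreal (exp (- (z * (\<integral>x. (1 - g x) \<partial>m))))"
proof -
  obtain K where K: "compact K" "{x. g x \<noteq> 1} \<subseteq> K" using g by (auto simp: test_fun_def)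
  then obtain n where n: "K \<subseteq> (\<Union>i<n. piece i)" using piece_compact by blast
  have "(\<integral>\<^sup>+\<eta>. ennreal (conf_prod g \<eta>) \<partial>law) = (\<integral>\<^sup>+\<omega>. ennreal (conf_prod g (pp.points \<omega>)) \<partial>pp.ppp_space)"
    unfolding law_def using conf_prod_measurable[OF g] measurable_points by (subst nn_integral_distr) auto
  also have "\<dots> = (\<integral>\<^sup>+\<omega>. ennreal (\<Prod>(i, n)\<in>pp.labels \<omega> \<inter> {..<n} \<times> UNIV. g (snd \<omega> (i, n))) \<partial>pp.ppp_space)"
  proof (rule nn_integral_cong_AE)
    have "AE \<omega> in pp.ppp_space. inj_on (\<lambda>p. snd \<omega> p) (pp.labels \<omega>)"
    proof (rule pp.AE_inj_labels[of "\<lambda>x. x"])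
      fix y i
      have "AE x in scale_measure (ennreal z) m. x \<notin> {y}"
        by (intro AE_not_in null_setsI) (auto simp: nonatomic sets_m)
      then show "AE x in scale_measure (ennreal z) m. x \<noteq> y \<or> x \<notin> piece i" by eventually_elim auto
    qed (simp add: sets_m measurable_def)
    then show "AE \<omega> in pp.ppp_space. ennreal (conf_prod g (pp.points \<omega>)) =
      ennreal (\<Prod>(i, n)\<in>pp.labels \<omega> \<inter> {..<n} \<times> UNIV. g (snd \<omega> (i, n)))"
    proof eventually_elim
      case (elim \<omega>)
      let ?L = "{p\<in>pp.labels \<omega>. g (snd \<omega> p) \<noteq> 1}"
      have eq: "{x\<in>pp.points \<omega>. g x \<noteq> 1} = snd \<omega> ` ?L" by (auto simp: pp.points_def)
      have "conf_prod g (pp.points \<omega>) = (\<Prod>p\<in>?L. g (snd \<omega> p))"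
        unfolding conf_prod_def eq using elim by (subst prod.reindex) (auto simp: inj_on_def)
      also have "\<dots> = (\<Prod>p\<in>pp.labels \<omega> \<inter> {..<n} \<times> UNIV. g (snd \<omega> p))"
      proof (rule prod.mono_neutral_left)
        show "finite (pp.labels \<omega> \<inter> {..<n} \<times> UNIV)"
          by (rule finite_subset[of _ "SIGMA i:{..<n}. {..<fst \<omega> i}"]) (auto simp: pp.labels_def)
        \<comment> \<open>A sampled point with \<open>g\<close> different from 1 is in
          \<open>K\<close>, hence in one of the first \<open>n\<close> pieces; as the pieces are
          disjoint, this is the piece of its label.\<close>
        show "?L \<subseteq> pp.labels \<omega> \<inter> {..<n} \<times> UNIV"
        proof
          fix p assume p: "p \<in> ?L"
          then have "snd \<omega> p \<in> (\<Union>i<n. piece i)" using K n by auto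
          then obtain j where "j < n" "snd \<omega> p \<in> piece j" by auto
          moreover have "snd \<omega> p \<in> piece (fst p)" using p by (auto simp: pp.labels_def)
          ultimately have "piece (fst p) \<inter> piece j \<noteq> {}" by blast
          then have "fst p = j" using piece_disj unfolding disjoint_family_on_def by (metis UNIV_I)
          then have "fst p < n" using \<open>j < n\<close> by simp
          then show "p \<in> pp.labels \<omega> \<inter> {..<n} \<times> UNIV" using p by (cases p) auto
        qed
      qed auto
      finally show ?case by (simp add: split_beta)
    qed
  qed
  also have "\<dots> = ennreal (exp (- (\<integral>x. (1 - g x) \<partial>scale_measure (ennreal z) m)))"
  proof (rule pp.ppp_functional)
    show "g \<in> borel_measurable (scale_measure (ennreal z) m)"
      using test_funD(1)[OF g] by (simp add: measurable_def sets_m)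
    show "x \<in> (\<Union>i\<in>{..<n}. piece i)" if "g x \<noteq> 1" for x using K n that by blast
  qed (use test_funD(2,3)[OF g] in auto)
  also have "(\<integral>x. (1 - g x) \<partial>scale_measure (ennreal z) m) = z * (\<integral>x. (1 - g x) \<partial>m)"
  proof -
    have "scale_measure (ennreal z) m = density m (\<lambda>_. ennreal z)"
      by (intro measure_eqI) (auto simp: emeasure_density nn_integral_cmult_indicator)
    then show ?thesis
      using z_pos test_funD(1)[OF g] by (simp add: integral_density integral_mult_right)
  qed
  finally show ?thesis .
qed

end

section \<open>The transition kernels\<close>

lemma simple_function_prod:
  fixes f :: "'i \<Rightarrow> 'b \<Rightarrow> real"
  assumes "\<And>i. i \<in> I \<Longrightarrow> simple_function M (f i)"
  shows "simple_function M (\<lambda>x. \<Prod>i\<in>I. f i x)"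
proof (cases "finite I")
  case True
  then show ?thesis using assms by induct auto
qed simp

section \<open>Void events, unions and thinning\<close>

context vague_space
begin

lemma test_fun_void:
  assumes "B \<in> sets borel" "compact (closure (B :: 'a set))"
  shows "test_fun (indicat_real (- B))"
proof -
  have "simple_function borel (indicat_real (- B))"
    using assms(1) by (intro simple_function_indicator) auto
  moreover have "{x. indicat_real (- B) x \<noteq> 1} \<subseteq> closure B"
    using closure_subset[of B] by (auto split: split_indicator_asm)
  ultimately show ?thesis using assms(2) by (auto simp: test_fun_def intro!: exI[of _ "closure B"])
qed

text \<open>A point in \<open>B\<close> contributes the factor 0. Relative compactness makes
  \<open>\<gamma> \<inter> B\<close> finite, so the product really vanishes instead of defaulting to
  1.\<close>

lemma conf_prod_void:
  assumes "\<gamma> \<in> \<Gamma>" "compact (closure (B :: 'a set))"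
  shows "conf_prod (indicat_real (- B)) \<gamma> = indicator (void B) \<gamma>"
proof -
  have eq: "{x\<in>\<gamma>. indicat_real (- B) x \<noteq> 1} = \<gamma> \<inter> B" by (auto split: split_indicator)
  show ?thesis
  proof (cases "\<gamma> \<inter> B = {}")
    case True
    then show ?thesis using assms by (simp add: conf_prod_def eq)
  next
    case False
    then obtain x where "x \<in> \<gamma> \<inter> B" by blast
    then have "(\<Prod>x\<in>\<gamma> \<inter> B. indicat_real (- B) x) = 0"
      using config_space_rel_compact[OF assms] by (intro prod_zero bexI[of _ x]) auto
    then show ?thesis using False by (simp add: conf_prod_def eq)
  qed
qed

lemma emeasure_void_functional:
  assumes "B \<in> sets borel" "compact (closure (B :: 'a set))" "sets P = sets conf_borel"
  shows "emeasure P (void B) = (\<integral>\<^sup>+\<gamma>. ennreal (conf_prod (indicat_real (- B)) \<gamma>) \<partial>P)"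
proof -
  have "emeasure P (void B) = (\<integral>\<^sup>+\<gamma>. indicator (void B) \<gamma> \<partial>P)"
    using measurable_void[OF assms(1,2)] assms(3) by simp
  also have "\<dots> = (\<integral>\<^sup>+\<gamma>. ennreal (conf_prod (indicat_real (- B)) \<gamma>) \<partial>P)"
    using sets_eq_imp_space_eq[OF assms(3)] conf_prod_void[OF _ assms(2)]
    by (intro nn_integral_cong) (simp add: ennreal_indicator)
  finally show ?thesis .
qed

lemma conf_prod_Un:
  assumes g: "test_fun (g :: 'a \<Rightarrow> real)" and "\<eta> \<in> \<Gamma>" "\<gamma> \<in> \<Gamma>" "\<eta> \<inter> \<gamma> = {}"
  shows "conf_prod g (\<eta> \<union> \<gamma>) = conf_prod g \<eta> * conf_prod g \<gamma>"
proof -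
  have "{x\<in>\<eta> \<union> \<gamma>. g x \<noteq> 1} = {x\<in>\<eta>. g x \<noteq> 1} \<union> {x\<in>\<gamma>. g x \<noteq> 1}" by auto
  then show ?thesis
    unfolding conf_prod_def using assms test_funD(6)[OF g]
    by (simp only:) (intro prod.union_disjoint, auto)
qed

lemma countable_config: "\<gamma> \<in> \<Gamma> \<Longrightarrow> countable (\<gamma> :: 'a set)"
proof -
  assume \<gamma>: "\<gamma> \<in> \<Gamma>"
  have fin: "finite (\<gamma> \<inter> piece n)" for n
  proof -
    obtain K where K: "compact K" "piece n \<subseteq> K" using piece_sub by blast
    show ?thesis by (rule finite_subset[OF _ config_spaceD[OF \<gamma> K(1)]]) (use K in auto)
  qed
  have "countable (\<Union>n. \<gamma> \<inter> piece n)" by (rule countable_UN) (use fin countable_finite in auto)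
  moreover have "(\<Union>n. \<gamma> \<inter> piece n) = \<gamma>" using piece_UN by auto
  ultimately show ?thesis by simp
qed

lemma measurable_config_Un:
  "(\<lambda>(\<eta>1, \<eta>2). \<eta>1 \<union> \<eta>2) \<in> measurable (conf_borel \<Otimes>\<^sub>M conf_borel) (conf_borel :: 'a set measure)"
proof (rule vague_measurableI)
  fix B :: "'a set" assume "compact B"
  then have [measurable]: "void B \<in> sets conf_borel" by (rule measurable_void_compact)
  have "{p \<in> space (conf_borel \<Otimes>\<^sub>M conf_borel). fst p \<in> void B \<and> snd p \<in> void B} \<in> sets (conf_borel \<Otimes>\<^sub>M conf_borel)"
    by measurable
  then show "{p \<in> space (conf_borel \<Otimes>\<^sub>M conf_borel). (case p of (\<eta>1, \<eta>2) \<Rightarrow> \<eta>1 \<union> \<eta>2) \<inter> B = {}} \<in> sets (conf_borel \<Otimes>\<^sub>M conf_borel)"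
    by (rule back_subst[where P="\<lambda>A. A \<in> sets _"]) (auto simp: space_pair_measure)
qed (auto simp: space_pair_measure intro: config_space_Un)

abbreviation thin_space :: "real \<Rightarrow> 'a set \<Rightarrow> ('a \<Rightarrow> bool) measure" where
  "thin_space p \<gamma> \<equiv> PiM \<gamma> (\<lambda>_. measure_pmf (bernoulli_pmf p))"

text \<open>A void event for a compact set only involves the finitely many points of
  \<open>\<gamma>\<close> in that set, hence finitely many coordinates.\<close>

lemma measurable_thin:
  assumes \<gamma>: "\<gamma> \<in> \<Gamma>"
  shows "(\<lambda>a. {x\<in>\<gamma>. a x}) \<in> measurable (thin_space p \<gamma>) conf_borel"
proof (rule vague_measurableI)
  show "{x\<in>\<gamma>. a x} \<in> \<Gamma>" for a using \<gamma> by (rule config_space_subset) auto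
  fix B :: "'a set" assume "compact B"
  then have fin: "finite (\<gamma> \<inter> B)" by (rule config_spaceD[OF \<gamma>])
  have "{a \<in> space (thin_space p \<gamma>). \<forall>x\<in>\<gamma> \<inter> B. \<not> a x} \<in> sets (thin_space p \<gamma>)"
  proof (rule sets.sets_Collect_finite_All[OF _ fin])
    fix x assume "x \<in> \<gamma> \<inter> B"
    then have [measurable]: "(\<lambda>a. a x) \<in> measurable (thin_space p \<gamma>) (count_space UNIV)"
      using measurable_component_singleton[of x \<gamma> "\<lambda>_. measure_pmf (bernoulli_pmf p)"] by simp
    show "{a \<in> space (thin_space p \<gamma>). \<not> a x} \<in> sets (thin_space p \<gamma>)" by measurable
  qed
  then show "{a \<in> space (thin_space p \<gamma>). {x\<in>\<gamma>. a x} \<inter> B = {}} \<in> sets (thin_space p \<gamma>)"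
    by (rule back_subst[where P="\<lambda>A. A \<in> sets _"]) auto
qed

lemma prob_space_thinning:
  "\<gamma> \<in> \<Gamma> \<Longrightarrow> prob_space (thinning p (\<gamma> :: 'a set))"
  unfolding thinning_def
  by (intro prob_space.prob_space_distr measurable_thin prob_space_PiM prob_space_measure_pmf)

text \<open>Independent points contribute their means: a point is kept with probability
  \<open>p\<close> and then gives \<open>g x\<close>, otherwise 1, with mean
  \<open>1 - p * (1 - g x)\<close>. Only the finitely many points with \<open>g x \<noteq> 1\<close>
  enter.\<close>

lemma nn_integral_thin:
  assumes \<gamma>: "\<gamma> \<in> \<Gamma>" and g: "test_fun (g :: 'a \<Rightarrow> real)" and p: "0 \<le> p" "p \<le> 1"
  shows "(\<integral>\<^sup>+a. ennreal (conf_prod g {x\<in>\<gamma>. a x}) \<partial>thin_space p \<gamma>) = ennreal (conf_prod (\<lambda>x. 1 - p * (1 - g x)) \<gamma>)"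
proof -
  let ?F = "{x\<in>\<gamma>. g x \<noteq> 1}"
  have fin: "finite ?F" using test_funD(6)[OF g \<gamma>] .
  have eq: "ennreal (conf_prod g {x\<in>\<gamma>. a x}) = (\<Prod>x\<in>?F. ennreal (if a x then g x else 1))" for a
  proof -
    have "conf_prod g {x\<in>\<gamma>. a x} = (\<Prod>x\<in>?F. if a x then g x else 1)"
      unfolding conf_prod_def using fin by (intro prod.mono_neutral_cong_left) auto
    then show ?thesis using test_funD(2)[OF g] by (simp add: prod_ennreal)
  qed
  have "(\<integral>\<^sup>+a. ennreal (conf_prod g {x\<in>\<gamma>. a x}) \<partial>thin_space p \<gamma>) =
    (\<Prod>x\<in>?F. \<integral>\<^sup>+b. ennreal (if b then g x else 1) \<partial>measure_pmf (bernoulli_pmf p))"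
    unfolding eq using fin by (intro nn_integral_PiM_prod prob_space_measure_pmf) auto
  also have "\<dots> = (\<Prod>x\<in>?F. ennreal (1 - p * (1 - g x)))"
  proof (intro prod.cong refl)
    fix x
    have "(\<integral>\<^sup>+b. ennreal (if b then g x else 1) \<partial>measure_pmf (bernoulli_pmf p)) =
      ennreal (g x) * ennreal p + ennreal (1 - p)"
      using p by simp
    also have "\<dots> = ennreal (1 - p * (1 - g x))"
      using p test_funD(2)[OF g, of x] by (simp add: ennreal_mult'[symmetric] ennreal_plus[symmetric] algebra_simps del: ennreal_plus)
    finally show "(\<integral>\<^sup>+b. ennreal (if b then g x else 1) \<partial>measure_pmf (bernoulli_pmf p)) = ennreal (1 - p * (1 - g x))" .
  qed
  also have "\<dots> = ennreal (\<Prod>x\<in>?F. 1 - p * (1 - g x))"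
  proof (rule prod_ennreal)
    fix x
    have "p * (1 - g x) \<le> 1 * 1" using p test_funD(2,3)[OF g, of x] by (intro mult_mono) auto
    then show "0 \<le> 1 - p * (1 - g x)" by simp
  qed
  also have "(\<Prod>x\<in>?F. 1 - p * (1 - g x)) = conf_prod (\<lambda>x. 1 - p * (1 - g x)) \<gamma>"
    using fin by (intro conf_prod_cong_finite[symmetric]) auto
  finally show ?thesis .
qed

lemma test_fun_thin:
  assumes g: "test_fun (g :: 'a \<Rightarrow> real)" and p: "0 \<le> p" "p \<le> 1"
  shows "test_fun (\<lambda>x. 1 - p * (1 - g x))"
proof -
  have "simple_function borel ((\<lambda>y. 1 - p * (1 - y)) \<circ> g)"
    using g by (intro simple_function_compose) (simp add: test_fun_def)
  moreover have "0 \<le> 1 - p * (1 - g x) \<and> 1 - p * (1 - g x) \<le> 1" for x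
    using mult_mono[of p 1 "1 - g x" 1] p test_funD(2,3)[OF g, of x] by auto
  ultimately show ?thesis using g by (fastforce simp: test_fun_def comp_def)
qed

end

section \<open>Counts under the Poisson law and its uniqueness\<close>

context poisson_config
begin

lemma law_void:
  assumes "B \<in> sets borel" "compact (closure B)"
  shows "emeasure law (void B) = ennreal (exp (- (z * measure m B)))"
proof -
  have "(\<integral>x. (1 - indicat_real (- B) x) \<partial>m) = (\<integral>x. indicat_real B x \<partial>m)"
    by (intro Bochner_Integration.integral_cong) (auto split: split_indicator)
  then show ?thesis
    using emeasure_void_functional[OF assms sets_law] law_functional[OF test_fun_void[OF assms]] by simp
qed

text \<open>Each point of the countable set \<open>\<gamma>\<close> has measure 0 and is missed
  almost surely. Hence the union in \<open>transition\<close> almost surely adds the two counting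
  measures.\<close>

lemma law_AE_disjoint:
  assumes "\<gamma> \<in> \<Gamma>" shows "AE \<eta> in law. \<gamma> \<inter> \<eta> = {}"
proof -
  have "AE \<eta> in law. x \<notin> \<eta>" for x
  proof -
    have "emeasure law (void {x}) = 1"
      using law_void[of "{x}"] by (simp add: measure_def nonatomic)
    then have "AE \<eta> in law. \<eta> \<in> void {x}"
      by (intro law.AE_prob_1) (simp add: measure_def)
    then show ?thesis by eventually_elim auto
  qed
  then have "AE \<eta> in law. \<forall>x\<in>\<gamma>. x \<notin> \<eta>"
    by (intro AE_ball_countable' countable_config assms)
  then show ?thesis by eventually_elim auto
qed

text \<open>The exponents of the joint generating function are replaced by events one coordinate at a time.\<close>

lemma law_counts:
  fixes I :: "'i set"
  assumes I: "finite I" and B: "\<And>i. i \<in> I \<Longrightarrow> B i \<in> sets borel" "\<And>i. i \<in> I \<Longrightarrow> compact (closure (B i))"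
    and disj: "disjoint_family_on B I"
  shows "measure law {\<gamma>\<in>\<Gamma>. \<forall>i\<in>I. card (\<gamma> \<inter> B i) = k i} =
    (\<Prod>i\<in>I. exp (- (z * measure m (B i))) * (z * measure m (B i)) ^ k i / fact (k i))"
proof -
  define l where "l i = z * measure m (B i)" for i
  define p where "p i = exp (- l i) * l i ^ k i / fact (k i)" for i
  have l0: "0 \<le> l i" for i using z_pos by (simp add: l_def)
  have p0: "0 \<le> p i" for i using l0 by (simp add: p_def)
  have meas: "(\<lambda>\<gamma>. card (\<gamma> \<inter> B i)) \<in> measurable law (count_space UNIV)" if "i \<in> I" for i
    using measurable_card_Int[OF B[OF that]] by (simp add: measurable_cong_sets[OF sets_law refl])
  have "\<forall>s. (\<forall>i. 0 \<le> s i \<and> s i \<le> 1) \<longrightarrow>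
    (\<integral>\<^sup>+\<gamma>. ennreal ((\<Prod>i\<in>A. of_bool (card (\<gamma> \<inter> B i) = k i)) * (\<Prod>i\<in>I - A. s i ^ card (\<gamma> \<inter> B i))) \<partial>law) =
    ennreal ((\<Prod>i\<in>A. p i) * (\<Prod>i\<in>I - A. exp (- (l i * (1 - s i)))))" if "A \<subseteq> I" for A
    using finite_subset[OF that I] that
  proof (induct rule: finite_subset_induct')
    case empty
    show ?case
    proof (intro allI impI)
      fix s :: "'i \<Rightarrow> real" assume s: "\<forall>i. 0 \<le> s i \<and> s i \<le> 1"
      \<comment> \<open>With the value \<open>s i\<close> on \<open>B i\<close>,
        \<open>conf_prod g\<close> becomes the product of the powers
        \<open>s i ^ card (\<gamma> \<inter> B i)\<close>. Disjointness of the sets enters when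
        \<open>1 - g\<close> is integrated.\<close>
      define g where "g x = (\<Prod>i\<in>I. if x \<in> B i then s i else 1)" for x
      have supp: "\<exists>i\<in>I. x \<in> B i" if "g x \<noteq> 1" for x
      proof (rule ccontr)
        assume "\<not> ?thesis"
        then have "g x = 1" by (simp add: g_def)
        then show False using that by simp
      qed
      have g: "test_fun g"
        unfolding test_fun_def
      proof (intro conjI allI exI)
        show "simple_function borel g"
          unfolding g_def using B by (intro simple_function_prod simple_function_If) auto
        show "0 \<le> g x" "g x \<le> 1" for x using s by (auto simp: g_def intro!: prod_nonneg prod_le_1)
        show "compact (\<Union>i\<in>I. closure (B i))" using I B(2) by (intro compact_UN) auto
        show "{x. g x \<noteq> 1} \<subseteq> (\<Union>i\<in>I. closure (B i))"
        proof
          fix x assume "x \<in> {x. g x \<noteq> 1}"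
          then obtain i where "i \<in> I" "x \<in> B i" using supp by auto
          then show "x \<in> (\<Union>i\<in>I. closure (B i))" using closure_subset[of "B i"] by auto
        qed
      qed
      have eq: "conf_prod g \<gamma> = (\<Prod>i\<in>I. s i ^ card (\<gamma> \<inter> B i))" if "\<gamma> \<in> \<Gamma>" for \<gamma>
      proof -
        let ?F = "\<Union>i\<in>I. \<gamma> \<inter> B i"
        have F: "finite ?F" by (intro finite_UN_I I config_space_rel_compact[OF that] B(2))
        have "conf_prod g \<gamma> = (\<Prod>x\<in>?F. g x)"
        proof (rule conf_prod_cong_finite[OF F])
          show "{x\<in>\<gamma>. g x \<noteq> 1} \<subseteq> ?F" using supp by auto
        qed auto
        also have "\<dots> = (\<Prod>i\<in>I. \<Prod>x\<in>?F. if x \<in> B i then s i else 1)"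
          unfolding g_def by (rule prod.swap)
        also have "\<dots> = (\<Prod>i\<in>I. \<Prod>x\<in>\<gamma> \<inter> B i. s i)"
          using F by (intro prod.cong refl prod.mono_neutral_cong_right) auto
        finally show ?thesis by simp
      qed
      have int: "integrable m (indicat_real (B i))" if "i \<in> I" for i
        using B[OF that] closure_subset[of "B i"]
        by (intro integrable_real_indicator rel_compact_finite[of _ "closure (B i)"]) (auto simp: sets_m)
      have "(\<integral>x. (1 - g x) \<partial>m) = (\<integral>x. (\<Sum>i\<in>I. (1 - s i) * indicat_real (B i) x) \<partial>m)"
      proof (intro Bochner_Integration.integral_cong refl)
        fix x
        show "1 - g x = (\<Sum>i\<in>I. (1 - s i) * indicat_real (B i) x)"
        proof (cases "\<exists>j\<in>I. x \<in> B j")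
          case True
          then obtain j where j: "j \<in> I" "x \<in> B j" by blast
          then have nj: "x \<notin> B i" if "i \<in> I" "i \<noteq> j" for i
            using that disj unfolding disjoint_family_on_def by (metis disjoint_iff)
          have "g x = (\<Prod>i\<in>{j}. if x \<in> B i then s i else 1)"
            unfolding g_def using I j nj by (intro prod.mono_neutral_right) auto
          moreover have "(\<Sum>i\<in>I. (1 - s i) * indicat_real (B i) x) = (\<Sum>i\<in>{j}. (1 - s i) * indicat_real (B i) x)"
            using I j nj by (intro sum.mono_neutral_right) auto
          ultimately show ?thesis using j by simp
        next
          case False
          then show ?thesis by (simp add: g_def)
        qed
      qed
      also have "\<dots> = (\<Sum>i\<in>I. (1 - s i) * measure m (B i))"
        using int B sets_m by (subst Bochner_Integration.integral_sum) auto
      finally have "exp (- (z * (\<integral>x. (1 - g x) \<partial>m))) = (\<Prod>i\<in>I. exp (- (l i * (1 - s i))))"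
        using I by (simp add: exp_sum[symmetric] sum_negf[symmetric] sum_distrib_left l_def algebra_simps)
      moreover have "(\<integral>\<^sup>+\<gamma>. ennreal (conf_prod g \<gamma>) \<partial>law) = (\<integral>\<^sup>+\<gamma>. ennreal (\<Prod>i\<in>I. s i ^ card (\<gamma> \<inter> B i)) \<partial>law)"
        using sets_eq_imp_space_eq[OF sets_law] eq by (intro nn_integral_cong) simp
      ultimately show "(\<integral>\<^sup>+\<gamma>. ennreal ((\<Prod>i\<in>{}. of_bool (card (\<gamma> \<inter> B i) = k i)) * (\<Prod>i\<in>I - {}. s i ^ card (\<gamma> \<inter> B i))) \<partial>law) =
        ennreal ((\<Prod>i\<in>{}. p i) * (\<Prod>i\<in>I - {}. exp (- (l i * (1 - s i)))))"
        using law_functional[OF g] by simp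
    qed
  next
    case (insert a A)
    show ?case
    proof (intro allI impI)
      fix s :: "'i \<Rightarrow> real" assume s: "\<forall>i. 0 \<le> s i \<and> s i \<le> 1"
      define R where "R = I - insert a A"
      have IA: "I - A = insert a R" "a \<notin> R" "finite R" "finite A"
        using insert I by (auto simp: R_def intro: finite_subset)
      \<comment> \<open>\<open>Y\<close> and \<open>C\<close> collect the factors of all other
        coordinates. Varying the variable of \<open>a\<close> alone, through
        \<open>s(a := r)\<close>, leaves them fixed and produces the generating function that
        \<open>poisson_pgf_extract\<close> expects.\<close>
      define Y where "Y \<gamma> = (\<Prod>i\<in>A. of_bool (card (\<gamma> \<inter> B i) = k i)) * (\<Prod>i\<in>R. s i ^ card (\<gamma> \<inter> B i))" for \<gamma>
      define C where "C = (\<Prod>i\<in>A. p i) * (\<Prod>i\<in>R. exp (- (l i * (1 - s i))))"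
      have "(\<integral>\<^sup>+\<gamma>. ennreal (Y \<gamma> * of_bool (card (\<gamma> \<inter> B a) = k a)) \<partial>law) = ennreal (C * (exp (- l a) * l a ^ k a / fact (k a)))"
      proof (rule law.poisson_pgf_extract)
        show "(\<lambda>\<gamma>. card (\<gamma> \<inter> B a)) \<in> measurable law (count_space UNIV)" using insert by (intro meas)
        have "(\<lambda>\<gamma>. of_bool (card (\<gamma> \<inter> B i) = k i) :: real) \<in> borel_measurable law" if "i \<in> A" for i
          using that \<open>A \<subseteq> I\<close> by (intro measurable_compose[OF meas]) auto
        moreover have "(\<lambda>\<gamma>. s i ^ card (\<gamma> \<inter> B i)) \<in> borel_measurable law" if "i \<in> R" for i
          using that unfolding R_def by (intro measurable_compose[OF meas]) auto
        ultimately show "Y \<in> borel_measurable law"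
          unfolding Y_def by (intro borel_measurable_times borel_measurable_prod)
        show "0 \<le> Y \<gamma>" for \<gamma> unfolding Y_def using s by (intro mult_nonneg_nonneg prod_nonneg) auto
        show "Y \<gamma> \<le> 1" for \<gamma> unfolding Y_def using s
          by (intro mult_le_one prod_le_1 prod_nonneg) (auto simp: power_le_one)
        show "0 \<le> C" unfolding C_def using p0 by (intro mult_nonneg_nonneg prod_nonneg) auto
        fix r :: real assume r: "0 \<le> r" "r \<le> 1"
        have "(\<integral>\<^sup>+\<gamma>. ennreal ((\<Prod>i\<in>A. of_bool (card (\<gamma> \<inter> B i) = k i)) * (\<Prod>i\<in>I - A. (s(a := r)) i ^ card (\<gamma> \<inter> B i))) \<partial>law) =
          ennreal ((\<Prod>i\<in>A. p i) * (\<Prod>i\<in>I - A. exp (- (l i * (1 - (s(a := r)) i)))))"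
          using insert(5)[rule_format, of "s(a := r)"] insert(2,3) s r by auto
        moreover have "(\<Prod>i\<in>R. (s(a := r)) i ^ card (\<gamma> \<inter> B i)) = (\<Prod>i\<in>R. s i ^ card (\<gamma> \<inter> B i))" for \<gamma>
          using IA(2) by (intro prod.cong) auto
        moreover have "(\<Prod>i\<in>R. exp (- (l i * (1 - (s(a := r)) i)))) = (\<Prod>i\<in>R. exp (- (l i * (1 - s i))))"
          using IA(2) by (intro prod.cong) auto
        ultimately show "(\<integral>\<^sup>+\<gamma>. ennreal (Y \<gamma> * r ^ card (\<gamma> \<inter> B a)) \<partial>law) = ennreal (C * exp (- (l a * (1 - r))))"
          using IA by (simp add: Y_def C_def mult_ac)
      qed (rule l0)
      then show "(\<integral>\<^sup>+\<gamma>. ennreal ((\<Prod>i\<in>insert a A. of_bool (card (\<gamma> \<inter> B i) = k i)) * (\<Prod>i\<in>I - insert a A. s i ^ card (\<gamma> \<inter> B i))) \<partial>law) =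
        ennreal ((\<Prod>i\<in>insert a A. p i) * (\<Prod>i\<in>I - insert a A. exp (- (l i * (1 - s i)))))"
        unfolding R_def[symmetric] using insert(4) IA(4) by (simp add: Y_def C_def p_def mult_ac)
    qed
  qed
  \<comment> \<open>Once every coordinate is an event, the product over \<open>I - A\<close> is
    empty; the value 0 for \<open>s\<close> is an arbitrary choice.\<close>
  from this[of I, rule_format, of "\<lambda>_. 0"]
  have 1: "(\<integral>\<^sup>+\<gamma>. ennreal (\<Prod>i\<in>I. of_bool (card (\<gamma> \<inter> B i) = k i)) \<partial>law) = ennreal (\<Prod>i\<in>I. p i)" by simp
  let ?S = "{\<gamma>\<in>\<Gamma>. \<forall>i\<in>I. card (\<gamma> \<inter> B i) = k i}"
  have sp: "space law = \<Gamma>" using sets_eq_imp_space_eq[OF sets_law] by simp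
  have "{\<gamma>\<in>space law. \<forall>i\<in>I. card (\<gamma> \<inter> B i) = k i} \<in> sets law"
  proof (rule sets.sets_Collect_finite_All[OF _ I])
    fix i assume "i \<in> I"
    note [measurable] = meas[OF this]
    show "{\<gamma>\<in>space law. card (\<gamma> \<inter> B i) = k i} \<in> sets law" by measurable
  qed
  then have "emeasure law ?S = (\<integral>\<^sup>+\<gamma>. indicator ?S \<gamma> \<partial>law)" by (simp add: sp)
  also have "\<dots> = (\<integral>\<^sup>+\<gamma>. ennreal (\<Prod>i\<in>I. of_bool (card (\<gamma> \<inter> B i) = k i)) \<partial>law)"
  proof (intro nn_integral_cong)
    fix \<gamma> assume "\<gamma> \<in> space law"
    show "indicator ?S \<gamma> = ennreal (\<Prod>i\<in>I. of_bool (card (\<gamma> \<inter> B i) = k i))"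
    proof (cases "\<forall>i\<in>I. card (\<gamma> \<inter> B i) = k i")
      case False
      then obtain i where "i \<in> I" "card (\<gamma> \<inter> B i) \<noteq> k i" by blast
      then have "(\<Prod>i\<in>I. of_bool (card (\<gamma> \<inter> B i) = k i)) = (0::real)"
        using I by (intro prod_zero bexI[of _ i]) auto
      then show ?thesis using False by simp
    qed (use \<open>\<gamma> \<in> space law\<close> in \<open>simp add: sp\<close>)
  qed
  finally show ?thesis
    using 1 p0 by (simp add: measure_def prod_nonneg p_def l_def)
qed

lemma is_poisson_law: "is_poisson_measure (\<lambda>B. z * measure m B) law"
  unfolding is_poisson_measure_def
proof (intro conjI allI impI)
  fix n :: nat and B :: "nat \<Rightarrow> 'a set" and k :: "nat \<Rightarrow> nat"
  assume B: "\<forall>i<n. B i \<in> sets borel \<and> compact (closure (B i))"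
    and disj: "\<forall>i<n. \<forall>j<n. i \<noteq> j \<longrightarrow> B i \<inter> B j = {}"
  show "measure law {\<gamma>\<in>\<Gamma>. \<forall>i<n. card (\<gamma> \<inter> B i) = k i} =
    (\<Prod>i<n. exp (- (z * measure m (B i))) * (z * measure m (B i)) ^ k i / fact (k i))"
    using law_counts[of "{..<n}" B k] B disj by (simp add: disjoint_family_on_def Ball_def)
qed (auto intro: law.prob_space_axioms simp: sets_law)

text \<open>Uniqueness in the definite description comes from the void probabilities, the special
  case of one set and count 0.\<close>

lemma poisson_measure_eq: "poisson_measure z m = law"
  unfolding poisson_measure_def
proof (rule the_equality)
  show "is_poisson_measure (\<lambda>B. z * measure m B) law" by (rule is_poisson_law)
  fix Q assume Q: "is_poisson_measure (\<lambda>B. z * measure m B) Q"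
  then interpret Q: prob_space Q by (simp add: is_poisson_measure_def)
  have sets_Q: "sets Q = sets conf_borel" using Q by (simp add: is_poisson_measure_def)
  show "Q = law"
  proof (rule conf_measure_eqI)
    fix B :: "'a set" assume B: "B \<in> sets borel" "compact (closure B)"
    have "measure Q {\<gamma>\<in>\<Gamma>. \<forall>i<(1::nat). card (\<gamma> \<inter> B) = 0} = (\<Prod>i<(1::nat). exp (- (z * measure m B)) * (z * measure m B) ^ 0 / fact 0)"
      using Q B unfolding is_poisson_measure_def by (elim conjE allE[of _ "1::nat"] allE[of _ "\<lambda>_. B"] allE[of _ "\<lambda>_. 0::nat"]) auto
    \<comment> \<open>\<open>card\<close> is 0 on infinite sets as well; relative compactness of
      \<open>B\<close> excludes that case.\<close>
    moreover have "{\<gamma>\<in>\<Gamma>. \<forall>i<(1::nat). card (\<gamma> \<inter> B) = 0} = void B"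
      using config_space_rel_compact[OF _ B(2)] by auto
    ultimately have "measure Q (void B) = exp (- (z * measure m B))" by simp
    then show "emeasure Q (void B) = emeasure law (void B)"
      by (simp add: law_void[OF B] Q.emeasure_eq_measure)
  qed (auto simp: sets_Q sets_law Q.finite_measure_axioms)
qed

end

section \<open>Action of the kernels on multiplicative functionals\<close>

context radon_space
begin

text \<open>The Poisson part is integrated first. It almost surely avoids \<open>\<gamma>\<close>,
  so \<open>conf_prod g\<close> splits into two factors: the Poisson one has a constant mean given
  by \<open>law_functional\<close>, and the thinned one is averaged by
  \<open>nn_integral_thin\<close>.\<close>

lemma transition:
  assumes t: "0 < t" and \<gamma>: "\<gamma> \<in> \<Gamma>"
  shows prob_space_transition: "prob_space (transition m t \<gamma>)"
    and sets_transition: "sets (transition m t \<gamma>) = sets conf_borel"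
    and transition_functional: "test_fun g \<Longrightarrow> (\<integral>\<^sup>+\<eta>. ennreal (conf_prod g \<eta>) \<partial>transition m t \<gamma>) =
      ennreal (conf_prod (\<lambda>x. 1 - exp (- t) * (1 - g x)) \<gamma> * exp (- ((1 - exp (- t)) * (\<integral>x. (1 - g x) \<partial>m))))"
proof -
  interpret pc: poisson_config m "1 - exp (- t)" by unfold_locales (use t in simp)
  interpret th: prob_space "thinning (exp (- t)) \<gamma>" by (rule prob_space_thinning[OF \<gamma>])
  interpret pp: pair_prob_space "thinning (exp (- t)) \<gamma>" pc.law ..
  have tr: "transition m t \<gamma> = distr (thinning (exp (- t)) \<gamma> \<Otimes>\<^sub>M pc.law) conf_borel (\<lambda>(\<eta>1, \<eta>2). \<eta>1 \<union> \<eta>2)"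
    using t by (simp add: transition_def pc.poisson_measure_eq)
  have st: "sets (thinning (exp (- t)) \<gamma> \<Otimes>\<^sub>M pc.law) = sets (conf_borel \<Otimes>\<^sub>M conf_borel)"
    by (intro sets_pair_measure_cong) (auto simp: thinning_def pc.sets_law)
  have un: "(\<lambda>(\<eta>1, \<eta>2). \<eta>1 \<union> \<eta>2) \<in> measurable (thinning (exp (- t)) \<gamma> \<Otimes>\<^sub>M pc.law) conf_borel"
    using measurable_config_Un by (simp only: measurable_cong_sets[OF st refl])
  show "prob_space (transition m t \<gamma>)" unfolding tr by (rule pp.prob_space_distr[OF un])
  show "sets (transition m t \<gamma>) = sets conf_borel" by (simp add: tr)
  assume g: "test_fun g"
  have mg: "(\<lambda>\<eta>. ennreal (conf_prod g \<eta>)) \<in> borel_measurable conf_borel"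
    using conf_prod_measurable[OF g] by measurable
  have mg2: "(\<lambda>p. ennreal (conf_prod g (case p of (\<eta>1, \<eta>2) \<Rightarrow> \<eta>1 \<union> \<eta>2))) \<in> borel_measurable (thinning (exp (- t)) \<gamma> \<Otimes>\<^sub>M pc.law)"
    by (rule measurable_compose[OF un mg])
  let ?c = "ennreal (exp (- ((1 - exp (- t)) * (\<integral>x. (1 - g x) \<partial>m))))"
  have "(\<integral>\<^sup>+\<eta>. ennreal (conf_prod g \<eta>) \<partial>transition m t \<gamma>) =
    (\<integral>\<^sup>+p. ennreal (conf_prod g (case p of (\<eta>1, \<eta>2) \<Rightarrow> \<eta>1 \<union> \<eta>2)) \<partial>(thinning (exp (- t)) \<gamma> \<Otimes>\<^sub>M pc.law))"
    unfolding tr using un mg by (subst nn_integral_distr) auto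
  also have "\<dots> = (\<integral>\<^sup>+\<eta>1. \<integral>\<^sup>+\<eta>2. ennreal (conf_prod g (\<eta>1 \<union> \<eta>2)) \<partial>pc.law \<partial>thinning (exp (- t)) \<gamma>)"
    using pc.law.nn_integral_fst[OF mg2] by simp
  also have "\<dots> = (\<integral>\<^sup>+a. \<integral>\<^sup>+\<eta>2. ennreal (conf_prod g ({x\<in>\<gamma>. a x} \<union> \<eta>2)) \<partial>pc.law \<partial>thin_space (exp (- t)) \<gamma>)"
  proof -
    have "(\<lambda>\<eta>1. \<integral>\<^sup>+\<eta>2. ennreal (conf_prod g (\<eta>1 \<union> \<eta>2)) \<partial>pc.law) \<in> borel_measurable (thinning (exp (- t)) \<gamma>)"
      using pc.law.borel_measurable_nn_integral_fst[OF mg2] by simp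
    then show ?thesis
      unfolding thinning_def by (subst nn_integral_distr[OF measurable_thin[OF \<gamma>]]) auto
  qed
  also have "\<dots> = (\<integral>\<^sup>+a. ennreal (conf_prod g {x\<in>\<gamma>. a x}) * ?c \<partial>thin_space (exp (- t)) \<gamma>)"
  proof (intro nn_integral_cong)
    fix a
    let ?\<eta> = "{x\<in>\<gamma>. a x}"
    have \<eta>: "?\<eta> \<in> \<Gamma>" using \<gamma> by (rule config_space_subset) auto
    have "AE \<eta>2 in pc.law. ennreal (conf_prod g (?\<eta> \<union> \<eta>2)) = ennreal (conf_prod g ?\<eta>) * ennreal (conf_prod g \<eta>2)"
      using pc.law_AE_disjoint[OF \<gamma>] AE_space[of pc.law]
    proof eventually_elim
      case (elim \<eta>2)
      then have "\<eta>2 \<in> \<Gamma>" using sets_eq_imp_space_eq[OF pc.sets_law] by simp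
      then have "conf_prod g (?\<eta> \<union> \<eta>2) = conf_prod g ?\<eta> * conf_prod g \<eta>2"
        using elim by (intro conf_prod_Un g \<eta>) auto
      then show ?case using test_funD(4)[OF g] by (simp add: ennreal_mult)
    qed
    then have "(\<integral>\<^sup>+\<eta>2. ennreal (conf_prod g (?\<eta> \<union> \<eta>2)) \<partial>pc.law) = (\<integral>\<^sup>+\<eta>2. ennreal (conf_prod g ?\<eta>) * ennreal (conf_prod g \<eta>2) \<partial>pc.law)"
      by (rule nn_integral_cong_AE)
    also have "\<dots> = ennreal (conf_prod g ?\<eta>) * (\<integral>\<^sup>+\<eta>2. ennreal (conf_prod g \<eta>2) \<partial>pc.law)"
      using mg by (intro nn_integral_cmult) (simp add: measurable_cong_sets[OF pc.sets_law refl])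
    finally show "(\<integral>\<^sup>+\<eta>2. ennreal (conf_prod g (?\<eta> \<union> \<eta>2)) \<partial>pc.law) = ennreal (conf_prod g ?\<eta>) * ?c"
      by (simp only: pc.law_functional[OF g])
  qed
  also have "\<dots> = (\<integral>\<^sup>+a. ennreal (conf_prod g {x\<in>\<gamma>. a x}) \<partial>thin_space (exp (- t)) \<gamma>) * ?c"
    by (intro nn_integral_multc measurable_compose[OF measurable_thin[OF \<gamma>] mg])
  also have "\<dots> = ennreal (conf_prod (\<lambda>x. 1 - exp (- t) * (1 - g x)) \<gamma>) * ?c"
    using t by (subst nn_integral_thin[OF \<gamma> g]) auto
  finally show "(\<integral>\<^sup>+\<eta>. ennreal (conf_prod g \<eta>) \<partial>transition m t \<gamma>) =
      ennreal (conf_prod (\<lambda>x. 1 - exp (- t) * (1 - g x)) \<gamma> * exp (- ((1 - exp (- t)) * (\<integral>x. (1 - g x) \<partial>m))))"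
    by (simp add: ennreal_mult'')
qed

text \<open>It suffices to consider void events, whose probabilities are a constant times a
  multiplicative functional of the starting configuration.\<close>

lemma measurable_transition:
  assumes t: "0 < t"
  shows "transition m t \<in> measurable conf_borel (prob_algebra conf_borel)"
proof (rule measurable_prob_algebra_generated[OF sigma_voids Int_stable_voids voids_subset])
  fix A assume "A \<in> voids"
  then obtain B where A: "A = void B" "B \<in> sets borel" "compact (closure B)" by (auto simp: voids_def)
  let ?g = "indicat_real (- B)"
  have g: "test_fun ?g" by (rule test_fun_void[OF A(2,3)])
  have "test_fun (\<lambda>x. 1 - exp (- t) * (1 - ?g x))" using t by (intro test_fun_thin g) auto
  from conf_prod_measurable[OF this]
  have "(\<lambda>\<gamma>. ennreal (conf_prod (\<lambda>x. 1 - exp (- t) * (1 - ?g x)) \<gamma> * exp (- ((1 - exp (- t)) * (\<integral>x. (1 - ?g x) \<partial>m)))))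
    \<in> borel_measurable conf_borel" by measurable
  moreover have "emeasure (transition m t \<gamma>) A = ennreal (conf_prod (\<lambda>x. 1 - exp (- t) * (1 - ?g x)) \<gamma> * exp (- ((1 - exp (- t)) * (\<integral>x. (1 - ?g x) \<partial>m))))"
    if "\<gamma> \<in> space conf_borel" for \<gamma>
    using that emeasure_void_functional[OF A(2,3) sets_transition[OF t]] transition_functional[OF t _ g] by (simp add: A(1))
  ultimately show "(\<lambda>\<gamma>. emeasure (transition m t \<gamma>) A) \<in> borel_measurable conf_borel"
    by (simp only: cong: measurable_cong)
qed (use prob_space_transition[OF t] sets_transition[OF t] in auto)

end

section \<open>The graphical construction\<close>

text \<open>\<open>survive b ts x\<close> is the probability that a particle at \<open>x\<close> alive at time \<open>b\<close> is not in \<open>B\<close> at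
  time \<open>t\<close> for every \<open>(t, B)\<close> in \<open>ts\<close>, and \<open>immigrant s ts x\<close> is the rate (per unit of \<open>m\<close>) of
  particles born at \<open>x\<close> after time \<open>s\<close> that violate this condition.\<close>

fun survive :: "real \<Rightarrow> (real \<times> 'a set) list \<Rightarrow> 'a \<Rightarrow> real" where
  "survive b [] x = 1"
| "survive b ((t, B) # ts) x = 1 - exp (b - t) * (1 - indicator (- B) x * survive t ts x)"

fun immigrant :: "real \<Rightarrow> (real \<times> 'a set) list \<Rightarrow> 'a \<Rightarrow> real" where
  "immigrant s [] x = 0"
| "immigrant s ((t, B) # ts) x =
     (1 - exp (s - t)) * (1 - indicator (- B) x * survive t ts x) + immigrant t ts x"

text \<open>Memorylessness in algebraic form: the probability of a violation depends on the starting
  time only through the factor \<open>exp b\<close>, so the base time can be moved to any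
  \<open>t\<close>.\<close>

lemma survive_shift: "1 - survive b ts x = exp (b - t) * (1 - survive t ts x)"
  by (cases ts) (auto simp: exp_add[symmetric] mult.assoc[symmetric])

lemma survive_bounds: "sorted_wrt (<) (b # map fst ts) \<Longrightarrow> 0 \<le> survive b ts x \<and> survive b ts x \<le> 1"
proof (induct ts arbitrary: b)
  case (Cons p ts)
  obtain t B where p: "p = (t, B)" by (cases p)
  have IH: "0 \<le> survive t ts x" "survive t ts x \<le> 1" using Cons p by auto
  let ?u = "1 - indicat_real (- B) x * survive t ts x"
  have u: "0 \<le> ?u" "?u \<le> 1" using IH by (auto split: split_indicator)
  have "exp (b - t) \<le> 1" using Cons p by auto
  then have "exp (b - t) * ?u \<le> 1 * 1" using u by (intro mult_mono) auto
  then show ?case using u by (auto simp: p)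
qed simp

lemma immigrant_nonneg: "sorted_wrt (<) (s # map fst ts) \<Longrightarrow> 0 \<le> immigrant s ts x"
proof (induct ts arbitrary: s)
  case (Cons p ts)
  obtain t B where p: "p = (t, B)" by (cases p)
  have "0 \<le> survive t ts x" "survive t ts x \<le> 1" using survive_bounds[of t ts x] Cons p by auto
  then have "0 \<le> (1 - exp (s - t)) * (1 - indicat_real (- B) x * survive t ts x)"
    using Cons(2) p by (intro mult_nonneg_nonneg) (auto split: split_indicator)
  then show ?case using Cons p by auto
qed simp

section \<open>Exponential lifetimes and hitting probabilities\<close>

definition lifetime :: "real measure" where
  "lifetime = density lborel (exponential_density 1)"

interpretation lifetime: prob_space lifetime
  unfolding lifetime_def by (rule prob_space_exponential_density) simp

lemma sets_lifetime [simp, measurable_cong]: "sets lifetime = sets borel"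
  by (simp add: lifetime_def)

lemma space_lifetime [simp]: "space lifetime = UNIV"
  by (simp add: lifetime_def)

lemma lifetime_tail: "0 \<le> c \<Longrightarrow> emeasure lifetime {c<..} = ennreal (exp (- c))"
proof -
  assume c: "0 \<le> c"
  have "distributed lifetime lborel (\<lambda>x. x) (exponential_density 1)"
    unfolding distributed_def
  proof (intro conjI)
    show "distr lifetime lborel (\<lambda>x. x) = density lborel (\<lambda>x. ennreal (exponential_density 1 x))"
      using distr_id2[of lborel lifetime] by (simp add: lifetime_def)
    show "(\<lambda>x. x) \<in> measurable lifetime lborel" by (rule measurable_ident_sets) simp
    show "(\<lambda>x. ennreal (exponential_density 1 x)) \<in> borel_measurable lborel" by measurable
  qed
  from lifetime.exponential_distributedD_gt[OF this c] show ?thesis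
    by (simp add: lifetime.emeasure_eq_measure greaterThan_def)
qed

lemma lifetime_positive: "AE l in lifetime. 0 < l"
  using lifetime_tail[of 0] by (intro lifetime.AE_prob_1[of "{0<..}", simplified]) (simp add: measure_def)

text \<open>A particle stays at \<open>x\<close> until it dies. The event is therefore that it
  outlives the first listed time whose set contains \<open>x\<close>; entries whose set misses
  \<open>x\<close> are skipped, and \<open>survive_shift\<close> accounts for them.\<close>

lemma lifetime_hit:
  assumes "sorted_wrt (<) (b # map fst ts)"
  shows "emeasure lifetime {l. \<exists>(t, B)\<in>set ts. x \<in> B \<and> t < b + l} = ennreal (1 - survive b ts x)"
  using assms
proof (induct ts)
  case (Cons p ts)
  obtain t B where p: "p = (t, B)" by (cases p)
  have tb: "b < t" and later: "\<And>q. q \<in> set ts \<Longrightarrow> t < fst q" and srt: "sorted_wrt (<) (b # map fst ts)"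
    using Cons(2) by (auto simp: p)
  show ?case
  proof (cases "x \<in> B")
    case True
    have "{l. \<exists>(t, B)\<in>set (p # ts). x \<in> B \<and> t < b + l} = {t - b<..}"
    proof (intro equalityI subsetI)
      fix l assume "l \<in> {l. \<exists>(t, B)\<in>set (p # ts). x \<in> B \<and> t < b + l}"
      then obtain q where "q \<in> set (p # ts)" "fst q < b + l" by (auto simp del: set_simps)
      then have "t < b + l" using later[of q] by (auto simp: p)
      then show "l \<in> {t - b<..}" by auto
    qed (use True in \<open>auto simp: p\<close>)
    then show ?thesis using True lifetime_tail[of "t - b"] tb by (simp add: p)
  next
    case False
    then have "{l. \<exists>(t, B)\<in>set (p # ts). x \<in> B \<and> t < b + l} = {l. \<exists>(t, B)\<in>set ts. x \<in> B \<and> t < b + l}"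
      by (auto simp: p)
    then show ?thesis using Cons(1)[OF srt] False survive_shift[of b ts x t] by (simp add: p)
  qed
qed simp

definition hit_set :: "real \<Rightarrow> (real \<times> 'a set) list \<Rightarrow> 'a \<Rightarrow> (real \<times> real) set" where
  "hit_set s ts x = {(b, l). s < b \<and> (\<exists>(t, B)\<in>set ts. x \<in> B \<and> b \<le> t \<and> t < b + l)}"

lemma hit_set_sets [measurable]: "hit_set s ts x \<in> sets (borel \<Otimes>\<^sub>M borel)"
proof -
  have "hit_set s ts x = {p\<in>space (borel \<Otimes>\<^sub>M borel). s < fst p} \<inter>
    (\<Union>q\<in>set ts. if x \<in> snd q then {p\<in>space (borel \<Otimes>\<^sub>M borel). fst p \<le> fst q \<and> fst q < fst p + snd p} else {})"
    by (auto simp: hit_set_def space_pair_measure split: if_splits)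
  also have "\<dots> \<in> sets (borel \<Otimes>\<^sub>M borel)"
    by (intro sets.Int sets.finite_UN) (auto intro!: borel_measurable_less borel_measurable_le)
  finally show ?thesis .
qed

text \<open>Births in \<open>(s, t]\<close> are separated from births after the first time
  \<open>t\<close>. A particle born at \<open>b\<close> in that interval must live beyond
  \<open>t\<close>, with probability \<open>exp (b - t)\<close>, and integrating over
  \<open>b\<close> gives the factor \<open>1 - exp (s - t)\<close>; later births are the same
  problem with \<open>t\<close> in place of \<open>s\<close>.\<close>

lemma emeasure_hit_set:
  assumes "sorted_wrt (<) (s # map fst ts)"
  shows "emeasure (lborel \<Otimes>\<^sub>M lifetime) (hit_set s ts x) = ennreal (immigrant s ts x)"
proof -
  have sets: "sets (lborel \<Otimes>\<^sub>M lifetime) = sets (borel \<Otimes>\<^sub>M borel)"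
    by (intro sets_pair_measure_cong) auto
  have alt: "emeasure (lborel \<Otimes>\<^sub>M lifetime) (hit_set s ts x) =
      (\<integral>\<^sup>+b. emeasure lifetime (Pair b -` hit_set s ts x) \<partial>lborel)" for s ts
    by (rule lifetime.emeasure_pair_measure_alt) (simp add: sets)
  show ?thesis using assms
  proof (induct ts arbitrary: s)
    case Nil
    then show ?case by (simp add: hit_set_def)
  next
    case (Cons p ts)
    obtain t B where p: "p = (t, B)" by (cases p)
    have st: "s < t" and later: "\<And>q. q \<in> set ts \<Longrightarrow> t < fst q" and srt: "sorted_wrt (<) (t # map fst ts)"
      using Cons(2) by (auto simp: p)
    \<comment> \<open>The probability that a particle at \<open>x\<close> which is alive at
      \<open>t\<close> is caught at \<open>t\<close> or at a later listed time.\<close>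
    define u where "u = 1 - indicat_real (- B) x * survive t ts x"
    have u0: "0 \<le> u" using survive_bounds[OF srt, of x] by (auto simp: u_def split: split_indicator)
    \<comment> \<open>A birth exactly at \<open>t\<close> would break the strict order required by
      \<open>lifetime_hit\<close>; a single instant is null for Lebesgue measure.\<close>
    have slice: "emeasure lifetime (Pair b -` hit_set s (p # ts) x) =
      ennreal (exp (b - t) * u) * indicator {s<..t} b + emeasure lifetime (Pair b -` hit_set t ts x)"
      if "b \<noteq> t" for b
    proof -
      consider "b \<le> s" | "s < b" "b < t" | "t < b" using \<open>b \<noteq> t\<close> by linarith
      then show ?thesis
      proof cases
        case 1
        then show ?thesis using st by (simp add: hit_set_def vimage_def)
      next
        case 2
        have "b \<le> fst q" if "q \<in> set (p # ts)" for q using that later[of q] 2 by (auto simp: p)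
        then have "Pair b -` hit_set s (p # ts) x = {l. \<exists>(t, B)\<in>set (p # ts). x \<in> B \<and> t < b + l}"
          using 2 by (force simp: hit_set_def)
        moreover have "sorted_wrt (<) (b # map fst (p # ts))" using 2 Cons(2) later by (auto simp: p) force
        ultimately show ?thesis using lifetime_hit[of b "p # ts" x] 2
          by (simp add: p u_def hit_set_def vimage_def)
      next
        case 3
        then have "Pair b -` hit_set s (p # ts) x = Pair b -` hit_set t ts x"
          using st by (auto simp: hit_set_def p)
        then show ?thesis using 3 by simp
      qed
    qed
    have "emeasure (lborel \<Otimes>\<^sub>M lifetime) (hit_set s (p # ts) x) =
      (\<integral>\<^sup>+b. ennreal (exp (b - t) * u) * indicator {s<..t} b + emeasure lifetime (Pair b -` hit_set t ts x) \<partial>lborel)"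
      unfolding alt using AE_lborel_singleton[of t]
      by (intro nn_integral_cong_AE) (auto elim!: eventually_mono simp: slice)
    also have "\<dots> = (\<integral>\<^sup>+b. ennreal (exp (b - t) * u) * indicator {s<..t} b \<partial>lborel) + emeasure (lborel \<Otimes>\<^sub>M lifetime) (hit_set t ts x)"
      unfolding alt
      by (rule nn_integral_add) (auto intro!: lifetime.measurable_emeasure_Pair simp: sets)
    \<comment> \<open>Adding the endpoint \<open>s\<close> changes the integrand on a null set and
      gives the closed interval to which \<open>nn_integral_FTC_Icc\<close> applies.\<close>
    also have "(\<integral>\<^sup>+b. ennreal (exp (b - t) * u) * indicator {s<..t} b \<partial>lborel) =
      (\<integral>\<^sup>+b. ennreal (exp (b - t) * u) * indicator {s..t} b \<partial>lborel)"
      using AE_lborel_singleton[of s] by (intro nn_integral_cong_AE) (auto elim!: eventually_mono split: split_indicator)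
    also have "\<dots> = ennreal (exp (t - t) * u - exp (s - t) * u)"
      using st u0 by (intro nn_integral_FTC_Icc) (auto intro!: derivative_eq_intros)
    also have "exp (t - t) * u - exp (s - t) * u = (1 - exp (s - t)) * u" by (simp add: algebra_simps)
    also have "emeasure (lborel \<Otimes>\<^sub>M lifetime) (hit_set t ts x) = ennreal (immigrant t ts x)"
      using Cons(1)[OF srt] .
    finally show ?case
      using u0 st immigrant_nonneg[OF srt, of x] by (simp add: p u_def[symmetric] ennreal_plus)
  qed
qed

text \<open>The indicator of a half-open life span \<open>[b, b + l)\<close> is constant just before
  and just after any given time. For the finitely many particles that matter in a compact set these
  statements hold simultaneously, and \<open>limitin_vague\<close> applies on both sides.\<close>

lemma cadlag_particles:
  fixes Q :: "('a::topological_space \<times> real \<times> real) set"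
  assumes fin: "\<And>K T. compact K \<Longrightarrow> finite {(x, b, l). (x, b, l) \<in> Q \<and> x \<in> K \<and> b \<le> T}"
  shows "(\<lambda>t. if t < 0 then {} else {x. \<exists>b l. (x, b, l) \<in> Q \<and> b \<le> t \<and> t < b + l}) \<in> cadlag_paths"
proof -
  define w where "w t = (if t < 0 then {} else {x. \<exists>b l. (x, b, l) \<in> Q \<and> b \<le> t \<and> t < b + l})" for t
  have G: "{x. \<exists>b l. (x, b, l) \<in> Q \<and> b \<le> t \<and> P x b l} \<in> \<Gamma>" for t P
    unfolding config_space_def
  proof (intro CollectI allI impI)
    fix K :: "'a set" assume "compact K"
    show "finite ({x. \<exists>b l. (x, b, l) \<in> Q \<and> b \<le> t \<and> P x b l} \<inter> K)"
      by (rule finite_subset[OF _ finite_imageI[OF fin[OF \<open>compact K\<close>, of t], of fst]]) force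
  qed
  have w: "w t \<in> \<Gamma>" for t unfolding w_def using G[of t "\<lambda>x b l. t < b + l"] by simp
  have right: "limitin vague_topology w (w t) (at_right t)" if t: "0 \<le> t" for t
  proof (rule limitin_vague)
    fix K :: "'a set" assume K: "compact K"
    \<comment> \<open>The window ends after \<open>t\<close>, since births shortly after
      \<open>t\<close> must be among the finitely many particles under control.\<close>
    let ?F = "{(x, b, l). (x, b, l) \<in> Q \<and> x \<in> K \<and> b \<le> t + 1}"
    have "eventually (\<lambda>s. (b \<le> s \<and> s < b + l) \<longleftrightarrow> (b \<le> t \<and> t < b + l)) (at_right t)" for b l
    proof -
      have 1: "eventually (\<lambda>s. s < b) (at_right t)" if "t < b" for b :: real
        using that eventually_at_right_field by blast
      consider "t < b" | "b \<le> t" "t < b + l" | "b \<le> t" "b + l \<le> t" by linarith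
      then show ?thesis
      proof cases
        case 1 then show ?thesis using \<open>\<And>b. t < b \<Longrightarrow> eventually (\<lambda>s. s < b) (at_right t)\<close>[of b] by (auto elim: eventually_mono)
      next
        case 2 then show ?thesis
          using 1[of "b + l"] eventually_at_right_less[of t] by (auto elim: eventually_elim2)
      next
        case 3 then show ?thesis
          using eventually_at_right_less[of t] by (auto elim: eventually_mono)
      qed
    qed
    then have "eventually (\<lambda>s. \<forall>q\<in>?F. (fst (snd q) \<le> s \<and> s < fst (snd q) + snd (snd q)) \<longleftrightarrow> (fst (snd q) \<le> t \<and> t < fst (snd q) + snd (snd q))) (at_right t)"
      using fin[OF K, of "t + 1"] by (intro eventually_ball_finite) auto
    moreover have "eventually (\<lambda>s. t < s) (at_right t)" by (rule eventually_at_right_less)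
    moreover have "eventually (\<lambda>s. s < t + 1) (at_right t)" unfolding eventually_at_right_field by (intro exI[of _ "t + 1"]) auto
    ultimately show "eventually (\<lambda>s. w s \<inter> K = w t \<inter> K) (at_right t)"
    proof eventually_elim
      case (elim s)
      have "x \<in> w s \<longleftrightarrow> x \<in> w t" if "x \<in> K" for x
      proof -
        have "(x, b, l) \<in> Q \<Longrightarrow> (b \<le> s \<and> s < b + l) \<longleftrightarrow> (b \<le> t \<and> t < b + l)" for b l
          using elim(1)[rule_format, of "(x, b, l)"] that elim(2,3) by (cases "b \<le> t + 1") auto
        then show ?thesis using t elim(2) by (auto simp: w_def)
      qed
      then show ?case by auto
    qed
  qed (use w in auto)
  have left: "\<exists>l. limitin vague_topology w l (at_left t)" if t: "0 < t" for t
  proof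
    \<comment> \<open>The left limit omits particles born exactly at \<open>t\<close> and keeps
      those dying exactly at \<open>t\<close>. The conjunct \<open>b \<le> t\<close> gives the set
      the shape of \<open>G\<close>.\<close>
    let ?l = "{x. \<exists>b l. (x, b, l) \<in> Q \<and> b \<le> t \<and> (b < t \<and> t \<le> b + l)}"
    show "limitin vague_topology w ?l (at_left t)"
    proof (rule limitin_vague)
      show "?l \<in> \<Gamma>" by (rule G)
      fix K :: "'a set" assume K: "compact K"
      let ?F = "{(x, b, l). (x, b, l) \<in> Q \<and> x \<in> K \<and> b \<le> t}"
      have lt: "eventually (\<lambda>s. s < t) (at_left t)" by (simp add: eventually_at_filter)
      have gt: "eventually (\<lambda>s. b < s) (at_left t)" if "b < t" for b
        using that eventually_at_left_field by blast
      have "eventually (\<lambda>s. (b \<le> s \<and> s < b + l) \<longleftrightarrow> (b < t \<and> t \<le> b + l)) (at_left t)" for b l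
      proof -
        consider "t \<le> b" | "b < t" "t \<le> b + l" | "b < t" "b + l < t" by linarith
        then show ?thesis
        proof cases
          case 1 then show ?thesis using lt by (auto elim: eventually_mono)
        next
          case 2 then show ?thesis using gt[of b] lt by (auto elim: eventually_elim2)
        next
          case 3 then show ?thesis using gt[of "b + l"] by (auto elim: eventually_mono)
        qed
      qed
      then have "eventually (\<lambda>s. \<forall>q\<in>?F. (fst (snd q) \<le> s \<and> s < fst (snd q) + snd (snd q)) \<longleftrightarrow> (fst (snd q) < t \<and> t \<le> fst (snd q) + snd (snd q))) (at_left t)"
        using fin[OF K, of t] by (intro eventually_ball_finite) auto
      moreover note lt gt[OF t]
      ultimately show "eventually (\<lambda>s. w s \<inter> K = ?l \<inter> K) (at_left t)"
      proof eventually_elim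
        case (elim s)
        have "x \<in> w s \<longleftrightarrow> x \<in> ?l" if "x \<in> K" for x
        proof -
          have "(x, b, l) \<in> Q \<Longrightarrow> (b \<le> s \<and> s < b + l) \<longleftrightarrow> (b < t \<and> t \<le> b + l)" for b l
            using elim(1)[rule_format, of "(x, b, l)"] that elim(2) by (cases "b \<le> t") auto
          then show ?thesis using elim(2,3) by (auto simp: w_def) force+
        qed
        then show ?case by auto
      qed
    qed (use w in auto)
  qed
  have "w t = {}" if "t < 0" for t using that by (simp add: w_def)
  then have "w \<in> cadlag_paths"
    unfolding cadlag_paths_def using w right left by simp
  then show ?thesis unfolding w_def .
qed

interpretation birth_life: pair_sigma_finite lborel lifetime ..

section \<open>Iterated kernels on void events, and the particle process\<close>

context vague_space
begin

lemma test_fun_mult: "test_fun (g :: 'a \<Rightarrow> real) \<Longrightarrow> test_fun h \<Longrightarrow> test_fun (\<lambda>x. g x * h x)"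
proof -
  assume g: "test_fun g" and h: "test_fun h"
  obtain K where K: "compact K" "{x. g x \<noteq> 1} \<subseteq> K" using g by (auto simp: test_fun_def)
  obtain L where L: "compact L" "{x. h x \<noteq> 1} \<subseteq> L" using h by (auto simp: test_fun_def)
  have "{x. g x * h x \<noteq> 1} \<subseteq> {x. g x \<noteq> 1} \<union> {x. h x \<noteq> 1}" by auto
  then have "{x. g x * h x \<noteq> 1} \<subseteq> K \<union> L" using Un_mono[OF K(2) L(2)] by (rule subset_trans)
  moreover have "compact (K \<union> L)" using K L by (intro compact_Un)
  ultimately show ?thesis
    using g h by (auto simp: test_fun_def mult_le_one)
qed

lemma conf_prod_mult:
  assumes g: "test_fun (g :: 'a \<Rightarrow> real)" and h: "test_fun h" and \<gamma>: "\<gamma> \<in> \<Gamma>"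
  shows "conf_prod (\<lambda>x. g x * h x) \<gamma> = conf_prod g \<gamma> * conf_prod h \<gamma>"
proof -
  let ?F = "{x\<in>\<gamma>. g x \<noteq> 1} \<union> {x\<in>\<gamma>. h x \<noteq> 1}"
  have F: "finite ?F" using test_funD(6)[OF g \<gamma>] test_funD(6)[OF h \<gamma>] by simp
  have "conf_prod (\<lambda>x. g x * h x) \<gamma> = (\<Prod>x\<in>?F. g x * h x)" "conf_prod g \<gamma> = (\<Prod>x\<in>?F. g x)" "conf_prod h \<gamma> = (\<Prod>x\<in>?F. h x)"
    by (intro conf_prod_cong_finite[OF F]; auto)+
  then show ?thesis by (simp add: prod.distrib)
qed

abbreviation rel_compact_list :: "(real \<times> 'a set) list \<Rightarrow> bool" where
  "rel_compact_list ts \<equiv> \<forall>(t, B)\<in>set ts. B \<in> sets borel \<and> compact (closure B)"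

lemma test_fun_survive:
  assumes "sorted_wrt (<) (b # map fst ts)" "rel_compact_list ts"
  shows "test_fun (survive b ts)"
  using assms
proof (induct ts arbitrary: b)
  case Nil
  then show ?case by (auto simp: test_fun_def)
next
  case (Cons p ts)
  obtain t B where p: "p = (t, B)" by (cases p)
  have "test_fun (\<lambda>x. indicat_real (- B) x * survive t ts x)"
    using Cons by (intro test_fun_mult test_fun_void) (auto simp: p)
  from test_fun_thin[OF this, of "exp (b - t)"] show ?case using Cons(2) by (simp add: p)
qed

end

context radon_space
begin

lemma integrable_immigrant:
  assumes "sorted_wrt (<) (s # map fst ts)" "rel_compact_list ts"
  shows "integrable m (immigrant s ts)"
  using assms
proof (induct ts arbitrary: s)
  case Nil
  have "immigrant s [] = (\<lambda>x. 0)" by (rule ext) simp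
  then show ?case by simp
next
  case (Cons p ts)
  obtain t B where p: "p = (t, B)" by (cases p)
  have "test_fun (\<lambda>x. indicat_real (- B) x * survive t ts x)"
    using Cons by (intro test_fun_mult test_fun_void test_fun_survive) (auto simp: p)
  from integrable_test_fun[OF this] have "integrable m (\<lambda>x. immigrant s (p # ts) x)" using Cons by (simp add: p)
  then show ?case .
qed

text \<open>After the first step the integrand is again multiplicative, with function
  \<open>indicator (- B) x * survive t ts x\<close>. One application of
  \<open>transition_functional\<close> then produces the recursion of \<open>survive\<close> in the
  product and that of \<open>immigrant\<close> in the exponent.\<close>

lemma fdd_void:
  assumes "sorted_wrt (<) (s # map fst ts)" "rel_compact_list ts" "\<gamma> \<in> \<Gamma>"
  shows "fdd m \<gamma> s (map (\<lambda>(t, B). (t, void B)) ts) =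
    ennreal (conf_prod (survive s ts) \<gamma> * exp (- (\<integral>x. immigrant s ts x \<partial>m)))"
  using assms
proof (induct ts arbitrary: s \<gamma>)
  case Nil
  then show ?case by (simp add: conf_prod_def)
next
  case (Cons p ts)
  obtain t B where p: "p = (t, B)" by (cases p)
  have st: "0 < t - s" and srt: "sorted_wrt (<) (t # map fst ts)" and rc: "rel_compact_list ts"
    and B: "B \<in> sets borel" "compact (closure B)" using Cons by (auto simp: p)
  let ?g = "\<lambda>x. indicat_real (- B) x * survive t ts x"
  let ?c = "exp (- (\<integral>x. immigrant t ts x \<partial>m))"
  have gB: "test_fun (indicat_real (- B))" and gS: "test_fun (survive t ts)"
    using test_fun_void[OF B] test_fun_survive[OF srt rc] by auto
  have g: "test_fun ?g" by (rule test_fun_mult[OF gB gS])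
  have sp: "space (transition m (t - s) \<gamma>) = \<Gamma>"
    using sets_eq_imp_space_eq[OF sets_transition[OF st Cons(4)]] by simp
  have "fdd m \<gamma> s (map (\<lambda>(t, B). (t, void B)) (p # ts)) =
    (\<integral>\<^sup>+\<gamma>1. ennreal (conf_prod ?g \<gamma>1) * ennreal ?c \<partial>transition m (t - s) \<gamma>)"
    unfolding p list.map prod.case fdd.simps
  proof (intro nn_integral_cong)
    fix \<gamma>1 assume "\<gamma>1 \<in> space (transition m (t - s) \<gamma>)"
    then have \<gamma>1: "\<gamma>1 \<in> \<Gamma>" by (simp add: sp)
    show "indicator (void B) \<gamma>1 * fdd m \<gamma>1 t (map (\<lambda>(t, B). (t, void B)) ts) = ennreal (conf_prod ?g \<gamma>1) * ennreal ?c"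
      using Cons(1)[OF srt rc \<gamma>1] conf_prod_void[OF \<gamma>1 B(2)] conf_prod_mult[OF gB gS \<gamma>1] test_funD(4)[OF gS]
      by (auto simp: ennreal_mult split: split_indicator)
  qed
  also have "\<dots> = (\<integral>\<^sup>+\<gamma>1. ennreal (conf_prod ?g \<gamma>1) \<partial>transition m (t - s) \<gamma>) * ennreal ?c"
    using conf_prod_measurable[OF g]
    by (intro nn_integral_multc) (simp add: measurable_cong_sets[OF sets_transition[OF st Cons(4)] refl])
  also have "(\<integral>\<^sup>+\<gamma>1. ennreal (conf_prod ?g \<gamma>1) \<partial>transition m (t - s) \<gamma>) =
    ennreal (conf_prod (survive s (p # ts)) \<gamma> * exp (- ((1 - exp (s - t)) * (\<integral>x. (1 - ?g x) \<partial>m))))"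
  proof -
    have "survive s (p # ts) = (\<lambda>x. 1 - exp (- (t - s)) * (1 - ?g x))" by (rule ext) (simp add: p)
    then show ?thesis using transition_functional[OF st Cons(4) g] by simp
  qed
  also have "\<dots> * ennreal ?c = ennreal (conf_prod (survive s (p # ts)) \<gamma> *
      (exp (- ((1 - exp (s - t)) * (\<integral>x. (1 - ?g x) \<partial>m))) * ?c))"
    by (simp add: ennreal_mult''[symmetric] mult.assoc)
  also have "exp (- ((1 - exp (s - t)) * (\<integral>x. (1 - ?g x) \<partial>m))) * ?c = exp (- (\<integral>x. immigrant s (p # ts) x \<partial>m))"
  proof -
    have "(\<integral>x. immigrant s (p # ts) x \<partial>m) = (\<integral>x. (1 - exp (s - t)) * (1 - ?g x) \<partial>m) + (\<integral>x. immigrant t ts x \<partial>m)"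
      unfolding p immigrant.simps
      by (intro Bochner_Integration.integral_add integrable_mult_right integrable_test_fun[OF g] integrable_immigrant[OF srt rc])
    also have "(\<integral>x. (1 - exp (s - t)) * (1 - ?g x) \<partial>m) = (1 - exp (s - t)) * (\<integral>x. (1 - ?g x) \<partial>m)"
      by (rule integral_mult_right_zero)
    finally show ?thesis by (simp add: exp_add[symmetric])
  qed
  finally show ?case .
qed

text \<open>Particles \<open>(x, b, l)\<close> are born at \<open>x\<close> at time \<open>b\<close> and live for a time \<open>l\<close>.\<close>

definition marked :: "('a \<times> real \<times> real) measure" where
  "marked = m \<Otimes>\<^sub>M (lborel \<Otimes>\<^sub>M lifetime)"

text \<open>Left-open birth intervals tile the positive half-line, so no particle is born at time 0
  and the initial state is undisturbed. Lifetimes are not cut, as their law has total mass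
  1.\<close>

definition cell :: "nat \<times> nat \<Rightarrow> ('a \<times> real \<times> real) set" where
  "cell = (\<lambda>(i, k). piece i \<times> ({real k<..real k + 1} \<times> UNIV))"

lemma sets_marked: "sets marked = sets (borel \<Otimes>\<^sub>M (borel \<Otimes>\<^sub>M borel))"
  unfolding marked_def by (intro sets_pair_measure_cong sets_m) auto

sublocale im: poisson_pieces marked cell
proof
  show "cell p \<in> sets marked" for p
    unfolding sets_marked cell_def using piece_sets by (cases p) auto
  show "emeasure marked (cell p) < \<infinity>" for p
  proof (cases p)
    case (Pair i k)
    have "emeasure marked (cell p) = emeasure m (piece i) * (emeasure lborel {real k<..real k + 1} * emeasure lifetime UNIV)"
      unfolding marked_def cell_def Pair using piece_sets sets_m
      by (simp add: birth_life.P.emeasure_pair_measure_Times lifetime.emeasure_pair_measure_Times)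
    also have "\<dots> < \<infinity>"
      using piece_finite[of i] lifetime.emeasure_space_1 by simp
    finally show ?thesis .
  qed
  show "disjoint_family cell"
    unfolding disjoint_family_on_def
  proof (intro ballI impI)
    fix p q :: "nat \<times> nat" assume pq: "p \<noteq> q"
    obtain i k j n where p: "p = (i, k)" and q: "q = (j, n)" by (cases p, cases q)
    have "k = n" if "real k < b" "b \<le> real k + 1" "real n < b" "b \<le> real n + 1" for b
      using that by linarith
    moreover have "piece i \<inter> piece j = {}" if "i \<noteq> j"
      using piece_disj that unfolding disjoint_family_on_def by blast
    ultimately show "cell p \<inter> cell q = {}"
      using pq unfolding p q cell_def prod.case Times_Int_Times by (cases "i = j") auto
  qed
qed

lemma points_birth_pos: "(x, b, l) \<in> im.points \<omega> \<Longrightarrow> 0 < b"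
proof -
  assume "(x, b, l) \<in> im.points \<omega>"
  then obtain i k where "(x, b, l) \<in> cell (i, k)" using im.points_subset[of \<omega>] by auto
  then have "real k < b" by (simp add: cell_def)
  then show "0 < b" by (rule le_less_trans[rotated]) simp
qed

lemma cell_cover:
  assumes K: "compact K"
  shows "\<exists>J. finite J \<and> K \<times> ({0<..T} \<times> UNIV) \<subseteq> (\<Union>p\<in>J. cell p)"
proof -
  obtain n where n: "K \<subseteq> (\<Union>i<n. piece i)" using piece_compact[OF K] by blast
  have "K \<times> ({0<..T} \<times> UNIV) \<subseteq> (\<Union>p\<in>{..<n} \<times> {..nat \<lceil>T\<rceil>}. cell p)"
  proof
    fix q assume "q \<in> K \<times> ({0<..T} \<times> (UNIV :: real set))"
    then obtain x b l where q: "q = (x, b, l)" "x \<in> K" "0 < b" "b \<le> T" by auto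
    then obtain i where i: "i < n" "x \<in> piece i" using n by blast
    \<comment> \<open>The interval \<open>(k, k + 1]\<close> containing \<open>b\<close> has index
      \<open>\<lceil>b\<rceil> - 1\<close> rather than the floor, because it is closed on the
      right.\<close>
    let ?k = "nat (\<lceil>b\<rceil> - 1)"
    have "0 \<le> \<lceil>b\<rceil> - 1" using q by linarith
    then have k: "real ?k = of_int (\<lceil>b\<rceil> - 1)" by simp
    have "real ?k < b" "b \<le> real ?k + 1" unfolding k by linarith+
    moreover have "?k \<le> nat \<lceil>T\<rceil>" using q ceiling_mono[of b T] by linarith
    ultimately show "q \<in> (\<Union>p\<in>{..<n} \<times> {..nat \<lceil>T\<rceil>}. cell p)"
      using i q by (intro UN_I[of "(i, ?k)"]) (auto simp: cell_def)
  qed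
  then show ?thesis by (intro exI[of _ "{..<n} \<times> {..nat \<lceil>T\<rceil>}"]) simp
qed

lemma points_finite_cell:
  assumes "compact K" shows "finite {(x, b, l). (x, b, l) \<in> im.points \<omega> \<and> x \<in> K \<and> b \<le> T}"
proof -
  obtain J where J: "finite J" "K \<times> ({0<..T} \<times> UNIV) \<subseteq> (\<Union>p\<in>J. cell p)" using cell_cover[OF assms] by blast
  have "finite (im.points \<omega> \<inter> (K \<times> ({0<..T} \<times> UNIV)))"
    by (rule im.points_finite[OF J(1)]) (rule subset_trans[OF Int_lower1 J(2)])
  moreover have "{(x, b, l). (x, b, l) \<in> im.points \<omega> \<and> x \<in> K \<and> b \<le> T} \<subseteq> im.points \<omega> \<inter> (K \<times> ({0<..T} \<times> UNIV))"
  proof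
    fix q assume "q \<in> {(x, b, l). (x, b, l) \<in> im.points \<omega> \<and> x \<in> K \<and> b \<le> T}"
    then obtain x b l where q: "q = (x, b, l)" "(x, b, l) \<in> im.points \<omega>" "x \<in> K" "b \<le> T" by blast
    then show "q \<in> im.points \<omega> \<inter> (K \<times> ({0<..T} \<times> UNIV))" using points_birth_pos[OF q(2)] by simp
  qed
  ultimately show ?thesis by (rule finite_subset[rotated])
qed

definition path :: "'a set \<Rightarrow> ('a \<Rightarrow> real) \<times> (nat \<times> nat \<Rightarrow> nat) \<times> ((nat \<times> nat) \<times> nat \<Rightarrow> 'a \<times> real \<times> real) \<Rightarrow> real \<Rightarrow> 'a set" where
  "path \<gamma> p t = (if t < 0 then {} else {x\<in>\<gamma>. t < fst p x} \<union> {x. \<exists>b l. (x, b, l) \<in> im.points (snd p) \<and> b \<le> t \<and> t < b + l})"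

definition path_space :: "'a set \<Rightarrow> (('a \<Rightarrow> real) \<times> (nat \<times> nat \<Rightarrow> nat) \<times> ((nat \<times> nat) \<times> nat \<Rightarrow> 'a \<times> real \<times> real)) measure" where
  "path_space \<gamma> = PiM \<gamma> (\<lambda>_. lifetime) \<Otimes>\<^sub>M im.ppp_space"

definition path_law :: "'a set \<Rightarrow> (real \<Rightarrow> 'a set) measure" where
  "path_law \<gamma> = distr (path_space \<gamma>) path_F (path \<gamma>)"

lemma path_cadlag:
  assumes \<gamma>: "\<gamma> \<in> \<Gamma>" shows "path \<gamma> p \<in> cadlag_paths"
proof -
  \<comment> \<open>Initial particles count as born at time 0, so both kinds form one particle
    set.\<close>
  let ?Q = "(\<lambda>x. (x, 0, fst p x)) ` \<gamma> \<union> im.points (snd p)"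
  have "path \<gamma> p = (\<lambda>t. if t < 0 then {} else {x. \<exists>b l. (x, b, l) \<in> ?Q \<and> b \<le> t \<and> t < b + l})"
  proof (rule ext)
    fix t
    have "x \<in> {x\<in>\<gamma>. t < fst p x} \<Longrightarrow> 0 \<le> t \<Longrightarrow> \<exists>b l. (x, b, l) \<in> ?Q \<and> b \<le> t \<and> t < b + l" for x
      by (rule exI[of _ 0], rule exI[of _ "fst p x"]) auto
    then show "path \<gamma> p t = (if t < 0 then {} else {x. \<exists>b l. (x, b, l) \<in> ?Q \<and> b \<le> t \<and> t < b + l})"
      unfolding path_def by auto
  qed
  also have "\<dots> \<in> cadlag_paths"
  proof (rule cadlag_particles)
    fix K :: "'a set" and T :: real assume K: "compact K"
    have "{(x, b, l). (x, b, l) \<in> ?Q \<and> x \<in> K \<and> b \<le> T} \<subseteq>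
      (\<lambda>x. (x, 0, fst p x)) ` (\<gamma> \<inter> K) \<union> {(x, b, l). (x, b, l) \<in> im.points (snd p) \<and> x \<in> K \<and> b \<le> T}" by auto
    then show "finite {(x, b, l). (x, b, l) \<in> ?Q \<and> x \<in> K \<and> b \<le> T}"
      by (rule finite_subset) (intro finite_UnI finite_imageI config_spaceD[OF \<gamma> K] points_finite_cell K)
  qed
  finally show ?thesis .
qed

end

section \<open>Cylinder sets of paths\<close>

abbreviation cylinder :: "(real \<times> 'a set set) list \<Rightarrow> (real \<Rightarrow> 'a::topological_space set) set" where
  "cylinder ts \<equiv> {\<omega>\<in>cadlag_paths. \<forall>(t, A)\<in>set ts. \<omega> t \<in> A}"

lemma sets_path_sigma:
  "sets (path_sigma T) = sigma_sets cadlag_paths {{\<omega>\<in>cadlag_paths. \<omega> t \<in> A} | t A. t \<in> T \<and> A \<in> sets conf_borel}"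
  unfolding path_sigma_def by (intro sets_measure_of) auto

lemma space_path_sigma [simp]: "space (path_sigma T) = cadlag_paths"
  unfolding path_sigma_def by (auto simp: space_measure_of_conv)

lemma eval_sets: "t \<in> T \<Longrightarrow> A \<in> sets conf_borel \<Longrightarrow> {\<omega>\<in>cadlag_paths. \<omega> t \<in> A} \<in> sets (path_sigma T)"
  unfolding sets_path_sigma by (intro sigma_sets.Basic) auto

lemma cylinder_sets:
  assumes "\<forall>(t, A)\<in>set ts. t \<in> T \<and> A \<in> sets conf_borel"
  shows "cylinder ts \<in> sets (path_sigma T)"
  using assms
proof (induct ts)
  case Nil
  then show ?case using sets.top[of "path_sigma T"] by simp
next
  case (Cons p ts)
  obtain t A where p: "p = (t, A)" by (cases p)
  have "cylinder (p # ts) = {\<omega>\<in>cadlag_paths. \<omega> t \<in> A} \<inter> cylinder ts" by (auto simp: p)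
  then show ?case using Cons eval_sets[of t T A] by (auto simp: p)
qed

lemma AE_pair_fst:
  assumes "sigma_finite_measure B" "AE x in A. P x"
  shows "AE p in A \<Otimes>\<^sub>M B. P (fst p)"
proof -
  interpret B: sigma_finite_measure B by fact
  obtain N where N: "{x \<in> space A. \<not> P x} \<subseteq> N" "emeasure A N = 0" "N \<in> sets A"
    using AE_E[OF assms(2)] by metis
  show ?thesis
    by (rule AE_I[where N="N \<times> space B"])
       (use N in \<open>auto simp: space_pair_measure B.emeasure_pair_measure_Times\<close>)
qed

context vague_space
begin

text \<open>Containing the countably many points of \<open>\<gamma>\<close> and having no others are
  countably many conditions, the second tested piece by piece. This makes starting in
  \<open>\<gamma>\<close> an event on path space.\<close>

lemma config_singleton_sets:
  assumes \<gamma>: "\<gamma> \<in> \<Gamma>" shows "{\<gamma>} \<in> sets (conf_borel :: 'a set measure)"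
proof -
  have count: "countable \<gamma>" by (rule countable_config[OF \<gamma>])
  have [measurable]: "\<gamma> \<in> sets borel" using borel_closed[OF config_closed[OF \<gamma>]] .
  have rc: "compact (closure (piece i - \<gamma>))" for i
    using piece_sub[of i] rel_compact_subset[of "piece i - \<gamma>"] by blast
  have "{\<eta>\<in>space conf_borel. \<forall>x\<in>\<gamma>. \<eta> \<notin> void {x}} \<in> sets conf_borel"
  proof (rule sets.sets_Collect_countable_All'[OF _ count])
    fix x
    have [measurable]: "void {x} \<in> sets conf_borel" by (rule measurable_void_compact) simp
    show "{\<eta>\<in>space conf_borel. \<eta> \<notin> void {x}} \<in> sets conf_borel" by measurable
  qed
  moreover have "(\<Inter>i. void (piece i - \<gamma>)) \<in> sets conf_borel"
    by (rule sets.countable_INT) (auto intro!: measurable_void rc piece_sets)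
  ultimately have "{\<eta>\<in>space conf_borel. \<forall>x\<in>\<gamma>. \<eta> \<notin> void {x}} \<inter> (\<Inter>i. void (piece i - \<gamma>)) \<in> sets conf_borel"
    by (rule sets.Int)
  also have "{\<eta>\<in>space conf_borel. \<forall>x\<in>\<gamma>. \<eta> \<notin> void {x}} \<inter> (\<Inter>i. void (piece i - \<gamma>)) = {\<gamma>}"
  proof (intro equalityI subsetI)
    fix \<eta> assume \<eta>: "\<eta> \<in> {\<eta>\<in>space conf_borel. \<forall>x\<in>\<gamma>. \<eta> \<notin> void {x}} \<inter> (\<Inter>i. void (piece i - \<gamma>))"
    then have 1: "\<gamma> \<subseteq> \<eta>" by auto
    have "\<eta> \<inter> (piece i - \<gamma>) = {}" for i using \<eta> by auto
    moreover have "\<exists>i. x \<in> piece i" for x using piece_UN by blast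
    ultimately have "\<eta> \<subseteq> \<gamma>" by blast
    then show "\<eta> \<in> {\<gamma>}" using 1 by auto
  qed (use \<gamma> in auto)
  finally show ?thesis .
qed

end

section \<open>Void probabilities of the particle process\<close>

context radon_space
begin

definition hit_region :: "(real \<times> 'a set) list \<Rightarrow> ('a \<times> real \<times> real) set" where
  "hit_region ts = {(x, p). p \<in> hit_set 0 ts x}"

text \<open>Separates the initial lifetimes from the immigrants, which are independent components of
  \<open>path_space\<close>. Birth times are strictly positive, so \<open>hit_region\<close>, with
  starting time 0, captures all immigrants.\<close>

lemma path_void_iff:
  assumes "\<forall>(t, B)\<in>set ts. 0 \<le> t"
  shows "(\<forall>(t, B)\<in>set ts. path \<gamma> p t \<inter> B = {}) \<longleftrightarrow>
    (\<forall>x\<in>\<gamma>. \<not> (\<exists>(t, B)\<in>set ts. x \<in> B \<and> t < 0 + fst p x)) \<and> im.points (snd p) \<inter> hit_region ts = {}"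
    (is "?L \<longleftrightarrow> ?R1 \<and> ?R2")
proof -
  have at: "path \<gamma> p t \<inter> B = {} \<longleftrightarrow> (\<forall>x\<in>\<gamma>. x \<in> B \<longrightarrow> \<not> t < fst p x) \<and>
      (\<forall>x b l. (x, b, l) \<in> im.points (snd p) \<longrightarrow> \<not> (x \<in> B \<and> b \<le> t \<and> t < b + l))"
    if "0 \<le> t" for t B
    using that by (auto simp: path_def)
  have "?L \<longleftrightarrow> (\<forall>(t, B)\<in>set ts. (\<forall>x\<in>\<gamma>. x \<in> B \<longrightarrow> \<not> t < fst p x) \<and>
      (\<forall>x b l. (x, b, l) \<in> im.points (snd p) \<longrightarrow> \<not> (x \<in> B \<and> b \<le> t \<and> t < b + l)))"
  proof (intro ball_cong refl)
    fix q assume q: "q \<in> set ts"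
    obtain t B where [simp]: "q = (t, B)" by (cases q)
    have "0 \<le> t" using assms q by auto
    from at[OF this, of B] show "(case q of (t, B) \<Rightarrow> path \<gamma> p t \<inter> B = {}) \<longleftrightarrow> (case q of (t, B) \<Rightarrow> (\<forall>x\<in>\<gamma>. x \<in> B \<longrightarrow> \<not> t < fst p x) \<and>
      (\<forall>x b l. (x, b, l) \<in> im.points (snd p) \<longrightarrow> \<not> (x \<in> B \<and> b \<le> t \<and> t < b + l)))" by simp
  qed
  moreover have "?R2 \<longleftrightarrow> (\<forall>(t, B)\<in>set ts. (\<forall>x b l. (x, b, l) \<in> im.points (snd p) \<longrightarrow> \<not> (x \<in> B \<and> b \<le> t \<and> t < b + l)))"
    using points_birth_pos[of _ _ _ "snd p"] unfolding hit_region_def hit_set_def disjoint_iff by fastforce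
  ultimately show ?thesis by auto
qed

lemma hit_region_sets:
  assumes "\<forall>(t, B)\<in>set ts. B \<in> sets borel" shows "hit_region ts \<in> sets marked"
proof -
  have "hit_region ts = (\<Union>q\<in>set ts. snd q \<times> {p \<in> space (borel \<Otimes>\<^sub>M borel). 0 < fst p \<and> fst p \<le> fst q \<and> fst q < fst p + snd p})"
    by (force simp: hit_region_def hit_set_def space_pair_measure)
  also have "\<dots> \<in> sets (borel \<Otimes>\<^sub>M (borel \<Otimes>\<^sub>M borel))"
  proof (intro sets.finite_UN pair_measureI)
    fix q assume "q \<in> set ts"
    then show "snd q \<in> sets borel" using assms by auto
    show "{p \<in> space (borel \<Otimes>\<^sub>M borel). 0 < fst p \<and> fst p \<le> fst q \<and> fst q < fst p + snd p} \<in> sets (borel \<Otimes>\<^sub>M (borel :: real measure))"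
      by measurable
  qed simp
  finally show ?thesis by (simp add: sets_marked)
qed

text \<open>The complement is literally the event of \<open>lifetime_hit\<close> for birth time
  \<open>b = 0\<close>, hence the term \<open>0 + l\<close>.\<close>

definition young_set :: "(real \<times> 'a set) list \<Rightarrow> 'a \<Rightarrow> real set" where
  "young_set ts x = {l. \<not> (\<exists>(t, B)\<in>set ts. x \<in> B \<and> t < 0 + l)}"

lemma young_set_sets [measurable]: "young_set ts x \<in> sets borel"
proof -
  have "young_set ts x = - (\<Union>q\<in>set ts. if x \<in> snd q then {fst q<..} else {})"
    by (auto simp: young_set_def split: if_splits) force
  also have "\<dots> \<in> sets borel" by (intro borel_comp sets.finite_UN) auto
  finally show ?thesis .
qed

text \<open>\<open>\<gamma>\<close> may be infinite, but only its finitely many points in the sets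
  of \<open>ts\<close> are constrained; every other point has \<open>young_set ts x = UNIV\<close>.
  The event thus involves finitely many coordinates, and its probability is a finite product of
  complementary probabilities from \<open>lifetime_hit\<close>.\<close>

lemma young_paths:
  assumes \<gamma>: "\<gamma> \<in> \<Gamma>" and rc: "\<forall>(t, B)\<in>set ts. compact (closure B)"
  shows "{\<tau>\<in>space (PiM \<gamma> (\<lambda>_. lifetime)). \<forall>x\<in>\<gamma>. \<tau> x \<in> young_set ts x} \<in> sets (PiM \<gamma> (\<lambda>_. lifetime))" (is "?S \<in> _")
    and "sorted_wrt (<) (0 # map fst ts) \<Longrightarrow>
      emeasure (PiM \<gamma> (\<lambda>_. lifetime)) {\<tau>\<in>space (PiM \<gamma> (\<lambda>_. lifetime)). \<forall>x\<in>\<gamma>. \<tau> x \<in> young_set ts x} = ennreal (conf_prod (survive 0 ts) \<gamma>)"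
proof -
  let ?F = "\<Union>q\<in>set ts. \<gamma> \<inter> snd q"
  have F: "finite ?F" by (intro finite_UN_I config_space_rel_compact[OF \<gamma>]) (use rc in auto)
  have F_sub: "?F \<subseteq> \<gamma>" by auto
  note F = F F_sub
  have triv: "young_set ts x = UNIV" if "x \<in> \<gamma>" "x \<notin> ?F" for x
    using that by (auto simp: young_set_def)
  have S: "?S = {\<tau>\<in>space (PiM \<gamma> (\<lambda>_. lifetime)). \<forall>x\<in>?F. \<tau> x \<in> young_set ts x}"
    using F(2) triv by auto
  show meas: "?S \<in> sets (PiM \<gamma> (\<lambda>_. lifetime))"
    unfolding S
  proof (rule sets.sets_Collect_finite_All[OF _ F(1)])
    fix x assume "x \<in> ?F"
    then have [measurable]: "x \<in> \<gamma>" by auto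
    show "{\<tau>\<in>space (PiM \<gamma> (\<lambda>_. lifetime)). \<tau> x \<in> young_set ts x} \<in> sets (PiM \<gamma> (\<lambda>_. lifetime))" by measurable
  qed
  assume srt: "sorted_wrt (<) (0 # map fst ts)"
  have "emeasure (PiM \<gamma> (\<lambda>_. lifetime)) ?S = (\<integral>\<^sup>+\<tau>. (\<Prod>x\<in>?F. indicator (young_set ts x) (\<tau> x)) \<partial>PiM \<gamma> (\<lambda>_. lifetime))"
  proof -
    have "(\<Prod>x\<in>?F. indicator (young_set ts x) (\<tau> x) :: ennreal) = indicator ?S \<tau>" if "\<tau> \<in> space (PiM \<gamma> (\<lambda>_. lifetime))" for \<tau>
    proof (cases "\<forall>x\<in>?F. \<tau> x \<in> young_set ts x")
      case True
      then have "\<tau> \<in> ?S" using that unfolding S by simp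
      then show ?thesis using True by (simp add: prod.neutral)
    next
      case False
      then obtain x where "x \<in> ?F" "\<tau> x \<notin> young_set ts x" by blast
      then have "(\<Prod>x\<in>?F. indicator (young_set ts x) (\<tau> x) :: ennreal) = 0"
        using F(1) by (intro prod_zero bexI[of _ x]) auto
      moreover have "\<tau> \<notin> ?S" using False unfolding S by blast
      ultimately show ?thesis by simp
    qed
    then have "(\<integral>\<^sup>+\<tau>. (\<Prod>x\<in>?F. indicator (young_set ts x) (\<tau> x)) \<partial>PiM \<gamma> (\<lambda>_. lifetime)) = (\<integral>\<^sup>+\<tau>. indicator ?S \<tau> \<partial>PiM \<gamma> (\<lambda>_. lifetime))"
      by (intro nn_integral_cong)
    then show ?thesis using meas by simp
  qed
  also have "\<dots> = (\<Prod>x\<in>?F. \<integral>\<^sup>+l. indicator (young_set ts x) l \<partial>lifetime)"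
    using F by (intro nn_integral_PiM_prod lifetime.prob_space_axioms) auto
  also have "\<dots> = (\<Prod>x\<in>?F. ennreal (survive 0 ts x))"
  proof (intro prod.cong refl)
    fix x
    have s: "0 \<le> survive 0 ts x" "survive 0 ts x \<le> 1" using survive_bounds[OF srt] by auto
    define H where "H = {l. \<exists>(t, B)\<in>set ts. x \<in> B \<and> t < 0 + l}"
    have y: "young_set ts x = space lifetime - H" by (auto simp: young_set_def H_def)
    have "H = space lifetime - young_set ts x" by (auto simp: young_set_def H_def)
    then have "H \<in> sets lifetime" by (metis sets.compl_sets sets_lifetime young_set_sets)
    then have "emeasure lifetime (young_set ts x) = emeasure lifetime (space lifetime) - emeasure lifetime H"
      unfolding y by (rule emeasure_compl) simp
    also have "\<dots> = 1 - ennreal (1 - survive 0 ts x)"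
      unfolding lifetime.emeasure_space_1 H_def lifetime_hit[OF srt] ..
    also have "\<dots> = ennreal (survive 0 ts x)"
      using s ennreal_minus[of "1 - survive 0 ts x" 1] by simp
    finally show "(\<integral>\<^sup>+l. indicator (young_set ts x) l \<partial>lifetime) = ennreal (survive 0 ts x)" by simp
  qed
  also have "\<dots> = ennreal (\<Prod>x\<in>?F. survive 0 ts x)"
    using survive_bounds[OF srt] by (intro prod_ennreal) auto
  also have "(\<Prod>x\<in>?F. survive 0 ts x) = conf_prod (survive 0 ts) \<gamma>"
  proof (rule conf_prod_cong_finite[OF F(1) _ F(2), symmetric])
    have one: "survive b us x = 1" if "\<forall>q\<in>set us. x \<notin> snd q" for b us x
      using that by (induct us arbitrary: b) auto
    show "{x\<in>\<gamma>. survive 0 ts x \<noteq> 1} \<subseteq> ?F"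
    proof
      fix x assume x: "x \<in> {x\<in>\<gamma>. survive 0 ts x \<noteq> 1}"
      then have "\<not> (\<forall>q\<in>set ts. x \<notin> snd q)" using one[of ts x 0] by blast
      then show "x \<in> ?F" using x by auto
    qed
  qed
  finally show "emeasure (PiM \<gamma> (\<lambda>_. lifetime)) ?S = ennreal (conf_prod (survive 0 ts) \<gamma>)" .
qed

lemma path_void_sets:
  assumes "\<forall>(t, B)\<in>set ts. 0 \<le> t" "rel_compact_list ts"
  shows "{p\<in>space (path_space \<gamma>). \<forall>(t, B)\<in>set ts. path \<gamma> p t \<inter> B = {}} =
    {\<tau>\<in>space (PiM \<gamma> (\<lambda>_. lifetime)). \<forall>x\<in>\<gamma>. \<tau> x \<in> young_set ts x} \<times>
    {\<omega>\<in>space im.ppp_space. im.points \<omega> \<inter> hit_region ts = {}}"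
  unfolding path_void_iff[OF assms(1)] path_space_def
  by (rule set_eqI) (simp add: space_pair_measure mem_Times_iff young_set_def conj_ac)

lemma measurable_path_at:
  assumes \<gamma>: "\<gamma> \<in> \<Gamma>" and t: "0 \<le> t"
  shows "(\<lambda>p. path \<gamma> p t) \<in> measurable (path_space \<gamma>) conf_borel"
proof (rule vague_measurableI)
  show "path \<gamma> p t \<in> \<Gamma>" for p using path_cadlag[OF \<gamma>, of p] t by (auto simp: cadlag_paths_def)
  fix B :: "'a set" assume B: "compact B"
  then have cl: "closed B" by (rule compact_imp_closed)
  have rc: "rel_compact_list [(t, B)]" using B cl by (simp add: borel_closed closure_closed)
  have "{p\<in>space (path_space \<gamma>). \<forall>(t, B)\<in>set [(t, B)]. path \<gamma> p t \<inter> B = {}} \<in> sets (path_space \<gamma>)"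
    unfolding path_void_sets[OF _ rc, of \<gamma>, simplified] using t rc
    by (subst path_void_sets) (auto simp: path_space_def intro!: pair_measureI young_paths[OF \<gamma>] im.measurable_points_void hit_region_sets)
  then show "{p\<in>space (path_space \<gamma>). path \<gamma> p t \<inter> B = {}} \<in> sets (path_space \<gamma>)" by simp
qed

lemma measurable_path:
  assumes \<gamma>: "\<gamma> \<in> \<Gamma>" shows "path \<gamma> \<in> measurable (path_space \<gamma>) path_F"
proof (rule measurable_sigma_sets[OF sets_path_sigma])
  fix y assume "y \<in> {{\<omega> \<in> cadlag_paths. \<omega> t \<in> A} |t A. t \<in> {0..} \<and> A \<in> sets (conf_borel :: 'a set measure)}"
  then obtain t A where y: "y = {\<omega> \<in> cadlag_paths. \<omega> t \<in> A}" "0 \<le> t" "A \<in> sets conf_borel" by auto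
  have "path \<gamma> -` y \<inter> space (path_space \<gamma>) = (\<lambda>p. path \<gamma> p t) -` A \<inter> space (path_space \<gamma>)"
    using path_cadlag[OF \<gamma>] by (auto simp: y(1))
  then show "path \<gamma> -` y \<inter> space (path_space \<gamma>) \<in> sets (path_space \<gamma>)"
    using measurable_sets[OF measurable_path_at[OF \<gamma> y(2)] y(3)] by simp
qed (use path_cadlag[OF \<gamma>] in auto)

lemma prob_space_path_law: "\<gamma> \<in> \<Gamma> \<Longrightarrow> prob_space (path_law \<gamma>)"
proof -
  assume \<gamma>: "\<gamma> \<in> \<Gamma>"
  interpret tau: prob_space "PiM \<gamma> (\<lambda>_. lifetime)" by (intro prob_space_PiM lifetime.prob_space_axioms)
  interpret ppp: prob_space im.ppp_space by (rule im.prob_space_ppp)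
  interpret pair: pair_prob_space "PiM \<gamma> (\<lambda>_. lifetime)" im.ppp_space ..
  show ?thesis unfolding path_law_def
    by (rule prob_space.prob_space_distr[OF _ measurable_path[OF \<gamma>]]) (simp add: path_space_def pair.prob_space_axioms)
qed

text \<open>The independent components give one factor each: the lifetimes of the initial particles,
  and the absence of Poisson points in \<open>hit_region ts\<close>, whose measure becomes the
  integral of \<open>immigrant\<close> after slicing by position. The result is that of
  \<open>fdd_void\<close> at \<open>s = 0\<close>.\<close>

lemma emeasure_path_void:
  assumes \<gamma>: "\<gamma> \<in> \<Gamma>" and srt: "sorted_wrt (<) (0 # map fst ts)" and rc: "rel_compact_list ts"
  shows "emeasure (path_law \<gamma>) (cylinder (map (\<lambda>(t, B). (t, void B)) ts)) =
    ennreal (conf_prod (survive 0 ts) \<gamma> * exp (- (\<integral>x. immigrant 0 ts x \<partial>m)))"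
proof -
  interpret ppp: prob_space im.ppp_space by (rule im.prob_space_ppp)
  have pos: "\<forall>(t, B)\<in>set ts. 0 \<le> t" using srt by (auto simp: less_imp_le)
  have cyl: "cylinder (map (\<lambda>(t, B). (t, void B)) ts) \<in> sets path_F"
    using pos rc measurable_void by (intro cylinder_sets) auto
  have "emeasure (path_law \<gamma>) (cylinder (map (\<lambda>(t, B). (t, void B)) ts)) =
    emeasure (path_space \<gamma>) {p\<in>space (path_space \<gamma>). \<forall>(t, B)\<in>set ts. path \<gamma> p t \<inter> B = {}}"
  proof -
    have "path \<gamma> p t \<in> \<Gamma>" if "0 \<le> t" for p t using path_cadlag[OF \<gamma>, of p] that by (auto simp: cadlag_paths_def)
    then have "path \<gamma> -` cylinder (map (\<lambda>(t, B). (t, void B)) ts) \<inter> space (path_space \<gamma>) =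
      {p\<in>space (path_space \<gamma>). \<forall>(t, B)\<in>set ts. path \<gamma> p t \<inter> B = {}}"
      using path_cadlag[OF \<gamma>] pos by (fastforce simp: split_beta)
    then show ?thesis unfolding path_law_def by (subst emeasure_distr[OF measurable_path[OF \<gamma>] cyl]) simp
  qed
  also have "\<dots> = ennreal (conf_prod (survive 0 ts) \<gamma>) * emeasure im.ppp_space {\<omega>\<in>space im.ppp_space. im.points \<omega> \<inter> hit_region ts = {}}"
    unfolding path_void_sets[OF pos rc] unfolding path_space_def
    using young_paths[OF \<gamma>, of ts] rc srt hit_region_sets[of ts]
    by (subst ppp.emeasure_pair_measure_Times) (auto simp: split_beta intro!: im.measurable_points_void)
  also have "emeasure im.ppp_space {\<omega>\<in>space im.ppp_space. im.points \<omega> \<inter> hit_region ts = {}} =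
    ennreal (exp (- measure marked (hit_region ts)))"
  proof -
    let ?K = "\<Union>q\<in>set ts. closure (snd q)"
    \<comment> \<open>Inserting 0 keeps \<open>Max\<close> meaningful for the empty list.\<close>
    let ?T = "Max (insert 0 (fst ` set ts))"
    have "compact ?K" using rc by (intro compact_UN) auto
    then obtain J where J: "finite J" "?K \<times> ({0<..?T} \<times> UNIV) \<subseteq> (\<Union>p\<in>J. cell p)" using cell_cover by blast
    have "hit_region ts \<subseteq> ?K \<times> ({0<..?T} \<times> UNIV)"
    proof
      fix z assume "z \<in> hit_region ts"
      then obtain x b l t B where z: "z = (x, b, l)" "0 < b" "(t, B) \<in> set ts" "x \<in> B" "b \<le> t"
        by (auto simp: hit_region_def hit_set_def)
      have "t \<le> ?T" using z(3) by (intro Max_ge) force+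
      moreover have "x \<in> ?K" using z(3,4) closure_subset[of B] by (intro UN_I[of "(t, B)"]) auto
      ultimately show "z \<in> ?K \<times> ({0<..?T} \<times> UNIV)" using z by auto
    qed
    then show ?thesis
      using rc by (intro im.emeasure_points_void[OF J(1)] hit_region_sets subset_trans[OF _ J(2)]) auto
  qed
  also have "measure marked (hit_region ts) = (\<integral>x. immigrant 0 ts x \<partial>m)"
  proof -
    have "emeasure marked (hit_region ts) = (\<integral>\<^sup>+x. emeasure (lborel \<Otimes>\<^sub>M lifetime) (Pair x -` hit_region ts) \<partial>m)"
      using hit_region_sets[of ts] rc unfolding marked_def
      by (intro birth_life.P.emeasure_pair_measure_alt) auto
    also have "\<dots> = (\<integral>\<^sup>+x. ennreal (immigrant 0 ts x) \<partial>m)"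
      using emeasure_hit_set[OF srt] by (simp add: hit_region_def vimage_def)
    also have "\<dots> = ennreal (\<integral>x. immigrant 0 ts x \<partial>m)"
      using immigrant_nonneg[OF srt] by (intro nn_integral_eq_integral integrable_immigrant srt rc) auto
    finally show ?thesis
      using immigrant_nonneg[OF srt] by (simp add: measure_def integral_nonneg_AE)
  qed
  finally show ?thesis by (simp add: ennreal_mult'')
qed

text \<open>All initial particles are present at time 0 as soon as their lifetimes are positive,
  which holds almost surely for countably many of them; births come strictly later.\<close>

lemma path_law_start:
  assumes \<gamma>: "\<gamma> \<in> \<Gamma>"
  shows "emeasure (path_law \<gamma>) {\<omega>\<in>cadlag_paths. \<omega> 0 = \<gamma>} = 1"
proof -
  interpret P: prob_space "path_law \<gamma>" by (rule prob_space_path_law[OF \<gamma>])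
  interpret ppp: prob_space im.ppp_space by (rule im.prob_space_ppp)
  have "{\<omega>\<in>cadlag_paths. \<omega> 0 \<in> {\<gamma>}} \<in> sets path_F"
    by (intro eval_sets config_singleton_sets \<gamma>) simp
  then have S: "{\<omega>\<in>cadlag_paths. \<omega> 0 = \<gamma>} \<in> sets path_F" by simp
  have "AE \<tau> in PiM \<gamma> (\<lambda>_. lifetime). \<forall>x\<in>\<gamma>. 0 < \<tau> x"
    by (intro AE_ball_countable' countable_config \<gamma> AE_PiM_component lifetime.prob_space_axioms lifetime_positive)
  then have "AE p in path_space \<gamma>. \<forall>x\<in>\<gamma>. 0 < fst p x"
    unfolding path_space_def by (rule AE_pair_fst[OF ppp.sigma_finite_measure_axioms])
  then have "AE p in path_space \<gamma>. path \<gamma> p \<in> {\<omega>\<in>cadlag_paths. \<omega> 0 = \<gamma>}"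
  proof eventually_elim
    case (elim p)
    have "path \<gamma> p 0 = \<gamma>" using elim points_birth_pos[of _ _ _ "snd p"] by (auto simp: path_def) fastforce
    then show ?case using path_cadlag[OF \<gamma>] by simp
  qed
  then have "AE \<omega> in path_law \<gamma>. \<omega> \<in> {\<omega>\<in>cadlag_paths. \<omega> 0 = \<gamma>}"
    unfolding path_law_def using S by (subst AE_distr_iff[OF measurable_path[OF \<gamma>]]) auto
  then show ?thesis using S by (intro P.emeasure_eq_1_AE) (auto simp: path_law_def)
qed

end

section \<open>Finite-dimensional distributions\<close>

abbreviation conf_list :: "(real \<times> 'a::topological_space set set) list \<Rightarrow> bool" where
  "conf_list ts \<equiv> \<forall>(t, A)\<in>set ts. A \<in> sets conf_borel"

lemma measurable_eval: "t \<in> T \<Longrightarrow> (\<lambda>\<omega>. \<omega> t) \<in> measurable (path_sigma T) (conf_borel :: 'a::topological_space set measure)" if "T \<subseteq> {0..}"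
proof (rule measurableI)
  fix A :: "'a set set" assume t: "t \<in> T" and A: "A \<in> sets conf_borel"
  have "(\<lambda>\<omega>. \<omega> t) -` A \<inter> space (path_sigma T) = {\<omega>\<in>cadlag_paths. \<omega> t \<in> A}" by auto
  then show "(\<lambda>\<omega>. \<omega> t) -` A \<inter> space (path_sigma T) \<in> sets (path_sigma T)" using eval_sets[OF t A] by simp
next
  fix \<omega> :: "real \<Rightarrow> 'a set" assume "t \<in> T" "\<omega> \<in> space (path_sigma T)"
  then show "\<omega> t \<in> space conf_borel" using that by (auto simp: cadlag_paths_def)
qed

context radon_space
begin

lemma transition_space: "0 < t \<Longrightarrow> \<gamma> \<in> \<Gamma> \<Longrightarrow> space (transition m t \<gamma>) = \<Gamma>"
  using sets_eq_imp_space_eq[OF sets_transition] by simp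

lemma transition_kernel: "0 < t \<Longrightarrow> transition m t \<in> measurable conf_borel (subprob_algebra conf_borel)"
  by (rule measurable_prob_algebraD[OF measurable_transition])

lemma measurable_fdd:
  assumes "sorted_wrt (<) (s # map fst ts)" "conf_list ts"
  shows "(\<lambda>\<gamma>. fdd m \<gamma> s ts) \<in> borel_measurable conf_borel"
  using assms
proof (induct ts arbitrary: s)
  case (Cons p ts)
  obtain t A where p: "p = (t, A)" by (cases p)
  have [measurable]: "(\<lambda>\<gamma>. fdd m \<gamma> t ts) \<in> borel_measurable conf_borel" using Cons by (auto simp: p)
  have [measurable]: "A \<in> sets conf_borel" using Cons by (auto simp: p)
  have "(\<lambda>\<gamma>1. indicator A \<gamma>1 * fdd m \<gamma>1 t ts) \<in> borel_measurable conf_borel" by measurable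
  moreover have "0 < t - s" using Cons by (auto simp: p)
  ultimately show ?case unfolding p fdd.simps
    by (intro measurable_compose[OF transition_kernel nn_integral_measurable_subprob_algebra])
qed simp

lemma fdd_shift: "fdd m \<gamma> (s + c) (map (\<lambda>(t, A). (t + c, A)) ts) = fdd m \<gamma> s ts"
  by (induct ts arbitrary: \<gamma> s) auto

text \<open>The law of the state at time \<open>t\<close> restricted to the event that the states at the earlier times
  of \<open>ts\<close> lie in the prescribed sets, for a chain that starts in \<open>\<gamma>\<close> at time \<open>s\<close>.\<close>

fun fdd_kernel :: "real \<Rightarrow> 'a set \<Rightarrow> real \<Rightarrow> (real \<times> 'a set set) list \<Rightarrow> 'a set measure" where
  "fdd_kernel t \<gamma> s [] = transition m (t - s) \<gamma>"
| "fdd_kernel t \<gamma> s ((u, A) # ts) =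
     transition m (u - s) \<gamma> \<bind> (\<lambda>\<eta>. if \<eta> \<in> A then fdd_kernel t \<eta> u ts else null_measure conf_borel)"

lemma null_measure_subprob: "null_measure conf_borel \<in> space (subprob_algebra (conf_borel :: 'a set measure))"
  by (auto simp: space_subprob_algebra intro!: subprob_spaceI empty_in_config_space)

lemma measurable_fdd_kernel:
  assumes "sorted_wrt (<) (s # map fst ts @ [t])" "conf_list ts"
  shows "(\<lambda>\<gamma>. fdd_kernel t \<gamma> s ts) \<in> measurable conf_borel (subprob_algebra conf_borel)"
    and "A \<in> sets conf_borel \<Longrightarrow>
      (\<lambda>\<eta>. if \<eta> \<in> A then fdd_kernel t \<eta> s ts else null_measure conf_borel) \<in> measurable conf_borel (subprob_algebra conf_borel)"
proof -
  have *: "(\<lambda>\<eta>. if \<eta> \<in> A then K \<eta> else null_measure conf_borel) \<in> measurable conf_borel (subprob_algebra conf_borel)"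
    if "A \<in> sets conf_borel" "K \<in> measurable conf_borel (subprob_algebra conf_borel)" for A and K :: "'a set \<Rightarrow> 'a set measure"
    by (rule measurable_If_set[OF that(2) measurable_const[OF null_measure_subprob] sets.Int[OF that(1) sets.top]])
  show 1: "(\<lambda>\<gamma>. fdd_kernel t \<gamma> s ts) \<in> measurable conf_borel (subprob_algebra conf_borel)"
    using assms
  proof (induct ts arbitrary: s)
    case Nil
    then show ?case using transition_kernel[of "t - s"] by simp
  next
    case (Cons p ts)
    obtain u A where p: "p = (u, A)" by (cases p)
    have "(\<lambda>\<gamma>. fdd_kernel t \<gamma> u ts) \<in> measurable conf_borel (subprob_algebra conf_borel)"
      using Cons by (auto simp: p)
    then have "(\<lambda>\<eta>. if \<eta> \<in> A then fdd_kernel t \<eta> u ts else null_measure conf_borel) \<in> measurable conf_borel (subprob_algebra conf_borel)"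
      using Cons by (intro *) (auto simp: p)
    moreover have "0 < u - s" using Cons by (auto simp: p)
    ultimately show ?case unfolding p fdd_kernel.simps
      by (intro measurable_bind2[OF transition_kernel])
  qed
  show "(\<lambda>\<eta>. if \<eta> \<in> A then fdd_kernel t \<eta> s ts else null_measure conf_borel) \<in> measurable conf_borel (subprob_algebra conf_borel)"
    if "A \<in> sets conf_borel" using *[OF that 1] .
qed

lemma fdd_kernel_props:
  assumes "sorted_wrt (<) (s # map fst ts @ [t])" "conf_list ts" "\<gamma> \<in> \<Gamma>"
  shows "subprob_space (fdd_kernel t \<gamma> s ts)" "sets (fdd_kernel t \<gamma> s ts) = sets conf_borel"
  using measurable_space[OF measurable_fdd_kernel(1)[OF assms(1,2)], of \<gamma>] assms(3)
  by (auto simp: space_subprob_algebra)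

text \<open>Cuts the iterated integral at the coordinate \<open>t\<close>: the past becomes a
  measure and the future a function. In this form the dependence on \<open>A\<close> is visibly that
  of a measure.\<close>

lemma fdd_append:
  assumes "sorted_wrt (<) (s # map fst ts @ t # map fst us)" "conf_list ts" "conf_list us" "A \<in> sets conf_borel" "\<gamma> \<in> \<Gamma>"
  shows "fdd m \<gamma> s (ts @ (t, A) # us) = (\<integral>\<^sup>+\<eta>. indicator A \<eta> * fdd m \<eta> t us \<partial>fdd_kernel t \<gamma> s ts)"
  using assms(1,2,5)
proof (induct ts arbitrary: s \<gamma>)
  case (Cons p ts)
  obtain u B where p: "p = (u, B)" by (cases p)
  have srt: "sorted_wrt (<) (u # map fst ts @ t # map fst us)" and su: "0 < u - s" and cl: "conf_list ts"
    and B: "B \<in> sets conf_borel" using Cons by (auto simp: p)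
  have srt2: "sorted_wrt (<) (u # map fst ts @ [t])" using srt by (auto simp: sorted_wrt_append)
  have "sorted_wrt (<) (t # map fst us)" using srt by (auto simp: sorted_wrt_append)
  from measurable_fdd[OF this assms(3)] have [measurable]: "(\<lambda>\<eta>. fdd m \<eta> t us) \<in> borel_measurable conf_borel" .
  note [measurable] = assms(4)
  have F: "(\<lambda>\<eta>. indicator A \<eta> * fdd m \<eta> t us) \<in> borel_measurable conf_borel" by measurable
  have sp: "space (transition m (u - s) \<gamma>) = \<Gamma>" by (rule transition_space[OF su Cons(4)])
  have "fdd_kernel t \<gamma> s (p # ts) = transition m (u - s) \<gamma> \<bind> (\<lambda>\<eta>. if \<eta> \<in> B then fdd_kernel t \<eta> u ts else null_measure conf_borel)"
    by (simp add: p)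
  then have "(\<integral>\<^sup>+\<eta>. indicator A \<eta> * fdd m \<eta> t us \<partial>fdd_kernel t \<gamma> s (p # ts)) =
    (\<integral>\<^sup>+\<gamma>1. \<integral>\<^sup>+\<eta>. indicator A \<eta> * fdd m \<eta> t us \<partial>(if \<gamma>1 \<in> B then fdd_kernel t \<gamma>1 u ts else null_measure conf_borel) \<partial>transition m (u - s) \<gamma>)"
    using measurable_fdd_kernel(2)[OF srt2 cl B] F
    by (simp only:) (intro nn_integral_bind, auto simp: measurable_cong_sets[OF sets_transition[OF su Cons(4)] refl])
  also have "\<dots> = (\<integral>\<^sup>+\<gamma>1. indicator B \<gamma>1 * fdd m \<gamma>1 u (ts @ (t, A) # us) \<partial>transition m (u - s) \<gamma>)"
    using Cons(1)[OF srt cl] by (intro nn_integral_cong) (auto simp: sp split: split_indicator)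
  finally show ?case by (simp add: p)
qed simp

text \<open>The counterpart of \<open>fdd_kernel\<close> on path space. Here \<open>ts\<close> may
  also contain times after \<open>t\<close>, as happens in \<open>path_fdd\<close>.\<close>

definition path_at :: "'a set \<Rightarrow> (real \<times> 'a set set) list \<Rightarrow> real \<Rightarrow> 'a set measure" where
  "path_at \<gamma> ts t = distr (density (path_law \<gamma>) (indicator (cylinder ts))) conf_borel (\<lambda>\<omega>. \<omega> t)"

lemma sets_path_law: "sets (path_law \<gamma>) = sets path_F"
  by (simp add: path_law_def)

lemma path_at_integral:
  assumes ts: "\<forall>(t, A)\<in>set ts. 0 \<le> t \<and> A \<in> sets conf_borel" and t: "0 \<le> t" and f: "f \<in> borel_measurable conf_borel"
  shows "(\<integral>\<^sup>+\<eta>. f \<eta> \<partial>path_at \<gamma> ts t) = (\<integral>\<^sup>+\<omega>. indicator (cylinder ts) \<omega> * f (\<omega> t) \<partial>path_law \<gamma>)"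
proof -
  have ev: "(\<lambda>\<omega>. \<omega> t) \<in> measurable (path_law \<gamma>) conf_borel"
    using measurable_eval[of "{0..}" t] t by (simp add: measurable_cong_sets[OF sets_path_law refl])
  have cyl [measurable]: "cylinder ts \<in> sets (path_law \<gamma>)"
    unfolding sets_path_law using ts by (intro cylinder_sets) auto
  have "(\<lambda>\<omega>. f (\<omega> t)) \<in> borel_measurable (path_law \<gamma>)" by (rule measurable_compose[OF ev f])
  then show ?thesis
    unfolding path_at_def using ev f by (subst nn_integral_distr) (auto simp: nn_integral_density)
qed

lemma emeasure_path_at:
  assumes ts: "\<forall>(t, A)\<in>set ts. 0 \<le> t \<and> A \<in> sets conf_borel" and t: "0 \<le> t" and A: "A \<in> sets conf_borel"
  shows "emeasure (path_at \<gamma> ts t) A = emeasure (path_law \<gamma>) (cylinder ts \<inter> {\<omega>\<in>cadlag_paths. \<omega> t \<in> A})"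
proof -
  have A': "A \<in> sets (path_at \<gamma> ts t)" using A by (simp add: path_at_def)
  have S: "cylinder ts \<inter> {\<omega>\<in>cadlag_paths. \<omega> t \<in> A} \<in> sets (path_law \<gamma>)"
    unfolding sets_path_law using ts t A by (intro sets.Int cylinder_sets eval_sets) auto
  have "emeasure (path_at \<gamma> ts t) A = (\<integral>\<^sup>+\<eta>. indicator A \<eta> \<partial>path_at \<gamma> ts t)" using A' by simp
  also have "\<dots> = (\<integral>\<^sup>+\<omega>. indicator (cylinder ts) \<omega> * indicator A (\<omega> t) \<partial>path_law \<gamma>)"
    using A by (intro path_at_integral ts t) auto
  also have "\<dots> = (\<integral>\<^sup>+\<omega>. indicator (cylinder ts \<inter> {\<omega>\<in>cadlag_paths. \<omega> t \<in> A}) \<omega> \<partial>path_law \<gamma>)"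
    by (intro nn_integral_cong) (auto split: split_indicator)
  finally show ?thesis using S by simp
qed

text \<open>Induction over the coordinates: those in \<open>pre\<close> are already arbitrary, those in \<open>post\<close> still void events.\<close>

lemma path_fdd:
  assumes \<gamma>: "\<gamma> \<in> \<Gamma>"
  shows "sorted_wrt (<) (0 # map fst (pre @ map (\<lambda>(t, B). (t, void B)) post)) \<Longrightarrow> conf_list pre \<Longrightarrow> rel_compact_list post \<Longrightarrow>
    emeasure (path_law \<gamma>) (cylinder (pre @ map (\<lambda>(t, B). (t, void B)) post)) = fdd m \<gamma> 0 (pre @ map (\<lambda>(t, B). (t, void B)) post)"
proof (induct pre arbitrary: post rule: rev_induct)
  case Nil
  have "sorted_wrt (<) (0 # map fst post)" using Nil(1) by (simp add: comp_def split_beta)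
  then show ?case using emeasure_path_void[OF \<gamma> _ Nil(3)] fdd_void[OF _ Nil(3) \<gamma>] by simp
next
  case (snoc p pre)
  obtain t A where p: "p = (t, A)" by (cases p)
  interpret P: prob_space "path_law \<gamma>" by (rule prob_space_path_law[OF \<gamma>])
  let ?post = "map (\<lambda>(t, B). (t, void B)) post"
  have mfst: "map fst ?post = map fst post" by (simp add: comp_def split_beta)
  have srt: "sorted_wrt (<) (0 # map fst pre @ t # map fst ?post)" using snoc(2) by (simp add: p)
  have srt1: "sorted_wrt (<) (0 # map fst pre @ [t])" and srt2: "sorted_wrt (<) (t # map fst ?post)" and t: "0 < t"
    using srt by (auto simp: sorted_wrt_append)
  have cp: "conf_list pre" and A: "A \<in> sets conf_borel" using snoc(3) by (auto simp: p)
  have cpost: "conf_list ?post" using snoc(4) measurable_void by auto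
  define us where "us = ?post"
  have pos: "\<forall>y\<in>set (map fst pre @ t # map fst us). 0 < y"
    using srt unfolding us_def by (simp only: sorted_wrt.simps) blast
  have cus: "conf_list us" using cpost unfolding us_def .
  have all: "\<forall>(t, A)\<in>set (pre @ ?post). 0 \<le> t \<and> A \<in> sets conf_borel"
    unfolding us_def[symmetric]
  proof
    fix q assume "q \<in> set (pre @ us)"
    then have "0 < fst q" "snd q \<in> sets conf_borel" using pos cp cus by auto
    then show "case q of (t, A) \<Rightarrow> 0 \<le> t \<and> A \<in> sets conf_borel" by (simp add: split_beta)
  qed
  define K where "K = fdd_kernel t \<gamma> 0 pre"
  have K: "subprob_space K" "sets K = sets conf_borel" using fdd_kernel_props[OF srt1 cp \<gamma>] by (auto simp: K_def)
  have F: "(\<lambda>\<eta>. fdd m \<eta> t ?post) \<in> borel_measurable conf_borel" by (rule measurable_fdd[OF srt2 cpost])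
  have R: "emeasure (density K (\<lambda>\<eta>. fdd m \<eta> t ?post)) A = fdd m \<gamma> 0 (pre @ (t, A) # ?post)" if "A \<in> sets conf_borel" for A
  proof -
    have FK: "(\<lambda>\<eta>. fdd m \<eta> t ?post) \<in> borel_measurable K" using F by (simp add: measurable_cong_sets[OF K(2) refl])
    have "emeasure (density K (\<lambda>\<eta>. fdd m \<eta> t ?post)) A = (\<integral>\<^sup>+\<eta>. fdd m \<eta> t ?post * indicator A \<eta> \<partial>K)"
      using that K(2) by (intro emeasure_density FK) simp
    then show ?thesis unfolding fdd_append[OF srt cp cpost that \<gamma>] K_def[symmetric] by (simp only: mult.commute)
  qed
  have L: "emeasure (path_at \<gamma> (pre @ ?post) t) A = emeasure (path_law \<gamma>) (cylinder (pre @ (t, A) # ?post))"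
    if "A \<in> sets conf_borel" for A
    unfolding emeasure_path_at[OF all less_imp_le[OF t] that] by (intro arg_cong2[where f=emeasure] refl) auto
  \<comment> \<open>As functions of the set at time \<open>t\<close> both sides are measures, the
    left one finite. The induction hypothesis gives equality for a void event, by moving
    \<open>(t, B)\<close> to the front of \<open>post\<close>, and void events determine the
    measure.\<close>
  have "path_at \<gamma> (pre @ ?post) t = density K (\<lambda>\<eta>. fdd m \<eta> t ?post)"
  proof (rule conf_measure_eqI)
    show "finite_measure (path_at \<gamma> (pre @ ?post) t)"
    proof (rule finite_measureI)
      have "emeasure (path_at \<gamma> (pre @ ?post) t) \<Gamma> \<noteq> \<infinity>"
      proof -
        have G: "\<Gamma> \<in> sets conf_borel" using sets.top[of conf_borel] by simp
        show ?thesis unfolding L[OF G] by simp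
      qed
      then show "emeasure (path_at \<gamma> (pre @ ?post) t) (space (path_at \<gamma> (pre @ ?post) t)) \<noteq> \<infinity>"
        by (simp add: path_at_def)
    qed
    fix B :: "'a set" assume B: "B \<in> sets borel" "compact (closure B)"
    have "emeasure (path_law \<gamma>) (cylinder (pre @ map (\<lambda>(t, B). (t, void B)) ((t, B) # post))) =
      fdd m \<gamma> 0 (pre @ map (\<lambda>(t, B). (t, void B)) ((t, B) # post))"
    proof (rule snoc(1)[OF _ cp])
      show "sorted_wrt (<) (0 # map fst (pre @ map (\<lambda>(t, B). (t, void B)) ((t, B) # post)))" using srt by simp
      show "rel_compact_list ((t, B) # post)" using snoc(4) B by simp
    qed
    then show "emeasure (path_at \<gamma> (pre @ ?post) t) (void B) = emeasure (density K (\<lambda>\<eta>. fdd m \<eta> t ?post)) (void B)"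
      using L R measurable_void[OF B] by simp
  qed (simp_all add: path_at_def K)
  then show ?case using L[OF A] R[OF A] by (simp add: p)
qed

lemma emeasure_path_cylinder:
  assumes "\<gamma> \<in> \<Gamma>" "sorted_wrt (<) (0 # map fst ts)" "conf_list ts"
  shows "emeasure (path_law \<gamma>) (cylinder ts) = fdd m \<gamma> 0 ts"
  using path_fdd[OF assms(1), of ts "[]"] assms by simp

text \<open>Both measures assign to a set \<open>A\<close> the probability of the cylinder with
  \<open>(t, A)\<close> appended. In the Markov property this turns an integral over the state at
  \<open>t\<close> into one over paths.\<close>

lemma path_at_eq_kernel:
  assumes \<gamma>: "\<gamma> \<in> \<Gamma>" and srt: "sorted_wrt (<) (0 # map fst ts @ [t])" and cl: "conf_list ts"
  shows "path_at \<gamma> ts t = fdd_kernel t \<gamma> 0 ts"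
proof (rule measure_eqI)
  have K: "sets (fdd_kernel t \<gamma> 0 ts) = sets conf_borel" by (rule fdd_kernel_props[OF srt cl \<gamma>])
  show "sets (path_at \<gamma> ts t) = sets (fdd_kernel t \<gamma> 0 ts)" by (simp add: K path_at_def)
  fix A assume "A \<in> sets (path_at \<gamma> ts t)"
  then have A: "A \<in> sets conf_borel" by (simp add: path_at_def)
  have pos: "0 \<le> t" "\<forall>(t, A)\<in>set ts. 0 \<le> t \<and> A \<in> sets conf_borel"
    using srt cl by (auto simp: sorted_wrt_append less_imp_le split_beta)
  have "emeasure (path_at \<gamma> ts t) A = emeasure (path_law \<gamma>) (cylinder (ts @ [(t, A)]))"
    unfolding emeasure_path_at[OF pos(2,1) A] by (intro arg_cong2[where f=emeasure] refl) auto
  also have "\<dots> = fdd m \<gamma> 0 (ts @ [(t, A)])"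
    using srt cl A by (intro emeasure_path_cylinder \<gamma>) auto
  also have "\<dots> = emeasure (fdd_kernel t \<gamma> 0 ts) A"
    using fdd_append[of 0 ts t "[]" A \<gamma>] srt cl A \<gamma> by (simp add: K)
  finally show "emeasure (path_at \<gamma> ts t) A = emeasure (fdd_kernel t \<gamma> 0 ts) A" .
qed

lemma process_law_path_law: "process_law m path_law"
  unfolding process_law_def
proof (intro ballI conjI allI impI)
  fix \<gamma> :: "'a set" assume \<gamma>: "\<gamma> \<in> \<Gamma>"
  show "prob_space (path_law \<gamma>)" by (rule prob_space_path_law[OF \<gamma>])
  show "sets (path_law \<gamma>) = sets path_F" by (rule sets_path_law)
  show "emeasure (path_law \<gamma>) {\<omega>\<in>cadlag_paths. \<omega> 0 = \<gamma>} = 1" by (rule path_law_start[OF \<gamma>])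
  fix ts :: "(real \<times> 'a set set) list"
  assume "sorted_wrt (<) (map fst ts)" "\<forall>(t, A)\<in>set ts. 0 < t \<and> A \<in> sets conf_borel"
  then show "emeasure (path_law \<gamma>) (cylinder ts) = fdd m \<gamma> 0 ts"
    by (intro emeasure_path_cylinder \<gamma>) auto
qed

end

section \<open>Uniqueness and the Markov property\<close>

text \<open>Times may be unordered and repeated, so that intersecting two cylinders amounts to
  concatenating their lists.\<close>

definition cylinders :: "real set \<Rightarrow> (real \<Rightarrow> 'a::topological_space set) set set" where
  "cylinders T = {cylinder ts | ts. \<forall>(t, A)\<in>set ts. t \<in> T \<and> A \<in> sets conf_borel}"

lemma cylinders_subset: "cylinders T \<subseteq> Pow cadlag_paths"
  by (auto simp: cylinders_def)

lemma Int_stable_cylinders: "Int_stable (cylinders T)"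
proof (rule Int_stableI)
  fix a b :: "(real \<Rightarrow> 'a set) set" assume "a \<in> cylinders T" "b \<in> cylinders T"
  then obtain ts us :: "(real \<times> 'a set set) list" where "a = cylinder ts" "b = cylinder us"
    "\<forall>(t, A)\<in>set ts. t \<in> T \<and> A \<in> sets conf_borel" "\<forall>(t, A)\<in>set us. t \<in> T \<and> A \<in> sets conf_borel"
    unfolding cylinders_def by blast
  then have "a \<inter> b = cylinder (ts @ us)" "\<forall>(t, A)\<in>set (ts @ us). t \<in> T \<and> A \<in> sets conf_borel" by auto
  then show "a \<inter> b \<in> cylinders T" unfolding cylinders_def by blast
qed

lemma cadlag_in_cylinders: "cadlag_paths \<in> cylinders T"
  unfolding cylinders_def by (intro CollectI exI[of _ "[]"]) auto

lemma sigma_cylinders: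
  "sets (path_sigma T :: (real \<Rightarrow> 'a::topological_space set) measure) = sigma_sets cadlag_paths (cylinders T)" (is "?L = ?R")
proof
  have "cylinders T \<subseteq> ?L" using cylinder_sets by (auto simp: cylinders_def)
  from sets.sigma_sets_subset[OF this] show "?R \<subseteq> ?L" by simp
  show "?L \<subseteq> ?R"
    unfolding sets_path_sigma
  proof (rule sigma_sets_mono', rule subsetI)
    fix S :: "(real \<Rightarrow> 'a set) set" assume "S \<in> {{\<omega> \<in> cadlag_paths. \<omega> t \<in> A} |t A. t \<in> T \<and> A \<in> sets conf_borel}"
    then obtain t A where "S = {\<omega> \<in> cadlag_paths. \<omega> t \<in> A}" "t \<in> T" "A \<in> sets conf_borel" by blast
    then show "S \<in> cylinders T" unfolding cylinders_def by (intro CollectI exI[of _ "[(t, A)]"]) auto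
  qed
qed

text \<open>An insertion step towards strictly increasing times, for which the finite-dimensional
  distributions are prescribed; for a time already present the two sets are intersected.\<close>

lemma cylinder_insert:
  assumes "sorted_wrt (<) (s # map fst ts)" "conf_list ts" "s < t" "A \<in> sets conf_borel"
  shows "\<exists>us. sorted_wrt (<) (s # map fst us) \<and> conf_list us \<and> fst ` set us \<subseteq> insert t (fst ` set ts) \<and>
    cylinder us = {\<omega>\<in>cadlag_paths. \<omega> t \<in> A} \<inter> cylinder ts"
  using assms
proof (induct ts arbitrary: s)
  case Nil
  then show ?case by (intro exI[of _ "[(t, A)]"]) auto
next
  case (Cons p ts)
  obtain u B where p: "p = (u, B)" by (cases p)
  consider "t < u" | "t = u" | "u < t" by linarith
  then show ?case
  proof cases
    case 1
    then show ?thesis using Cons by (intro exI[of _ "(t, A) # p # ts"]) (auto simp: p)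
  next
    case 2
    then show ?thesis using Cons by (intro exI[of _ "(t, A \<inter> B) # ts"]) (auto simp: p)
  next
    case 3
    have "sorted_wrt (<) (u # map fst ts)" "conf_list ts" using Cons by (auto simp: p)
    from Cons(1)[OF this 3 Cons(5)] obtain us where us: "sorted_wrt (<) (u # map fst us)" "conf_list us"
      "fst ` set us \<subseteq> insert t (fst ` set ts)" "cylinder us = {\<omega>\<in>cadlag_paths. \<omega> t \<in> A} \<inter> cylinder ts" by blast
    have "cylinder (p # us) = {\<omega>\<in>cadlag_paths. \<omega> u \<in> B} \<inter> cylinder us" by (auto simp: p)
    also have "\<dots> = {\<omega>\<in>cadlag_paths. \<omega> t \<in> A} \<inter> cylinder (p # ts)" unfolding us(4) by (auto simp: p)
    finally have "cylinder (p # us) = {\<omega>\<in>cadlag_paths. \<omega> t \<in> A} \<inter> cylinder (p # ts)" .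
    moreover have "sorted_wrt (<) (s # map fst (p # us))"
      using us(1) Cons(2) by (auto simp: p)
    ultimately show ?thesis using us(2,3) Cons(3) by (intro exI[of _ "p # us"]) (auto simp: p)
  qed
qed

text \<open>Time 0 is split off because the prescribed distributions concern positive times and the
  start is a separate condition. The inclusion of times preserves an upper bound such as
  \<open>t\<close> for events of the past.\<close>

lemma cylinder_normal_form:
  assumes "\<forall>(t, A)\<in>set ts. 0 \<le> t \<and> A \<in> sets conf_borel"
  shows "\<exists>A us. A \<in> sets conf_borel \<and> sorted_wrt (<) (0 # map fst us) \<and> conf_list us \<and> fst ` set us \<subseteq> fst ` set ts \<and>
    cylinder ts = {\<omega>\<in>cadlag_paths. \<omega> 0 \<in> A} \<inter> cylinder us"
  using assms
proof (induct ts)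
  case Nil
  have "\<Gamma> \<in> sets (conf_borel :: 'a set measure)" using sets.top[of conf_borel] by simp
  then show ?case by (intro exI[of _ \<Gamma>] exI[of _ "[]"]) (auto simp: cadlag_paths_def)
next
  case (Cons p ts)
  obtain t B where p: "p = (t, B)" by (cases p)
  obtain A us where us: "A \<in> sets conf_borel" "sorted_wrt (<) (0 # map fst us)" "conf_list us" "fst ` set us \<subseteq> fst ` set ts"
    "cylinder ts = {\<omega>\<in>cadlag_paths. \<omega> 0 \<in> A} \<inter> cylinder us" using Cons by auto
  have t: "0 \<le> t" and B: "B \<in> sets conf_borel" using Cons(2) by (auto simp: p)
  have eq: "cylinder (p # ts) = {\<omega>\<in>cadlag_paths. \<omega> t \<in> B} \<inter> cylinder ts" by (auto simp: p)
  show ?case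
  proof (cases "t = 0")
    case True
    have "cylinder (p # ts) = {\<omega>\<in>cadlag_paths. \<omega> 0 \<in> A \<inter> B} \<inter> cylinder us"
      unfolding eq us(5) using True by auto
    then show ?thesis using us(1-4) B by (intro exI[of _ "A \<inter> B"] exI[of _ us]) auto
  next
    case False
    then have "0 < t" using t by simp
    from cylinder_insert[OF us(2,3) this B] obtain vs where vs: "sorted_wrt (<) (0 # map fst vs)" "conf_list vs"
      "fst ` set vs \<subseteq> insert t (fst ` set us)" "cylinder vs = {\<omega>\<in>cadlag_paths. \<omega> t \<in> B} \<inter> cylinder us" by blast
    have "cylinder (p # ts) = {\<omega>\<in>cadlag_paths. \<omega> 0 \<in> A} \<inter> cylinder vs"
      unfolding eq us(5) vs(4) by auto
    moreover have "fst ` set vs \<subseteq> fst ` set (p # ts)" using vs(3) us(4) by (auto simp: p)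
    ultimately show ?thesis using us(1) vs(1,2) by (intro exI[of _ A] exI[of _ vs]) auto
  qed
qed

text \<open>For the Markov property at \<open>t\<close>, the state at \<open>t\<close> should be the
  last coordinate. If the list does not contain the time \<open>t\<close>, it is appended with the
  whole space as its set.\<close>

lemma cylinder_split_last:
  assumes "sorted_wrt (<) (0 # map fst ts)" "conf_list ts" "fst ` set ts \<subseteq> {..t}" "0 < t"
  shows "\<exists>us A. sorted_wrt (<) (0 # map fst us @ [t]) \<and> conf_list us \<and> A \<in> sets conf_borel \<and>
    cylinder ts = cylinder us \<inter> {\<omega>\<in>cadlag_paths. \<omega> t \<in> A}"
proof (cases "ts \<noteq> [] \<and> fst (last ts) = t")
  case True
  obtain us p where ts: "ts = us @ [p]" using True by (metis append_butlast_last_id)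
  obtain A where p: "p = (t, A)" using True ts by (cases p) auto
  show ?thesis using assms(1,2) by (intro exI[of _ us] exI[of _ A]) (auto simp: ts p)
next
  case False
  have "x < t" if "x \<in> set (map fst ts)" for x
  proof -
    have "ts \<noteq> []" using that by auto
    then obtain us p where ts: "ts = us @ [p]" by (metis append_butlast_last_id)
    then have "fst p < t" using False assms(3) by (auto simp: order.strict_iff_order)
    moreover have "x \<le> fst p" using that assms(1) by (auto simp: ts sorted_wrt_append less_imp_le)
    ultimately show "x < t" by simp
  qed
  then have "sorted_wrt (<) (0 # map fst ts @ [t])" using assms(1,4) by (auto simp: sorted_wrt_append)
  moreover have "cylinder ts = cylinder ts \<inter> {\<omega>\<in>cadlag_paths. \<omega> t \<in> \<Gamma>}"
    using assms(4) by (auto simp: cadlag_paths_def)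
  moreover have "\<Gamma> \<in> sets (conf_borel :: 'a set measure)" using sets.top[of conf_borel] by simp
  ultimately show ?thesis using assms(2) by (intro exI[of _ ts] exI[of _ \<Gamma>]) blast
qed

lemma shift_cadlag:
  fixes \<omega> :: "real \<Rightarrow> 'a::topological_space set"
  assumes \<omega>: "\<omega> \<in> cadlag_paths" and t: "0 \<le> t" shows "shift t \<omega> \<in> cadlag_paths"
proof -
  have val: "\<omega> s \<in> \<Gamma>" if "0 \<le> s" for s using \<omega> that by (simp add: cadlag_paths_def)
  have right: "limitin vague_topology (shift t \<omega>) (shift t \<omega> s) (at_right s)" if s: "0 \<le> s" for s
    unfolding limitin_def
  proof (intro conjI allI impI)
    show "shift t \<omega> s \<in> topspace vague_topology" using s t val by (simp add: shift_def)
    fix U assume U: "openin vague_topology U \<and> shift t \<omega> s \<in> U"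
    have "limitin vague_topology \<omega> (\<omega> (s + t)) (at_right (s + t))" using \<omega> s t by (simp add: cadlag_paths_def)
    then have "eventually (\<lambda>x. \<omega> x \<in> U) (at_right (s + t))" using U s by (simp add: limitin_def shift_def)
    then obtain b where b: "s + t < b" "\<And>y. s + t < y \<Longrightarrow> y < b \<Longrightarrow> \<omega> y \<in> U"
      unfolding eventually_at_right_field by blast
    show "eventually (\<lambda>x. shift t \<omega> x \<in> U) (at_right s)"
      unfolding eventually_at_right_field using b s by (intro exI[of _ "b - t"]) (auto simp: shift_def)
  qed
  have left: "\<exists>l. limitin vague_topology (shift t \<omega>) l (at_left s)" if s: "0 < s" for s
  proof -
    obtain l where l: "limitin vague_topology \<omega> l (at_left (s + t))"
      using \<omega> add_pos_nonneg[OF s t] unfolding cadlag_paths_def by blast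
    have "limitin vague_topology (shift t \<omega>) l (at_left s)"
      unfolding limitin_def
    proof (intro conjI allI impI)
      show "l \<in> topspace vague_topology" using l by (simp add: limitin_def)
      fix U assume U: "openin vague_topology U \<and> l \<in> U"
      then have "eventually (\<lambda>x. \<omega> x \<in> U) (at_left (s + t))" using l by (simp add: limitin_def)
      then obtain b where b: "b < s + t" "\<And>y. b < y \<Longrightarrow> y < s + t \<Longrightarrow> \<omega> y \<in> U"
        unfolding eventually_at_left_field by blast
      \<comment> \<open>\<open>shift\<close> takes the empty configuration at negative times, so the
        left neighbourhood must stay above 0.\<close>
      show "eventually (\<lambda>x. shift t \<omega> x \<in> U) (at_left s)"
        unfolding eventually_at_left_field using b s by (intro exI[of _ "max 0 (b - t)"]) (auto simp: shift_def)
    qed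
    then show ?thesis ..
  qed
  have "shift t \<omega> s = {}" if "s < 0" for s using that by (simp add: shift_def)
  then show ?thesis
    unfolding cadlag_paths_def using right left val t by (simp add: shift_def)
qed

lemma shift_vimage_cylinder:
  fixes us :: "(real \<times> 'a::topological_space set set) list"
  assumes "0 \<le> t" "\<forall>(s, A)\<in>set us. 0 \<le> s"
  shows "shift t -` cylinder us \<inter> cadlag_paths = cylinder (map (\<lambda>(s, A). (s + t, A)) us)"
proof -
  have "shift t \<omega> s = \<omega> (s + t)" if "0 \<le> s" for \<omega> :: "real \<Rightarrow> 'a set" and s
    using that by (simp add: shift_def)
  then show ?thesis using assms by (auto simp: shift_cadlag split_beta)
qed

lemma measurable_shift:
  assumes t: "0 \<le> t" shows "shift t \<in> measurable path_F (path_F :: (real \<Rightarrow> 'a::topological_space set) measure)"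
proof (rule measurable_sigma_sets[OF sigma_cylinders cylinders_subset])
  show "shift t \<in> space path_F \<rightarrow> cadlag_paths" using shift_cadlag[OF _ t] by auto
  fix y :: "(real \<Rightarrow> 'a set) set" assume "y \<in> cylinders {0..}"
  then obtain us :: "(real \<times> 'a set set) list" where y: "y = cylinder us" and us: "\<forall>(s, A)\<in>set us. s \<in> {0..} \<and> A \<in> sets conf_borel"
    unfolding cylinders_def by blast
  have "shift t -` y \<inter> space path_F = cylinder (map (\<lambda>(s, A). (s + t, A)) us)"
    unfolding y space_path_sigma using us by (intro shift_vimage_cylinder t) auto
  then show "shift t -` y \<inter> space path_F \<in> sets path_F"
    using us t by (simp only:) (rule cylinder_sets, auto)
qed

section \<open>Consequences of the cylinder probabilities\<close>

context radon_space
begin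

text \<open>The starting condition makes the constraint at time 0 almost surely constant, so it
  becomes the factor \<open>indicator A \<gamma>\<close>. The family \<open>Q\<close> is arbitrary
  because uniqueness compares two of them.\<close>

lemma process_cylinder:
  assumes Q: "process_law m Q" and \<gamma>: "\<gamma> \<in> \<Gamma>" and A: "A \<in> sets conf_borel"
    and us: "sorted_wrt (<) (0 # map fst us)" "conf_list us"
  shows "emeasure (Q \<gamma>) ({\<omega>\<in>cadlag_paths. \<omega> 0 \<in> A} \<inter> cylinder us) = indicator A \<gamma> * fdd m \<gamma> 0 us"
    and "AE \<omega> in Q \<gamma>. \<omega> 0 = \<gamma>"
proof -
  interpret P: prob_space "Q \<gamma>" using Q \<gamma> by (simp add: process_law_def)
  have sets_Q: "sets (Q \<gamma>) = sets path_F" and start: "emeasure (Q \<gamma>) {\<omega>\<in>cadlag_paths. \<omega> 0 = \<gamma>} = 1"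
    using Q \<gamma> by (auto simp: process_law_def)
  have fdd: "emeasure (Q \<gamma>) (cylinder us) = fdd m \<gamma> 0 us"
    using Q \<gamma> us unfolding process_law_def by (auto simp: split_beta)
  show AE: "AE \<omega> in Q \<gamma>. \<omega> 0 = \<gamma>"
    using P.AE_prob_1[of "{\<omega>\<in>cadlag_paths. \<omega> 0 = \<gamma>}"] start by (auto simp: measure_def elim: eventually_mono)
  have cyl: "cylinder us \<in> sets (Q \<gamma>)"
    unfolding sets_Q using us by (intro cylinder_sets) (auto simp: split_beta less_imp_le)
  have ev: "{\<omega>\<in>cadlag_paths. \<omega> 0 \<in> A} \<in> sets (Q \<gamma>)" unfolding sets_Q by (intro eval_sets A) simp
  show "emeasure (Q \<gamma>) ({\<omega>\<in>cadlag_paths. \<omega> 0 \<in> A} \<inter> cylinder us) = indicator A \<gamma> * fdd m \<gamma> 0 us"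
  proof (cases "\<gamma> \<in> A")
    case True
    have "emeasure (Q \<gamma>) ({\<omega>\<in>cadlag_paths. \<omega> 0 \<in> A} \<inter> cylinder us) = emeasure (Q \<gamma>) (cylinder us)"
      using AE cyl ev True by (intro emeasure_eq_AE sets.Int) (auto elim: eventually_mono)
    then show ?thesis using True fdd by simp
  next
    case False
    have "emeasure (Q \<gamma>) ({\<omega>\<in>cadlag_paths. \<omega> 0 \<in> A} \<inter> cylinder us) = emeasure (Q \<gamma>) {}"
      using AE cyl ev False by (intro emeasure_eq_AE sets.Int) (auto elim: eventually_mono)
    then show ?thesis using False by simp
  qed
qed

lemma process_law_unique:
  assumes P: "process_law m P" and Q: "process_law m Q" and \<gamma>: "\<gamma> \<in> \<Gamma>"
  shows "Q \<gamma> = P \<gamma>"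
proof (rule measure_eqI_generator_eq[OF Int_stable_cylinders cylinders_subset, where A="\<lambda>_. cadlag_paths"])
  interpret Q: prob_space "Q \<gamma>" using Q \<gamma> by (simp add: process_law_def)
  show "range (\<lambda>_. cadlag_paths) \<subseteq> cylinders {0..}" using cadlag_in_cylinders by auto
  show "emeasure (Q \<gamma>) cadlag_paths \<noteq> \<infinity>" using Q.emeasure_finite[of cadlag_paths] by simp
  show "sets (Q \<gamma>) = sigma_sets cadlag_paths (cylinders {0..})" "sets (P \<gamma>) = sigma_sets cadlag_paths (cylinders {0..})"
    using P Q \<gamma> by (auto simp: process_law_def sigma_cylinders[symmetric])
  fix S :: "(real \<Rightarrow> 'a set) set" assume "S \<in> cylinders {0..}"
  then obtain ts :: "(real \<times> 'a set set) list" where S: "S = cylinder ts" and ts: "\<forall>(t, A)\<in>set ts. 0 \<le> t \<and> A \<in> sets conf_borel"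
    unfolding cylinders_def by (auto simp: split_beta)
  obtain A us where "A \<in> sets conf_borel" "sorted_wrt (<) (0 # map fst us)" "conf_list us"
    "cylinder ts = {\<omega>\<in>cadlag_paths. \<omega> 0 \<in> A} \<inter> cylinder us"
    using cylinder_normal_form[OF ts] by blast
  then show "emeasure (Q \<gamma>) S = emeasure (P \<gamma>) S"
    unfolding S using process_cylinder(1)[OF P \<gamma>] process_cylinder(1)[OF Q \<gamma>] by simp
qed auto

text \<open>On cylinders in normal form the probability is an indicator times \<open>fdd\<close>,
  both measurable in the starting point. The kernel form is what binding with
  \<open>path_law (\<omega> t)\<close> requires.\<close>

lemma measurable_path_law: "path_law \<in> measurable conf_borel (prob_algebra path_F)"
proof (rule measurable_prob_algebra_generated[OF sigma_cylinders Int_stable_cylinders cylinders_subset])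
  fix S :: "(real \<Rightarrow> 'a set) set" assume "S \<in> cylinders {0..}"
  then obtain ts :: "(real \<times> 'a set set) list" where S: "S = cylinder ts" and ts: "\<forall>(t, A)\<in>set ts. 0 \<le> t \<and> A \<in> sets conf_borel"
    unfolding cylinders_def by (auto simp: split_beta)
  obtain A us where us: "A \<in> sets conf_borel" "sorted_wrt (<) (0 # map fst us)" "conf_list us"
    and eq: "cylinder ts = {\<omega>\<in>cadlag_paths. \<omega> 0 \<in> A} \<inter> cylinder us"
    using cylinder_normal_form[OF ts] by blast
  note [measurable] = us(1) measurable_fdd[OF us(2,3)]
  have "(\<lambda>\<gamma>. indicator A \<gamma> * fdd m \<gamma> 0 us) \<in> borel_measurable conf_borel" by measurable
  moreover have "emeasure (path_law \<gamma>) S = indicator A \<gamma> * fdd m \<gamma> 0 us" if "\<gamma> \<in> space conf_borel" for \<gamma>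
    unfolding S eq using that by (intro process_cylinder(1)[OF process_law_path_law _ us]) simp
  ultimately show "(\<lambda>\<gamma>. emeasure (path_law \<gamma>) S) \<in> borel_measurable conf_borel"
    by (simp only: cong: measurable_cong)
qed (use prob_space_path_law sets_path_law in auto)

lemma measurable_emeasure_path_law:
  "B \<in> sets path_F \<Longrightarrow> (\<lambda>\<gamma>. emeasure (path_law \<gamma>) B) \<in> borel_measurable conf_borel"
  by (rule measurable_compose[OF measurable_prob_algebraD[OF measurable_path_law] measurable_emeasure_subprob_algebra])

text \<open>In normal form, the past ends with a constraint on the state at \<open>t\<close> and the
  shifted future begins with one. Cutting there by \<open>fdd_append\<close> gives an integral over
  that state, and homogeneity (\<open>fdd_shift\<close>) moves the future back to time 0.\<close>

lemma markov_cylinder: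
  assumes \<gamma>: "\<gamma> \<in> \<Gamma>" and t: "0 \<le> t"
    and ts: "\<forall>(s, A)\<in>set ts. s \<in> {0..t} \<and> A \<in> sets conf_borel"
    and us: "\<forall>(s, A)\<in>set us. 0 \<le> s \<and> A \<in> sets conf_borel"
  shows "emeasure (path_law \<gamma>) (cylinder ts \<inter> (shift t -` cylinder us \<inter> cadlag_paths)) =
    (\<integral>\<^sup>+\<omega>. indicator (cylinder ts) \<omega> * emeasure (path_law (\<omega> t)) (cylinder us) \<partial>path_law \<gamma>)"
proof -
  interpret P: prob_space "path_law \<gamma>" by (rule prob_space_path_law[OF \<gamma>])
  have sp: "space (path_law \<gamma>) = cadlag_paths" by (simp add: path_law_def)
  have start: "AE \<omega> in path_law \<gamma>. \<omega> 0 = \<gamma>"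
    using process_cylinder(2)[OF process_law_path_law \<gamma> sets.top, of "[]"] by simp
  obtain A vs where vs: "A \<in> sets conf_borel" "sorted_wrt (<) (0 # map fst vs)" "conf_list vs" "fst ` set vs \<subseteq> fst ` set ts"
    and A: "cylinder ts = {\<omega>\<in>cadlag_paths. \<omega> 0 \<in> A} \<inter> cylinder vs"
    using cylinder_normal_form[of ts] ts by (auto simp: split_beta)
  obtain B ws where ws: "B \<in> sets conf_borel" "sorted_wrt (<) (0 # map fst ws)" "conf_list ws" "fst ` set ws \<subseteq> fst ` set us"
    and B: "cylinder us = {\<omega>\<in>cadlag_paths. \<omega> 0 \<in> B} \<inter> cylinder ws"
    using cylinder_normal_form[OF us] by blast
  have Pus: "emeasure (path_law \<eta>) (cylinder us) = indicator B \<eta> * fdd m \<eta> 0 ws" if "\<eta> \<in> \<Gamma>" for \<eta>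
    unfolding B by (rule process_cylinder(1)[OF process_law_path_law that ws(1-3)])
  define ws' where "ws' = map (\<lambda>(s, A). (s + t, A)) ws"
  have ws_pos: "\<forall>(s, A)\<in>set ws. 0 \<le> s" using ws(2) by (auto simp: split_beta less_imp_le)
  have "shift t -` cylinder us \<inter> cadlag_paths = {\<omega>\<in>cadlag_paths. \<omega> t \<in> B} \<inter> (shift t -` cylinder ws \<inter> cadlag_paths)"
    unfolding B using shift_cadlag[OF _ t] by (auto simp: shift_def)
  then have sh: "shift t -` cylinder us \<inter> cadlag_paths = {\<omega>\<in>cadlag_paths. \<omega> t \<in> B} \<inter> cylinder ws'"
    unfolding shift_vimage_cylinder[OF t ws_pos] ws'_def .
  show ?thesis
  proof (cases "t = 0")
    \<comment> \<open>The cut is made at a positive time, so \<open>t = 0\<close> is separate: the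
      past then reduces to a condition on the initial state, which is almost surely
      \<open>\<gamma>\<close>.\<close>
    case True
    have "fst ` set ts \<subseteq> {0}" using ts True by auto
    then have "fst ` set vs \<subseteq> {0}" using vs(4) by (rule subset_trans[rotated])
    then have "vs = []" using vs(2) by (cases vs) auto
    have ws'_eq: "ws' = ws" by (simp add: ws'_def True split_beta)
    have "emeasure (path_law \<gamma>) (cylinder ts \<inter> (shift t -` cylinder us \<inter> cadlag_paths)) =
      emeasure (path_law \<gamma>) ({\<omega>\<in>cadlag_paths. \<omega> 0 \<in> A \<inter> B} \<inter> cylinder ws)"
      unfolding sh A ws'_eq by (intro arg_cong2[where f=emeasure] refl) (auto simp: True \<open>vs = []\<close>)
    also have "\<dots> = indicator A \<gamma> * (indicator B \<gamma> * fdd m \<gamma> 0 ws)"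
      using vs(1) ws process_cylinder(1)[OF process_law_path_law \<gamma>, of "A \<inter> B" ws]
      by (auto simp: indicator_inter_arith mult.assoc)
    also have "\<dots> = (\<integral>\<^sup>+\<omega>. indicator A \<gamma> * (indicator B \<gamma> * fdd m \<gamma> 0 ws) \<partial>path_law \<gamma>)"
      by (simp add: P.emeasure_space_1)
    also have "\<dots> = (\<integral>\<^sup>+\<omega>. indicator (cylinder ts) \<omega> * emeasure (path_law (\<omega> t)) (cylinder us) \<partial>path_law \<gamma>)"
      using start AE_space[of "path_law \<gamma>"]
    proof (intro nn_integral_cong_AE, eventually_elim)
      case (elim \<omega>)
      then have "indicator (cylinder ts) \<omega> = (indicator A \<gamma> :: ennreal)"
        unfolding A \<open>vs = []\<close> sp by (auto split: split_indicator)
      then show ?case using elim Pus[OF \<gamma>] True by simp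
    qed
    finally show ?thesis .
  next
    case False
    then have tpos: "0 < t" using t by simp
    have "fst ` set ts \<subseteq> {..t}" using ts by auto
    then have "fst ` set vs \<subseteq> {..t}" using vs(4) by (rule subset_trans[rotated])
    from cylinder_split_last[OF vs(2,3) this tpos] obtain pre C where
      pre: "sorted_wrt (<) (0 # map fst pre @ [t])" "conf_list pre" "C \<in> sets conf_borel"
      and C: "cylinder vs = cylinder pre \<inter> {\<omega>\<in>cadlag_paths. \<omega> t \<in> C}" by blast
    have srtw: "sorted_wrt (<) (t # map fst ws')" and cw: "conf_list ws'"
      using ws(2,3) by (auto simp: ws'_def comp_def split_beta sorted_wrt_map)
    have srt: "sorted_wrt (<) (0 # map fst pre @ t # map fst ws')"
      using pre(1) srtw by (auto simp: sorted_wrt_append intro: less_trans)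
    have CB: "C \<inter> B \<in> sets conf_borel" using pre ws by auto
    have shiftw: "fdd m \<eta> t ws' = fdd m \<eta> 0 ws" for \<eta>
      using fdd_shift[of \<eta> 0 t ws] by (simp add: ws'_def)
    have pos: "\<forall>(s, A)\<in>set pre. 0 \<le> s \<and> A \<in> sets conf_borel"
      using pre by (auto simp: split_beta less_imp_le)
    have mf: "(\<lambda>\<eta>. indicator (C \<inter> B) \<eta> * fdd m \<eta> t ws') \<in> borel_measurable conf_borel"
      using measurable_fdd[OF srtw cw] CB by measurable
    have "emeasure (path_law \<gamma>) (cylinder ts \<inter> (shift t -` cylinder us \<inter> cadlag_paths)) =
      emeasure (path_law \<gamma>) ({\<omega>\<in>cadlag_paths. \<omega> 0 \<in> A} \<inter> cylinder (pre @ (t, C \<inter> B) # ws'))"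
      unfolding sh A C by (intro arg_cong2[where f=emeasure] refl) auto
    also have "\<dots> = indicator A \<gamma> * fdd m \<gamma> 0 (pre @ (t, C \<inter> B) # ws')"
      using srt pre(2) CB cw by (intro process_cylinder(1)[OF process_law_path_law \<gamma> vs(1)]) auto
    also have "fdd m \<gamma> 0 (pre @ (t, C \<inter> B) # ws') = (\<integral>\<^sup>+\<eta>. indicator (C \<inter> B) \<eta> * fdd m \<eta> t ws' \<partial>path_at \<gamma> pre t)"
      unfolding path_at_eq_kernel[OF \<gamma> pre(1,2)] by (rule fdd_append[OF srt pre(2) cw CB \<gamma>])
    also have "\<dots> = (\<integral>\<^sup>+\<omega>. indicator (cylinder pre) \<omega> * (indicator (C \<inter> B) (\<omega> t) * fdd m (\<omega> t) t ws') \<partial>path_law \<gamma>)"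
      by (rule path_at_integral[OF pos t mf])
    also have "indicator A \<gamma> * \<dots> = (\<integral>\<^sup>+\<omega>. indicator A \<gamma> * (indicator (cylinder pre) \<omega> * (indicator (C \<inter> B) (\<omega> t) * fdd m (\<omega> t) t ws')) \<partial>path_law \<gamma>)"
    proof (rule nn_integral_cmult[symmetric])
      have ev: "(\<lambda>\<omega>. \<omega> t) \<in> measurable (path_law \<gamma>) conf_borel"
        using measurable_eval[of "{0..}" t] t by (simp add: measurable_cong_sets[OF sets_path_law refl])
      have cyl: "cylinder pre \<in> sets (path_law \<gamma>)"
        unfolding sets_path_law using pos by (intro cylinder_sets) auto
      show "(\<lambda>\<omega>. indicator (cylinder pre) \<omega> * (indicator (C \<inter> B) (\<omega> t) * fdd m (\<omega> t) t ws')) \<in> borel_measurable (path_law \<gamma>)"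
        by (rule borel_measurable_times_ennreal[OF borel_measurable_indicator[OF cyl] measurable_compose[OF ev mf]])
    qed
    also have "\<dots> = (\<integral>\<^sup>+\<omega>. indicator (cylinder ts) \<omega> * emeasure (path_law (\<omega> t)) (cylinder us) \<partial>path_law \<gamma>)"
      using start AE_space[of "path_law \<gamma>"]
    proof (intro nn_integral_cong_AE, eventually_elim)
      case (elim \<omega>)
      then have w: "\<omega> \<in> cadlag_paths" "\<omega> t \<in> \<Gamma>" "\<omega> 0 = \<gamma>" using t by (auto simp: sp cadlag_paths_def)
      have "indicator (cylinder ts) \<omega> = (indicator A \<gamma> * (indicator (cylinder pre) \<omega> * indicator C (\<omega> t)) :: ennreal)"
        unfolding A C using w by (auto split: split_indicator)
      then show ?case unfolding Pus[OF w(2)] shiftw by (simp add: indicator_inter_arith mult_ac)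
    qed
    finally show ?thesis .
  qed
qed

text \<open>The identity is extended in two rounds. With \<open>A\<close> a cylinder, both sides are
  measures in \<open>B\<close>; afterwards, with \<open>B\<close> arbitrary, both are measures in
  \<open>A\<close> on the sigma-algebra up to time \<open>t\<close>.\<close>

lemma markov_property:
  assumes \<gamma>: "\<gamma> \<in> \<Gamma>" and t: "0 \<le> t" and A: "A \<in> sets (path_Ft t)" and B: "B \<in> sets path_F"
  shows "emeasure (path_law \<gamma>) (A \<inter> (shift t -` B \<inter> cadlag_paths)) =
    (\<integral>\<^sup>+\<omega>. indicator A \<omega> * emeasure (path_law (\<omega> t)) B \<partial>path_law \<gamma>)"
proof -
  interpret P: prob_space "path_law \<gamma>" by (rule prob_space_path_law[OF \<gamma>])
  have sp: "space (path_law \<gamma>) = cadlag_paths" by (simp add: path_law_def)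
  have ev: "(\<lambda>\<omega>. \<omega> t) \<in> measurable (path_law \<gamma>) conf_borel"
    using measurable_eval[of "{0..}" t] t by (simp add: measurable_cong_sets[OF sets_path_law refl])
  have sh: "shift t \<in> measurable (path_law \<gamma>) path_F"
    using measurable_shift[OF t] by (simp only: measurable_cong_sets[OF sets_path_law refl])
  have shB: "shift t -` B \<inter> cadlag_paths \<in> sets (path_law \<gamma>)" if "B \<in> sets path_F" for B
    using measurable_sets[OF sh that] by (simp add: sp)
  have PB: "(\<lambda>\<omega>. emeasure (path_law (\<omega> t)) B) \<in> borel_measurable (path_law \<gamma>)" if "B \<in> sets path_F" for B
    by (rule measurable_compose[OF ev measurable_emeasure_path_law[OF that]])
  have ker: "(\<lambda>\<omega>. path_law (\<omega> t)) \<in> measurable (path_law \<gamma>) (subprob_algebra path_F)"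
    by (rule measurable_compose[OF ev measurable_prob_algebraD[OF measurable_path_law]])
  have sub: "(\<lambda>\<omega>. \<omega>) \<in> measurable (path_law \<gamma>) (path_Ft t)"
  proof (rule measurable_sigma_sets[OF sigma_cylinders cylinders_subset])
    fix y :: "(real \<Rightarrow> 'a set) set" assume "y \<in> cylinders {0..t}"
    then obtain ts :: "(real \<times> 'a set set) list" where y: "y = cylinder ts" "\<forall>(s, A)\<in>set ts. s \<in> {0..t} \<and> A \<in> sets conf_borel"
      unfolding cylinders_def by blast
    then have "y \<in> sets path_F" unfolding y(1) by (intro cylinder_sets) auto
    moreover have "(\<lambda>\<omega>. \<omega>) -` y \<inter> space (path_law \<gamma>) = y" unfolding sp y(1) by auto
    ultimately show "(\<lambda>\<omega>. \<omega>) -` y \<inter> space (path_law \<gamma>) \<in> sets (path_law \<gamma>)" by (simp add: sets_path_law)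
  qed (simp add: sp)
  have Ft: "A \<in> sets (path_law \<gamma>)" if "A \<in> sets (path_Ft t)" for A
  proof -
    have "A \<subseteq> cadlag_paths" using sets.sets_into_space[OF that] by simp
    then show ?thesis using measurable_sets[OF sub that] by (simp add: sp Int_absorb2)
  qed
  have step1: "emeasure (path_law \<gamma>) (A \<inter> (shift t -` B \<inter> cadlag_paths)) =
      (\<integral>\<^sup>+\<omega>. indicator A \<omega> * emeasure (path_law (\<omega> t)) B \<partial>path_law \<gamma>)"
    if A: "A \<in> cylinders {0..t}" and B: "B \<in> sets path_F" for A B
  proof -
    have A': "A \<in> sets (path_law \<gamma>)" by (rule Ft) (simp add: sigma_cylinders A sigma_sets.Basic)
    \<comment> \<open>As a measure in \<open>B\<close>, the left side is an image under the shift,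
      while the right side restarts the process from the state at \<open>t\<close>.\<close>
    let ?L = "distr (density (path_law \<gamma>) (indicator A)) path_F (shift t)"
    let ?R = "density (path_law \<gamma>) (indicator A) \<bind> (\<lambda>\<omega>. path_law (\<omega> t))"
    have L: "emeasure ?L B = emeasure (path_law \<gamma>) (A \<inter> (shift t -` B \<inter> cadlag_paths))" if "B \<in> sets path_F" for B
      using A' sh that shB[OF that] by (subst emeasure_distr) (simp_all add: emeasure_restricted sp)
    have R: "emeasure ?R B = (\<integral>\<^sup>+\<omega>. indicator A \<omega> * emeasure (path_law (\<omega> t)) B \<partial>path_law \<gamma>)" if "B \<in> sets path_F" for B
      using A' ker PB[OF that] that P.not_empty by (subst emeasure_bind[where N=path_F]) (auto simp: nn_integral_density)
    have "?L = ?R"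
    proof (rule measure_eqI_generator_eq[OF Int_stable_cylinders cylinders_subset, where A="\<lambda>_. cadlag_paths"])
      show "range (\<lambda>_. cadlag_paths) \<subseteq> cylinders {0..}" using cadlag_in_cylinders by auto
      show "sets ?L = sigma_sets cadlag_paths (cylinders {0..})" by (simp add: sigma_cylinders)
      show "sets ?R = sigma_sets cadlag_paths (cylinders {0..})"
        using P.not_empty ker by (subst sets_bind[where N=path_F]) (auto simp: sigma_cylinders[symmetric] sets_path_law)
      have "cadlag_paths \<in> sets path_F" using sets.top[of path_F] by simp
      then show "emeasure ?L cadlag_paths \<noteq> \<infinity>" by (subst L) auto
      fix S :: "(real \<Rightarrow> 'a set) set" assume S: "S \<in> cylinders {0..}"
      then have S': "S \<in> sets path_F" by (simp add: sigma_cylinders sigma_sets.Basic)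
      obtain us :: "(real \<times> 'a set set) list" where us: "S = cylinder us" "\<forall>(s, A)\<in>set us. 0 \<le> s \<and> A \<in> sets conf_borel"
        using S unfolding cylinders_def by (auto simp: split_beta)
      obtain ts :: "(real \<times> 'a set set) list" where ts: "A = cylinder ts" "\<forall>(s, A)\<in>set ts. s \<in> {0..t} \<and> A \<in> sets conf_borel"
        using A unfolding cylinders_def by blast
      have "emeasure (path_law \<gamma>) (A \<inter> (shift t -` S \<inter> cadlag_paths)) =
          (\<integral>\<^sup>+\<omega>. indicator A \<omega> * emeasure (path_law (\<omega> t)) S \<partial>path_law \<gamma>)"
        unfolding us(1) ts(1) by (rule markov_cylinder[OF \<gamma> t ts(2) us(2)])
      then show "emeasure ?L S = emeasure ?R S" by (simp only: L[OF S'] R[OF S'])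
    qed simp
    then show ?thesis using L[OF B] R[OF B] by simp
  qed
  let ?S = "shift t -` B \<inter> cadlag_paths"
  \<comment> \<open>Taking the image under the identity into \<open>path_Ft t\<close> restricts both
    measures to the smaller sigma-algebra.\<close>
  let ?L = "distr (density (path_law \<gamma>) (indicator ?S)) (path_Ft t) (\<lambda>\<omega>. \<omega>)"
  let ?R = "distr (density (path_law \<gamma>) (\<lambda>\<omega>. emeasure (path_law (\<omega> t)) B)) (path_Ft t) (\<lambda>\<omega>. \<omega>)"
  have L: "emeasure ?L A = emeasure (path_law \<gamma>) (A \<inter> ?S)" if "A \<in> sets (path_Ft t)" for A
  proof -
    have "(\<lambda>\<omega>. \<omega>) -` A \<inter> cadlag_paths = A" using sets.sets_into_space[OF that] by auto
    then show ?thesis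
      using that sub shB[OF B] Ft[OF that] by (subst emeasure_distr) (simp_all add: emeasure_restricted sp Int_commute)
  qed
  have R: "emeasure ?R A = (\<integral>\<^sup>+\<omega>. indicator A \<omega> * emeasure (path_law (\<omega> t)) B \<partial>path_law \<gamma>)" if "A \<in> sets (path_Ft t)" for A
  proof -
    have "(\<lambda>\<omega>. \<omega>) -` A \<inter> cadlag_paths = A" using sets.sets_into_space[OF that] by auto
    then show ?thesis
      using that sub PB[OF B] Ft[OF that] by (subst emeasure_distr) (auto simp: emeasure_density sp mult.commute)
  qed
  have "?L = ?R"
  proof (rule measure_eqI_generator_eq[OF Int_stable_cylinders cylinders_subset, where A="\<lambda>_. cadlag_paths"])
    show "range (\<lambda>_. cadlag_paths) \<subseteq> cylinders {0..t}" using cadlag_in_cylinders by auto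
    show "sets ?L = sigma_sets cadlag_paths (cylinders {0..t})" "sets ?R = sigma_sets cadlag_paths (cylinders {0..t})"
      by (simp_all add: sigma_cylinders)
    have "cadlag_paths \<in> sets (path_Ft t)" using sets.top[of "path_Ft t"] by simp
    then show "emeasure ?L cadlag_paths \<noteq> \<infinity>" by (subst L) auto
    fix A :: "(real \<Rightarrow> 'a set) set" assume A: "A \<in> cylinders {0..t}"
    then have "A \<in> sets (path_Ft t)" by (simp add: sigma_cylinders sigma_sets.Basic)
    then show "emeasure ?L A = emeasure ?R A" using L R step1[OF A B] by simp
  qed simp
  then show ?thesis using L[OF A] R[OF A] by simp
qed

end

theorem theorem4:
  fixes m :: "'a::{t2_space, second_countable_topology} measure"
  assumes "locally_compact_space (euclidean :: 'a topology)"
    and "sets m = sets borel"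
    and "\<And>K. compact K \<Longrightarrow> emeasure m K < \<infinity>"
    and "\<And>x. emeasure m {x} = 0"
  shows "\<exists>P. process_law m P \<and> markov_family P \<and>
           (\<forall>Q. process_law m Q \<longrightarrow> (\<forall>\<gamma>\<in>\<Gamma>. Q \<gamma> = P \<gamma>))"
proof -
  interpret radon_space m
    by unfold_locales (use assms in auto)
  have "markov_family path_law"
    unfolding markov_family_def using measurable_emeasure_path_law markov_property by blast
  then show ?thesis
    using process_law_path_law process_law_unique by blast
qed

end
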